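(* Let $K$ be a field of characteristic zero containing a primitive cubic root of unity $\zeta_3$. Let $X=\mathrm{Aff}(3,-1)$ and let $q\equiv\zeta_3$ be the constant $2$-cocycle. Then $$\Gamma_n(\mathcal{B}(X,q))=\begin{cases}\mathbb{P}^2\times\mathbb{P}^2 & \text{if } n=2,\\ 90\ \text{points} & \text{if } n=3,\\ 36\ \text{points} & \text{if } n=4,\\ \emptyset & \text{if } n\ge 5.\end{cases}$$
   Context: $\mathrm{Aff}(3,-1)$ is the rack with underlying set $\{x_g : g\in\mathbb{F}_3\}$ and $x_g\triangleright x_h=x_{2g-h}$; it is isomorphic to the conjugacy class of transpositions in $\mathbb{S}_3$ with $x\triangleright y=xyx^{-1}$. Nichols algebras. A $2$-cocycle of a finite rack $(X,\triangleright)$ over $K$ is a map $q\colon X\times X\to K^\times$, $(x,y)\mapsto q_{x,y}$, with $q_{x,y\triangleright z}\,q_{y,z}=q_{x\triangleright y,x\triangleright z}\,q_{x,z}$ for all $x,y,z\in X$ (constant maps are $2$-cocycles). Let $V=KX$ be the vector space with basis $X$ and let $c\in \mathrm{GL}(V\otimes V)$, $c(x\otimes y)=q_{x,y}\,(x\triangleright y)\otimes x$. On $V^{\otimes n}$ let $c_i$ act as $c$ on the tensor factors $i,i+1$ and as the identity elsewhere. Define $\mathcal{S}_1=I$ and $\mathcal{S}_{n+1}=(I\otimes\mathcal{S}_n)(I+c_1+c_1c_2+\cdots+c_1c_2\cdots c_n)$; in particular $\mathcal{S}_2=I+c_1$. The Nichols algebra is the graded algebra $\mathcal{B}(X,q)=K\oplus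 V\oplus\bigoplus_{n\ge 2}V^{\otimes n}/\ker\mathcal{S}_n$, a quotient of the tensor algebra $T(V)$. Truncated point modules. For a connected graded $K$-algebra $A$ generated in degree one by $x_1,\dots,x_d$, an $n$-truncated point module is a graded (left) $A$-module generated in degree $0$ with Hilbert series $1+t+\cdots+t^n$. $\Gamma_n(A)$ denotes the set of $n$-truncated point modules over $A$ up to graded isomorphism. It is identified with a subset of $(\mathbb{P}^{d-1}(K))^n$: if $M=Ke_0\oplus\cdots\oplus Ke_n$ with $e_j$ homogeneous of degree $j$ and $x_i\cdot e_j=\lambda_{i,j}e_{j+1}$, then $M$ corresponds to $([\lambda_{1,0}:\cdots:\lambda_{d,0}],\dots,[\lambda_{1,n-1}:\cdots:\lambda_{d,n-1}])$. Here $d=3$, and $\mathbb{P}^2\times\mathbb{P}^2$ is meant under this identification (i.e. every pair of points occurs). *)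

theory Defs
  imports
    "HOL-Library.Poly_Mapping"
    "HOL-Library.Numeral_Type"
    "HOL-Algebra.QuotRing"
    "HOL-Algebra.Algebraic_Closure_Type"
begin

section \<open>Racks and cocycles\<close>

definition is_rack :: "('x \<Rightarrow> 'x \<Rightarrow> 'x) \<Rightarrow> bool" where
  "is_rack r \<longleftrightarrow> (\<forall>x. bij (r x)) \<and> (\<forall>x y z. r x (r y z) = r (r x y) (r x z))"

definition is_2cocycle :: "('x \<Rightarrow> 'x \<Rightarrow> 'x) \<Rightarrow> ('x \<Rightarrow> 'x \<Rightarrow> 'k::field) \<Rightarrow> bool" where
  "is_2cocycle r q \<longleftrightarrow>
     (\<forall>x y. q x y \<noteq> 0) \<and> (\<forall>x y z. q x (r y z) * q y z = q (r x y) (r x z) * q x z)"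

text \<open>The type \<^typ>\<open>3\<close> is the ring of integers modulo 3; the element \<open>x\<^sub>g\<close> of
  \<open>Aff(3,-1)\<close> is represented by \<open>g\<close> itself.\<close>

definition aff3 :: "3 \<Rightarrow> 3 \<Rightarrow> 3" where
  "aff3 g h = 2 * g - h"

lemma is_rack_aff3: "is_rack aff3"
  unfolding is_rack_def
proof (intro conjI allI)
  fix g :: 3
  show "bij (aff3 g)"
    by (rule o_bij[of "aff3 g"]) (auto simp: aff3_def fun_eq_iff)
qed (simp add: aff3_def algebra_simps)

lemma is_2cocycle_const: "c \<noteq> 0 \<Longrightarrow> is_2cocycle r (\<lambda>_ _. c)"
  by (simp add: is_2cocycle_def)


section \<open>The tensor algebra\<close>

text \<open>For \<open>V = KX\<close>, with \<open>X\<close> all of the type \<open>'x\<close>, the tensor algebra \<open>T(V)\<close> is the monoid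
  algebra over \<open>K\<close> of the free monoid of words in \<open>X\<close>; the word \<open>x\<^sub>1\<dots>x\<^sub>n\<close> is the basis
  vector \<open>x\<^sub>1 \<otimes> \<dots> \<otimes> x\<^sub>n\<close> of the \<open>n\<close>-th tensor power. Its ring structure is the convolution
  product of \<open>'x word \<Rightarrow>\<^sub>0 'k\<close>.\<close>

datatype 'x word = Word (letters: "'x list")

instantiation word :: (type) monoid_add
begin

definition zero_word :: "'a word" where
  "zero_word = Word []"

definition plus_word :: "'a word \<Rightarrow> 'a word \<Rightarrow> 'a word" where
  "plus_word u v = Word (letters u @ letters v)"

instance
  by standard (auto simp: zero_word_def plus_word_def)

end

type_synonym ('x, 'k) tensor = "'x word \<Rightarrow>\<^sub>0 'k"

definition basis :: "'x list \<Rightarrow> ('x, 'k::field) tensor" where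
  "basis xs = Poly_Mapping.single (Word xs) 1"

definition pscale :: "'k \<Rightarrow> ('b \<Rightarrow>\<^sub>0 'k::field) \<Rightarrow> ('b \<Rightarrow>\<^sub>0 'k)" where
  "pscale c f = Poly_Mapping.map ((*) c) f"

lemma lookup_pscale [simp]: "Poly_Mapping.lookup (pscale c f) b = c * Poly_Mapping.lookup f b"
  by (simp add: pscale_def Poly_Mapping.map.rep_eq when_def)

lemma vector_space_pscale: "vector_space (pscale :: 'k::field \<Rightarrow> ('b \<Rightarrow>\<^sub>0 'k) \<Rightarrow> ('b \<Rightarrow>\<^sub>0 'k))"
  by unfold_locales (auto intro!: poly_mapping_eqI simp: lookup_add algebra_simps)

definition linear_ext :: "('x list \<Rightarrow> ('x, 'k::field) tensor) \<Rightarrow> ('x, 'k) tensor \<Rightarrow> ('x, 'k) tensor" where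
  "linear_ext \<phi> f = (\<Sum>w\<in>Poly_Mapping.keys f. pscale (Poly_Mapping.lookup f w) (\<phi> (letters w)))"

definition tensor_power :: "nat \<Rightarrow> ('x, 'k::field) tensor set" where
  "tensor_power n = {f. \<forall>w\<in>Poly_Mapping.keys f. length (letters w) = n}"

definition homogeneous_part :: "nat \<Rightarrow> ('x, 'k::field) tensor \<Rightarrow> ('x, 'k) tensor" where
  "homogeneous_part n = linear_ext (\<lambda>xs. if length xs = n then basis xs else 0)"


section \<open>Quantum symmetrizers and the Nichols algebra\<close>

text \<open>The braiding on the tensor factors \<open>i\<close> and \<open>i + 1\<close>, counted from 1; it is only meant to
  be applied to tensors of degree at least \<open>i + 1\<close>. List indices start at 0.\<close>

definition braid :: "('x \<Rightarrow> 'x \<Rightarrow> 'x) \<Rightarrow> ('x \<Rightarrow> 'x \<Rightarrow> 'k::field) \<Rightarrow> nat \<Rightarrow>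
    ('x, 'k) tensor \<Rightarrow> ('x, 'k) tensor" where
  "braid r q i = linear_ext (\<lambda>xs.
     let x = xs ! (i - 1); y = xs ! i
     in pscale (q x y) (basis (xs[i - 1 := r x y, i := x])))"

text \<open>The composition \<open>c\<^sub>1 c\<^sub>2 \<dots> c\<^sub>k\<close>, in which \<open>c\<^sub>k\<close> is applied first.\<close>

primrec braid_prod :: "('x \<Rightarrow> 'x \<Rightarrow> 'x) \<Rightarrow> ('x \<Rightarrow> 'x \<Rightarrow> 'k::field) \<Rightarrow> nat \<Rightarrow>
    ('x, 'k) tensor \<Rightarrow> ('x, 'k) tensor" where
  "braid_prod r q 0 f = f"
| "braid_prod r q (Suc k) f = braid_prod r q k (braid r q (Suc k) f)"

text \<open>\<open>I \<otimes> F\<close>, where \<open>I\<close> is the identity of \<open>V\<close>; the value on the empty word is junk.\<close>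

definition id_tensor :: "(('x, 'k::field) tensor \<Rightarrow> ('x, 'k) tensor) \<Rightarrow>
    ('x, 'k) tensor \<Rightarrow> ('x, 'k) tensor" where
  "id_tensor F = linear_ext (\<lambda>xs. case xs of [] \<Rightarrow> 0 | y # ys \<Rightarrow> basis [y] * F (basis ys))"

text \<open>The symmetrizer of index \<open>n\<close> is only meant to be applied to tensors of degree \<open>n\<close>. In
  degrees 0 and 1 it is the identity, so that nothing is factored out there.\<close>

fun qsym :: "('x \<Rightarrow> 'x \<Rightarrow> 'x) \<Rightarrow> ('x \<Rightarrow> 'x \<Rightarrow> 'k::field) \<Rightarrow> nat \<Rightarrow>
    ('x, 'k) tensor \<Rightarrow> ('x, 'k) tensor" where
  "qsym r q 0 f = f"
| "qsym r q (Suc 0) f = f"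
| "qsym r q (Suc (Suc m)) f =
     id_tensor (qsym r q (Suc m)) (\<Sum>k\<in>{0..Suc m}. braid_prod r q k f)"

definition nichols_ideal :: "('x \<Rightarrow> 'x \<Rightarrow> 'x) \<Rightarrow> ('x \<Rightarrow> 'x \<Rightarrow> 'k::field) \<Rightarrow>
    ('x, 'k) tensor set" where
  "nichols_ideal r q = {f. \<forall>n. qsym r q n (homogeneous_part n f) = 0}"

text \<open>A graded \<open>K\<close>-algebra: a ring with a scalar multiplication, together with its homogeneous
  components.\<close>

record ('k, 'a) graded_algebra = "'a ring" +
  scal :: "'k \<Rightarrow> 'a \<Rightarrow> 'a"
  acomp :: "nat \<Rightarrow> 'a set"

definition nichols_algebra :: "('x \<Rightarrow> 'x \<Rightarrow> 'x) \<Rightarrow> ('x \<Rightarrow> 'x \<Rightarrow> 'k::field) \<Rightarrow>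
    ('k, ('x, 'k) tensor set) graded_algebra" where
  "nichols_algebra r q =
     (let T = ring_of_type_algebra; J = nichols_ideal r q
      in ring.extend (T Quot J)
           (graded_algebra.fields
              (\<lambda>c C. \<Union>f\<in>C. J +>\<^bsub>T\<^esub> pscale c f)
              (\<lambda>n. {J +>\<^bsub>T\<^esub> f |f. f \<in> tensor_power n})))"

definition nichols_gen :: "('x \<Rightarrow> 'x \<Rightarrow> 'x) \<Rightarrow> ('x \<Rightarrow> 'x \<Rightarrow> 'k::field) \<Rightarrow> 'x \<Rightarrow>
    ('x, 'k) tensor set" where
  "nichols_gen r q x = nichols_ideal r q +>\<^bsub>ring_of_type_algebra\<^esub> basis [x]"


section \<open>Graded modules and truncated point modules\<close>

text \<open>A graded module is given by its homogeneous components, which are subspaces of an ambient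
  vector space \<open>'m\<close> with scalar multiplication \<open>s\<close>, and by an action, which is only relevant on
  the algebra and on the sum of the components.\<close>

record ('a, 'm) graded_module =
  mcomp :: "nat \<Rightarrow> 'm set"
  act :: "'a \<Rightarrow> 'm \<Rightarrow> 'm"

definition mspace :: "('k::field \<Rightarrow> 'm \<Rightarrow> 'm::ab_group_add) \<Rightarrow>
    ('a, 'm) graded_module \<Rightarrow> 'm set" where
  "mspace s M = Modules.module.span s (\<Union>j. mcomp M j)"

definition graded_left_module :: "('k::field \<Rightarrow> 'm \<Rightarrow> 'm::ab_group_add) \<Rightarrow>
    ('k, 'a) graded_algebra \<Rightarrow> ('a, 'm) graded_module \<Rightarrow> bool" where
  "graded_left_module s A M \<longleftrightarrow>
     (\<forall>j. Modules.module.subspace s (mcomp M j)) \<and>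
     \<comment> \<open>the sum of the components is direct\<close>
     (\<forall>I v. finite I \<and> (\<forall>j\<in>I. v j \<in> mcomp M j) \<and> (\<Sum>j\<in>I. v j) = 0 \<longrightarrow> (\<forall>j\<in>I. v j = 0)) \<and>
     (\<forall>a\<in>carrier A. \<forall>m\<in>mspace s M. act M a m \<in> mspace s M) \<and>
     (\<forall>a\<in>carrier A. \<forall>b\<in>carrier A. \<forall>m\<in>mspace s M. act M (a \<oplus>\<^bsub>A\<^esub> b) m = act M a m + act M b m) \<and>
     (\<forall>a\<in>carrier A. \<forall>m\<in>mspace s M. \<forall>m'\<in>mspace s M. act M a (m + m') = act M a m + act M a m') \<and>
     (\<forall>a\<in>carrier A. \<forall>b\<in>carrier A. \<forall>m\<in>mspace s M. act M (a \<otimes>\<^bsub>A\<^esub> b) m = act M a (act M b m)) \<and>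
     (\<forall>m\<in>mspace s M. act M \<one>\<^bsub>A\<^esub> m = m) \<and>
     (\<forall>c. \<forall>a\<in>carrier A. \<forall>m\<in>mspace s M. act M (scal A c a) m = s c (act M a m)) \<and>
     (\<forall>i j. \<forall>a\<in>acomp A i. \<forall>m\<in>mcomp M j. act M a m \<in> mcomp M (i + j))"

definition generated_in_degree_0 :: "('k::field \<Rightarrow> 'm \<Rightarrow> 'm::ab_group_add) \<Rightarrow>
    ('k, 'a) graded_algebra \<Rightarrow> ('a, 'm) graded_module \<Rightarrow> bool" where
  "generated_in_degree_0 s A M \<longleftrightarrow>
     mspace s M = Modules.module.span s {act M a m |a m. a \<in> carrier A \<and> m \<in> mcomp M 0}"

text \<open>Finite dimensionality has to be stated separately, as \<open>dim\<close> is 0 on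
  infinite-dimensional spaces.\<close>

definition has_hilbert_series :: "('k::field \<Rightarrow> 'm \<Rightarrow> 'm::ab_group_add) \<Rightarrow>
    ('a, 'm) graded_module \<Rightarrow> (nat \<Rightarrow> nat) \<Rightarrow> bool" where
  "has_hilbert_series s M h \<longleftrightarrow>
     (\<forall>j. (\<exists>E. finite E \<and> mcomp M j \<subseteq> Modules.module.span s E) \<and>
          vector_space.dim s (mcomp M j) = h j)"

definition truncated_point_module :: "('k::field \<Rightarrow> 'm \<Rightarrow> 'm::ab_group_add) \<Rightarrow>
    ('k, 'a) graded_algebra \<Rightarrow> nat \<Rightarrow> ('a, 'm) graded_module \<Rightarrow> bool" where
  "truncated_point_module s A n M \<longleftrightarrow>
     graded_left_module s A M \<and> generated_in_degree_0 s A M \<and>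
     has_hilbert_series s M (\<lambda>j. if j \<le> n then 1 else 0)"

definition graded_isomorphic :: "('k::field \<Rightarrow> 'm \<Rightarrow> 'm::ab_group_add) \<Rightarrow>
    ('k, 'a) graded_algebra \<Rightarrow> ('a, 'm) graded_module \<Rightarrow> ('a, 'm) graded_module \<Rightarrow> bool" where
  "graded_isomorphic s A M N \<longleftrightarrow>
     (\<exists>f. bij_betw f (mspace s M) (mspace s N) \<and>
        (\<forall>m\<in>mspace s M. \<forall>m'\<in>mspace s M. f (m + m') = f m + f m') \<and>
        (\<forall>a\<in>carrier A. \<forall>m\<in>mspace s M. f (act M a m) = act N a (f m)) \<and>
        (\<forall>j. f ` mcomp M j = mcomp N j))"

text \<open>The set of isomorphism classes of \<open>n\<close>-truncated point modules. The ambient space of the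
  modules is the vector space \<^typ>\<open>nat \<Rightarrow>\<^sub>0 'k\<close> of countable dimension: every module of finite
  dimension over \<open>'k\<close> has an isomorphic copy on a subspace of it.\<close>

definition Gamma :: "('k::field, 'a) graded_algebra \<Rightarrow> nat \<Rightarrow>
    ('a, nat \<Rightarrow>\<^sub>0 'k) graded_module set set" where
  "Gamma A n =
     {M. truncated_point_module pscale A n M} //
     {(M, N). truncated_point_module pscale A n M \<and> truncated_point_module pscale A n N \<and>
              graded_isomorphic pscale A M N}"


section \<open>Projective space and the points of a module\<close>

definition proj_rel :: "(('x \<Rightarrow> 'k::field) \<times> ('x \<Rightarrow> 'k)) set" where
  "proj_rel = {(u, v). u \<noteq> (\<lambda>_. 0) \<and> v \<noteq> (\<lambda>_. 0) \<and> (\<exists>c. c \<noteq> 0 \<and> v = (\<lambda>i. c * u i))}"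

text \<open>The projective space of \<open>K\<^sup>X\<close>, with homogeneous coordinates indexed by the type \<open>'x\<close>.\<close>

definition projective_space :: "('x \<Rightarrow> 'k::field) set set" where
  "projective_space = {u. u \<noteq> (\<lambda>_. 0)} // proj_rel"

definition proj_point :: "('x \<Rightarrow> 'k::field) \<Rightarrow> ('x \<Rightarrow> 'k) set" where
  "proj_point u = proj_rel `` {u}"

text \<open>\<open>x\<^sub>i e\<^sub>j = \<lambda>\<^sub>i\<^sub>,\<^sub>j e\<^sub>j\<^sub>+\<^sub>1\<close>, where \<open>e\<^sub>j\<close> spans the component of degree \<open>j\<close> and \<open>gen i\<close> is the
  generator \<open>x\<^sub>i\<close>.\<close>

definition has_points :: "('k::field \<Rightarrow> 'm \<Rightarrow> 'm::ab_group_add) \<Rightarrow> ('x \<Rightarrow> 'a) \<Rightarrow> nat \<Rightarrow>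
    ('a, 'm) graded_module \<Rightarrow> ('x \<Rightarrow> 'k) set list \<Rightarrow> bool" where
  "has_points s gen n M ps \<longleftrightarrow>
     (\<exists>e lam. (\<forall>j\<le>n. e j \<noteq> 0 \<and> mcomp M j = Modules.module.span s {e j}) \<and>
        (\<forall>j<n. \<forall>i. act M (gen i) (e j) = s (lam i j) (e (Suc j))) \<and>
        ps = map (\<lambda>j. proj_point (\<lambda>i. lam i j)) [0..<n])"

definition point_sequence :: "('x \<Rightarrow> 'a) \<Rightarrow> nat \<Rightarrow>
    ('a, nat \<Rightarrow>\<^sub>0 'k::field) graded_module set \<Rightarrow> ('x \<Rightarrow> 'k) set list" where
  "point_sequence gen n C = (THE ps. \<exists>M\<in>C. has_points pscale gen n M ps)"

end

theory Submission
  imports Defs "HOL-Library.Function_Algebras"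
begin

text \<open>
  Since the kernels of the quantum symmetrizers form an ideal, an \<open>n\<close>-truncated point module is
  a sequence of \<open>n\<close> points such that the product of every \<open>k\<close> consecutive coordinate vectors,
  read as a linear form on the \<open>k\<close>-th tensor power, vanishes on the kernel of \<open>\<S>\<^sub>k\<close>.

  There is no kernel in degree 2. In degree 3 the kernel is spanned by the cubes \<open>x\<^sub>s\<^sup>3\<close> and by the
  sums of all \<open>x\<^sub>a x\<^sub>b x\<^sub>c\<close> with \<open>a - b + c = s\<close>. A product \<open>u \<otimes> v \<otimes> w\<close> kills the former if the
  pointwise product of \<open>u\<close>, \<open>v\<close>, \<open>w\<close> vanishes and the latter if the product of their discrete Fourier
  transforms does (with the sign of the frequency changed for \<open>v\<close>). These are six conditions, each
  to be satisfied by \<open>u\<close>, \<open>v\<close> or \<open>w\<close>. Any three of the six functionals, coordinates and Fourier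
  coefficients, are linearly independent, so a non-zero vector satisfies at most two of them, and
  two determine it up to a scalar. Hence the solutions correspond to the ordered partitions of the
  six functionals into three pairs, and there are \<open>15 \<cdot> 6 = 90\<close> of them.

  In degree 4 the cubic relations force the fourth point to have the same pair as the first one.
  There is one more relation modulo the cubic ones. It excludes the first pairs that consist of two
  coordinates or of two Fourier coefficients, and for each of the 9 mixed ones leaves 4 of the 6
  choices of the second pair, two of them mixed. In a sequence of 5 points the second pair would have
  to be mixed as well, but since the sign of the frequencies alternates, neither of the two mixed
  choices at the second position is compatible with those at the third.
\<close>

section \<open>Symmetrizers of the braid group\<close>

text \<open>\<open>qsym\<close> applies the smaller symmetrizer last, so its definition does not
  show that the kernels are closed under multiplication by a generator. The braid relations provide
  two more factorizations, in which the symmetrizer of the last, respectively first, strands acts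
  first on tensors. All work is done on functionals, where the transposed symmetrizer acts. A
  product of coordinate vectors in the image of this transpose kills the kernel, and membership is
  certified by an explicit preimage; conversely, explicit elements of the kernel yield necessary
  conditions. In this way the kernel in degree 4 never has to be computed: a single quartic element
  leaves 36 candidates, and preimages in a few base cases confirm all of them. Translations of the
  rack and multiplications with characters reduce every case to a first pair in standard position.
  Two facts about the root of unity \<open>z\<close> are decisive: \<open>1 + z + z^2\<close> is 0,
  which creates the cubic relations, and \<open>1 + 2 * z\<close> is not, since its square is
  -3.\<close>

primrec shuffle_sum :: "(nat \<Rightarrow> 'b \<Rightarrow> 'b::ab_group_add) \<Rightarrow> nat \<Rightarrow> nat \<Rightarrow> 'b \<Rightarrow> 'b" where
  "shuffle_sum c 0 k a = a"
| "shuffle_sum c (Suc n) k a = a + shuffle_sum c n (Suc k) (c (Suc k) a)"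

text \<open>The products of \<open>shuffle_sum\<close> in the opposite order, with the generator
  \<open>Suc k\<close> applied last. Both sums run over braid lifts of coset representatives for the
  permutations of the last \<open>n\<close> strands, one for each kind of coset.\<close>

primrec shuffle_sum_left :: "(nat \<Rightarrow> 'b \<Rightarrow> 'b::ab_group_add) \<Rightarrow> nat \<Rightarrow> nat \<Rightarrow> 'b \<Rightarrow> 'b" where
  "shuffle_sum_left c 0 k a = a"
| "shuffle_sum_left c (Suc n) k a = a + c (Suc k) (shuffle_sum_left c n (Suc k) a)"

primrec braid_chain :: "(nat \<Rightarrow> 'b \<Rightarrow> 'b) \<Rightarrow> nat \<Rightarrow> nat \<Rightarrow> 'b \<Rightarrow> 'b" where
  "braid_chain c 0 k a = a"
| "braid_chain c (Suc n) k a = braid_chain c n (Suc k) (c (Suc k) a)"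

text \<open>The chains may start anywhere but all end with the generator \<open>k + n\<close>: coset
  representatives for the permutations of the first \<open>n\<close> strands.\<close>

primrec shuffle_sum_right :: "(nat \<Rightarrow> 'b \<Rightarrow> 'b::ab_group_add) \<Rightarrow> nat \<Rightarrow> nat \<Rightarrow> 'b \<Rightarrow> 'b" where
  "shuffle_sum_right c 0 k a = a"
| "shuffle_sum_right c (Suc n) k a =
     shuffle_sum_right c n (Suc k) a + braid_chain c (Suc n) k a"

text \<open>The symmetrizer on \<open>n\<close> strands, with the braid generators shifted by \<open>k\<close>. The factors
  come in the opposite order to \<^const>\<open>qsym\<close> since it will be applied to functionals.\<close>

primrec symmetrizer :: "(nat \<Rightarrow> 'b \<Rightarrow> 'b::ab_group_add) \<Rightarrow> nat \<Rightarrow> nat \<Rightarrow> 'b \<Rightarrow> 'b" where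
  "symmetrizer c 0 k a = a"
| "symmetrizer c (Suc n) k a = shuffle_sum c n k (symmetrizer c n (Suc k) a)"

lemma shuffle_sum_eq_sum: "shuffle_sum c n k a = (\<Sum>j\<le>n. braid_chain c j k a)"
  by (induction n arbitrary: k a) (simp_all add: sum.atMost_Suc_shift del: sum.atMost_Suc)

lemma shuffle_sum_Suc: "shuffle_sum c (Suc n) k a = shuffle_sum c n k a + braid_chain c (Suc n) k a"
  by (simp add: shuffle_sum_eq_sum del: shuffle_sum.simps)

locale braided =
  fixes c :: "nat \<Rightarrow> 'b \<Rightarrow> 'b::ab_group_add"
  assumes c_add: "c i (a + b) = c i a + c i b"
    and c_far: "0 < i \<Longrightarrow> Suc i < j \<Longrightarrow> c i (c j a) = c j (c i a)"
    and c_braid: "0 < i \<Longrightarrow> c i (c (Suc i) (c i a)) = c (Suc i) (c i (c (Suc i) a))"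
begin

lemma shuffle_sum_add: "shuffle_sum c n k (a + b) = shuffle_sum c n k a + shuffle_sum c n k b"
  by (induction n arbitrary: k a b) (simp_all add: c_add)

lemma symmetrizer_add: "symmetrizer c n k (a + b) = symmetrizer c n k a + symmetrizer c n k b"
  by (induction n arbitrary: k a b) (simp_all add: shuffle_sum_add)

lemma braid_chain_add: "braid_chain c n k (a + b) = braid_chain c n k a + braid_chain c n k b"
  by (induction n arbitrary: k a b) (simp_all add: c_add)

lemma shuffle_sum_commute:
  "0 < i \<Longrightarrow> i < k \<Longrightarrow> shuffle_sum c n k (c i a) = c i (shuffle_sum c n k a)"
  by (induction n arbitrary: k a) (simp_all add: c_add flip: c_far)

lemma symmetrizer_commute:
  "0 < i \<Longrightarrow> i < k \<Longrightarrow> symmetrizer c n k (c i a) = c i (symmetrizer c n k a)"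
  by (induction n arbitrary: k a) (simp_all add: shuffle_sum_commute)

lemma braid_chain_commute:
  "0 < i \<Longrightarrow> i < k \<Longrightarrow> braid_chain c n k (c i a) = c i (braid_chain c n k a)"
  by (induction n arbitrary: k a) (simp_all flip: c_far)

text \<open>The generator \<open>Suc k\<close> commutes with the symmetrizer on the strands from the
  third on. In the induction it can therefore be moved past this inner symmetrizer to the other
  side.\<close>

lemma symmetrizer_Suc_left:
  "symmetrizer c (Suc n) k a = symmetrizer c n (Suc k) (shuffle_sum_left c n k a)"
proof (induction n arbitrary: k a)
  case (Suc n)
  let ?b = "shuffle_sum_left c n (Suc k) a"
  have "symmetrizer c (Suc (Suc n)) k a = symmetrizer c (Suc n) (Suc k) a
      + shuffle_sum c n (Suc k) (c (Suc k) (symmetrizer c (Suc n) (Suc k) a))"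
    by simp
  also have "c (Suc k) (symmetrizer c (Suc n) (Suc k) a) =
      symmetrizer c n (Suc (Suc k)) (c (Suc k) ?b)"
    by (simp only: Suc.IH symmetrizer_commute zero_less_Suc lessI)
  also have "shuffle_sum c n (Suc k) \<dots> = symmetrizer c (Suc n) (Suc k) (c (Suc k) ?b)"
    by simp
  finally show ?case
    by (simp only: symmetrizer_add shuffle_sum_left.simps)
qed simp

text \<open>In the chain one strand crosses all others. A crossing of two of the others slides past
  it, and its index drops by one. Where the moving strand meets the crossing this is the braid
  relation, elsewhere the commutation of distant generators.\<close>

lemma braid_chain_shift:
  "k < i \<Longrightarrow> i \<le> k + n \<Longrightarrow> braid_chain c (Suc n) k (c (Suc i) a) = c i (braid_chain c (Suc n) k a)"
proof (induction n arbitrary: k a)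
  case (Suc n)
  show ?case
  proof (cases "i = Suc k")
    case True
    then show ?thesis
      by (simp add: braid_chain_commute flip: c_braid)
  next
    case False
    then have "braid_chain c (Suc (Suc n)) k (c (Suc i) a) =
        braid_chain c (Suc n) (Suc k) (c (Suc i) (c (Suc k) a))"
      using Suc.prems by (simp add: c_far)
    also have "\<dots> = c i (braid_chain c (Suc n) (Suc k) (c (Suc k) a))"
      using Suc.prems False by (intro Suc.IH) auto
    finally show ?thesis by simp
  qed
qed simp

lemma braid_chain_shuffle_sum:
  "k \<le> l \<Longrightarrow> l + m \<le> k + n \<Longrightarrow>
    braid_chain c (Suc n) k (shuffle_sum c m (Suc l) a) = shuffle_sum c m l (braid_chain c (Suc n) k a)"
  by (induction m arbitrary: l a)
    (simp_all add: braid_chain_add braid_chain_shift del: braid_chain.simps)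

lemma braid_chain_symmetrizer:
  "k \<le> l \<Longrightarrow> l + m \<le> Suc (k + n) \<Longrightarrow>
    braid_chain c (Suc n) k (symmetrizer c m (Suc l) a) = symmetrizer c m l (braid_chain c (Suc n) k a)"
  by (induction m arbitrary: l a)
    (simp_all add: braid_chain_shuffle_sum del: braid_chain.simps)

text \<open>The longest chain is split off the shuffle sum. It carries the symmetrizer of the last
  strands to that of the first strands, and the other terms are covered by the induction
  hypothesis.\<close>

lemma symmetrizer_Suc_right:
  "symmetrizer c (Suc n) k a = symmetrizer c n k (shuffle_sum_right c n k a)"
proof (induction n arbitrary: k a)
  case (Suc n)
  let ?b = "symmetrizer c (Suc n) (Suc k) a"
  have "symmetrizer c (Suc (Suc n)) k a = shuffle_sum c n k ?b + braid_chain c (Suc n) k ?b"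
    by (simp only: symmetrizer.simps(2)[of _ "Suc n"] shuffle_sum_Suc)
  also have "shuffle_sum c n k ?b = symmetrizer c (Suc n) k (shuffle_sum_right c n (Suc k) a)"
    by (simp only: Suc.IH symmetrizer.simps(2)[of _ n k])
  also have "braid_chain c (Suc n) k ?b = symmetrizer c (Suc n) k (braid_chain c (Suc n) k a)"
    by (rule braid_chain_symmetrizer) auto
  finally show ?case
    by (simp only: symmetrizer_add shuffle_sum_right.simps)
qed simp

end


section \<open>Linear functionals on the tensor algebra\<close>

text \<open>The scalar multiplication is a parameter so that functionals, with the field as target,
  and maps into tensors or modules share one set of lemmas.\<close>

definition word_sum :: "('k::field \<Rightarrow> 'm \<Rightarrow> 'm::ab_group_add) \<Rightarrow> ('x list \<Rightarrow> 'm) \<Rightarrow> ('x, 'k) tensor \<Rightarrow> 'm"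
  where "word_sum s \<phi> f = (\<Sum>w\<in>Poly_Mapping.keys f. s (Poly_Mapping.lookup f w) (\<phi> (letters w)))"

abbreviation pairing :: "('x list \<Rightarrow> 'k::field) \<Rightarrow> ('x, 'k) tensor \<Rightarrow> 'k" where
  "pairing \<equiv> word_sum (*)"

lemma linear_ext_eq: "linear_ext = word_sum pscale"
  by (simp add: linear_ext_def word_sum_def fun_eq_iff)

lemma vector_space_mult: "vector_space ((*) :: 'k::field \<Rightarrow> 'k \<Rightarrow> 'k)"
  by unfold_locales (simp_all add: algebra_simps)

lemma pscale_0_left [simp]: "pscale 0 f = 0" and pscale_0_right [simp]: "pscale c 0 = 0"
  and pscale_1 [simp]: "pscale 1 f = f"
  by (auto intro: poly_mapping_eqI)

lemma pscale_add: "pscale c (f + g) = pscale c f + pscale c g"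
  and pscale_add_left: "pscale (c + d) f = pscale c f + pscale d f"
  and pscale_pscale [simp]: "pscale c (pscale d f) = pscale (c * d) f"
  by (auto intro!: poly_mapping_eqI simp: lookup_add algebra_simps)

lemma pscale_sum: "pscale c (sum h A) = (\<Sum>x\<in>A. pscale c (h x))"
  by (induction A rule: infinite_finite_induct) (simp_all add: pscale_add)

lemma keys_basis [simp]: "Poly_Mapping.keys (basis xs :: ('x, 'k::field) tensor) = {Word xs}"
  by (simp add: basis_def)

lemma lookup_basis: "Poly_Mapping.lookup (basis xs) w = (if w = Word xs then 1 else 0)"
  by (auto simp: basis_def lookup_single when_def)

lemma tensor_expand:
  "f = (\<Sum>w\<in>Poly_Mapping.keys f. pscale (Poly_Mapping.lookup f w) (basis (letters w)))"
  by (rule poly_mapping_eqI)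
    (auto simp: lookup_sum lookup_basis sum.delta' in_keys_iff if_distrib cong: if_cong)

lemma tensor_induct [case_names zero basis add]:
  assumes "P 0" "\<And>c xs. P (pscale c (basis xs))" "\<And>f g. P f \<Longrightarrow> P g \<Longrightarrow> P (f + g)"
  shows "P f"
proof -
  have "P (\<Sum>w\<in>A. pscale (Poly_Mapping.lookup f w) (basis (letters w)))" if "finite A" for A
    using that by induction (auto intro: assms)
  then show ?thesis
    by (subst tensor_expand) simp
qed

context vector_space
begin

lemma word_sum_superset:
  assumes "finite W" "Poly_Mapping.keys f \<subseteq> W"
  shows "word_sum scale \<phi> f = (\<Sum>w\<in>W. scale (Poly_Mapping.lookup f w) (\<phi> (letters w)))"
  unfolding word_sum_def using assms
  by (intro sum.mono_neutral_left) (auto simp: in_keys_iff)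

lemma word_sum_0 [simp]: "word_sum scale \<phi> 0 = 0"
  by (simp add: word_sum_def)

lemma word_sum_add: "word_sum scale \<phi> (f + g) = word_sum scale \<phi> f + word_sum scale \<phi> g"
proof -
  let ?W = "Poly_Mapping.keys f \<union> Poly_Mapping.keys g"
  have "Poly_Mapping.keys (f + g) \<subseteq> ?W" by (rule keys_add)
  then show ?thesis
    by (simp add: word_sum_superset[of ?W] lookup_add scale_left_distrib sum.distrib)
qed

lemma word_sum_pscale: "word_sum scale \<phi> (pscale c f) = scale c (word_sum scale \<phi> f)"
proof -
  have "Poly_Mapping.keys (pscale c f) \<subseteq> Poly_Mapping.keys f"
    by (auto simp: in_keys_iff)
  then show ?thesis
    by (simp add: word_sum_superset[of "Poly_Mapping.keys f"] scale_sum_right)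
qed

lemma word_sum_sum: "word_sum scale \<phi> (sum h A) = (\<Sum>x\<in>A. word_sum scale \<phi> (h x))"
  by (induction A rule: infinite_finite_induct) (simp_all add: word_sum_add)

lemma word_sum_basis [simp]: "word_sum scale \<phi> (basis xs) = \<phi> xs"
  by (simp add: word_sum_def lookup_basis)

lemma word_sum_diff: "word_sum scale \<phi> (f - g) = word_sum scale \<phi> f - word_sum scale \<phi> g"
  using word_sum_add[of \<phi> "f - g" g] by simp

lemma word_sum_add_fun:
  "word_sum scale (\<lambda>xs. \<phi> xs + \<psi> xs) f = word_sum scale \<phi> f + word_sum scale \<psi> f"
  by (simp add: word_sum_def scale_right_distrib sum.distrib)

end

lemma word_sum_cong:
  "(\<And>w. w \<in> Poly_Mapping.keys f \<Longrightarrow> \<phi> (letters w) = \<psi> (letters w)) \<Longrightarrow> word_sum s \<phi> f = word_sum s \<psi> f"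
  by (simp add: word_sum_def)

interpretation pairing: vector_space "(*) :: 'k::field \<Rightarrow> 'k \<Rightarrow> 'k"
  by (rule vector_space_mult)

declare pairing.scale_scale [simp del]

interpretation pscale: vector_space "pscale :: 'k::field \<Rightarrow> ('b \<Rightarrow>\<^sub>0 'k) \<Rightarrow> ('b \<Rightarrow>\<^sub>0 'k)"
  by (rule vector_space_pscale)

lemma lookup_eq_pairing: "Poly_Mapping.lookup f w = pairing (\<lambda>xs. if xs = letters w then 1 else 0) f"
proof -
  have "pairing (\<lambda>xs. if xs = letters w then 1 else 0) f =
      (\<Sum>v\<in>Poly_Mapping.keys f. if v = w then Poly_Mapping.lookup f v else 0)"
    unfolding word_sum_def by (intro sum.cong) (auto simp: word.expand)
  then show ?thesis
    by (simp add: in_keys_iff)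
qed

lemma eq_0_iff_pairing: "f = 0 \<longleftrightarrow> (\<forall>F. pairing F f = 0)"
  by (auto intro!: poly_mapping_eqI simp: lookup_eq_pairing)

lemma pairing_word_sum: "pairing F (word_sum pscale \<phi> f) = pairing (\<lambda>xs. pairing F (\<phi> xs)) f"
  by (simp add: word_sum_def[of pscale] pairing.word_sum_sum pairing.word_sum_pscale)
    (simp add: word_sum_def)

lemma basis_mult: "basis xs * basis ys = basis (xs @ ys)"
  by (simp add: basis_def mult_single plus_word_def)

lemma pscale_eq_mult: "pscale c f = Poly_Mapping.single 0 c * f"
  unfolding pscale_def by (rule mult_map_scale_conv_mult)

lemma pscale_single: "pscale c (Poly_Mapping.single b d) = Poly_Mapping.single b (c * d)"
  by (rule poly_mapping_eqI) (auto simp: lookup_single when_def)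

lemma pscale_eq_mult_right: "pscale c f = f * Poly_Mapping.single 0 c"
  for f :: "('x, 'k::field) tensor"
proof (induction f rule: tensor_induct)
  case (basis d xs)
  show ?case
    by (simp add: basis_def pscale_single mult_single mult.commute del: pscale_pscale)
qed (simp_all add: pscale_add distrib_right)

lemma pscale_mult_left: "pscale c f * g = pscale c (f * g)"
  for f :: "('x, 'k::field) tensor"
  by (simp add: pscale_eq_mult mult.assoc)

lemma pscale_mult_right: "f * pscale c g = pscale c (f * g)"
  for f :: "('x, 'k::field) tensor"
  by (simp add: pscale_eq_mult_right flip: mult.assoc)

lemma pairing_basis_mult: "pairing F (basis xs * f) = pairing (\<lambda>ys. F (xs @ ys)) f"
  by (induction f rule: tensor_induct)
    (simp_all add: pscale_mult_right basis_mult pairing.word_sum_pscale pairing.word_sum_add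
      distrib_left)

lemma pairing_mult_basis: "pairing F (f * basis xs) = pairing (\<lambda>ys. F (ys @ xs)) f"
  by (induction f rule: tensor_induct)
    (simp_all add: pscale_mult_left basis_mult pairing.word_sum_pscale pairing.word_sum_add
      distrib_right)

lemma tensor_power_add: "f \<in> tensor_power n \<Longrightarrow> g \<in> tensor_power n \<Longrightarrow> f + g \<in> tensor_power n"
  using keys_add[of f g] by (auto simp: tensor_power_def)

lemma tensor_power_0 [simp]: "0 \<in> tensor_power n"
  by (simp add: tensor_power_def)

lemma tensor_power_sum: "(\<And>x. x \<in> A \<Longrightarrow> h x \<in> tensor_power n) \<Longrightarrow> sum h A \<in> tensor_power n"
  by (induction A rule: infinite_finite_induct) (auto intro: tensor_power_add)

lemma tensor_power_pscale: "f \<in> tensor_power n \<Longrightarrow> pscale c f \<in> tensor_power n"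
  by (auto simp: tensor_power_def in_keys_iff)

lemma basis_in_tensor_power [simp]: "basis xs \<in> tensor_power n \<longleftrightarrow> length xs = n"
  by (simp add: tensor_power_def)

lemma word_sum_in_tensor_power:
  assumes "\<And>w. w \<in> Poly_Mapping.keys f \<Longrightarrow> \<phi> (letters w) \<in> tensor_power n"
  shows "word_sum pscale \<phi> f \<in> tensor_power n"
  unfolding word_sum_def by (intro tensor_power_sum tensor_power_pscale assms)

lemma homogeneous_part_in_tensor_power: "homogeneous_part n f \<in> tensor_power n"
  by (auto simp: homogeneous_part_def linear_ext_eq intro!: word_sum_in_tensor_power)

lemma pairing_homogeneous_part:
  "pairing F (homogeneous_part n f) = pairing (\<lambda>xs. if length xs = n then F xs else 0) f"
  by (simp add: homogeneous_part_def linear_ext_eq pairing_word_sum if_distrib cong: if_cong)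

lemma tensor_eqI: "(\<And>F. pairing F f = pairing F g) \<Longrightarrow> f = g"
  by (rule poly_mapping_eqI) (simp add: lookup_eq_pairing)

lemma homogeneous_part_tensor_power:
  assumes "f \<in> tensor_power n"
  shows "homogeneous_part m f = (if m = n then f else 0)"
proof (rule tensor_eqI)
  fix F
  show "pairing F (homogeneous_part m f) = pairing F (if m = n then f else 0)"
    unfolding pairing_homogeneous_part using assms
    by (auto simp: tensor_power_def word_sum_def intro!: sum.cong)
qed

lemma homogeneous_part_add: "homogeneous_part n (f + g) = homogeneous_part n f + homogeneous_part n g"
  by (simp add: homogeneous_part_def linear_ext_eq pscale.word_sum_add)

lemma homogeneous_part_pscale: "homogeneous_part n (pscale c f) = pscale c (homogeneous_part n f)"
  by (simp add: homogeneous_part_def linear_ext_eq pscale.word_sum_pscale)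

section \<open>The ideal of the Nichols algebra\<close>

text \<open>The transpose of \<open>braid\<close>. Words that are too short for the crossing get the
  value 0, so that the braid relations hold at every word.\<close>

definition braid_dual :: "('x \<Rightarrow> 'x \<Rightarrow> 'x) \<Rightarrow> ('x \<Rightarrow> 'x \<Rightarrow> 'k::field) \<Rightarrow> nat \<Rightarrow>
    ('x list \<Rightarrow> 'k) \<Rightarrow> 'x list \<Rightarrow> 'k" where
  "braid_dual r q i F xs =
     (if i < length xs
      then q (xs ! (i - 1)) (xs ! i) * F (xs[i - 1 := r (xs ! (i - 1)) (xs ! i), i := xs ! (i - 1)])
      else 0)"

abbreviation qsym_dual :: "('x \<Rightarrow> 'x \<Rightarrow> 'x) \<Rightarrow> ('x \<Rightarrow> 'x \<Rightarrow> 'k::field) \<Rightarrow> nat \<Rightarrow>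
    ('x list \<Rightarrow> 'k) \<Rightarrow> 'x list \<Rightarrow> 'k" where
  "qsym_dual r q n \<equiv> symmetrizer (braid_dual r q) n 0"

lemma braid_dual_append:
  "braid_dual r q (Suc (length us)) F (us @ x # y # vs) = q x y * F (us @ r x y # x # vs)"
  by (simp add: braid_dual_def nth_append list_update_append)

lemma braid_dual_append_far:
  "braid_dual r q (Suc (Suc (Suc (length us + length vs)))) F (us @ x # y # vs @ z # w # ts) =
    q z w * F (us @ x # y # vs @ r z w # z # ts)"
  using braid_dual_append[of r q "us @ x # y # vs" F z w ts] by simp

lemma braid_dual_append_next:
  "braid_dual r q (Suc (Suc (length us))) F (us @ x # y # z # vs) = q y z * F (us @ x # r y z # y # vs)"
  using braid_dual_append[of r q "us @ [x]" F y z vs] by simp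

lemma list_split_at:
  assumes "Suc i < length xs"
  obtains us x y vs where "xs = us @ x # y # vs" "length us = i"
  using assms id_take_nth_drop[of i xs] Cons_nth_drop_Suc[of "Suc i" xs]
  by (metis Suc_lessD length_take min.absorb2 less_imp_le)

lemma braided_braid_dual:
  assumes "is_rack r" "is_2cocycle r q"
  shows "braided (braid_dual r q)"
proof
  show "braid_dual r q i (F + G) = braid_dual r q i F + braid_dual r q i G" for i F G
    by (simp add: braid_dual_def fun_eq_iff distrib_left)
  show "braid_dual r q i (braid_dual r q j F) = braid_dual r q j (braid_dual r q i F)"
    if ij: "0 < i" "Suc i < j" for i j F
  proof
    fix xs
    show "braid_dual r q i (braid_dual r q j F) xs = braid_dual r q j (braid_dual r q i F) xs"
    proof (cases "j < length xs")
      case True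
      obtain us' z w ts where xs: "xs = us' @ z # w # ts" and us': "length us' = j - 1"
        by (rule list_split_at[of "j - 1" xs]) (use True ij in auto)
      obtain us x y vs where us: "us' = us @ x # y # vs" "length us = i - 1"
        by (rule list_split_at[of "i - 1" us']) (use us' ij in auto)
      have i: "i = Suc (length us)" and j: "j = Suc (Suc (Suc (length us + length vs)))"
        using us us' ij by auto
      show ?thesis
        unfolding xs us(1) i j by (simp add: braid_dual_append braid_dual_append_far mult.left_commute)
    qed (auto simp: braid_dual_def)
  qed
  show "braid_dual r q i (braid_dual r q (Suc i) (braid_dual r q i F)) =
      braid_dual r q (Suc i) (braid_dual r q i (braid_dual r q (Suc i) F))" if i0: "0 < i" for i F
  proof
    fix xs :: "'a list"
    show "braid_dual r q i (braid_dual r q (Suc i) (braid_dual r q i F)) xs =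
      braid_dual r q (Suc i) (braid_dual r q i (braid_dual r q (Suc i) F)) xs"
    proof (cases "Suc i < length xs")
      case True
      obtain us' y z vs where xs: "xs = us' @ y # z # vs" and us': "length us' = i"
        by (rule list_split_at[of i xs]) (use True in auto)
      obtain us x where us: "us' = us @ [x]"
        using us' i0 by (cases us' rule: rev_cases) auto
      have i: "i = Suc (length us)"
        using us us' by auto
      \<comment> \<open>The words on the two sides agree by self-distributivity, the scalars by the
        cocycle condition.\<close>
      have "r x (r y z) = r (r x y) (r x z)" "q x z * q (r x y) (r x z) = q y z * q x (r y z)"
        using assms by (simp_all add: is_rack_def is_2cocycle_def mult.commute)
      then show ?thesis
        unfolding xs us i by (simp add: braid_dual_append braid_dual_append_next)
    qed (simp add: braid_dual_def)
  qed
qed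

lemma pairing_braid:
  assumes "f \<in> tensor_power n" "i < n"
  shows "pairing F (braid r q i f) = pairing (braid_dual r q i F) f"
  unfolding braid_def linear_ext_eq pairing_word_sum using assms
  by (intro word_sum_cong) (auto simp: tensor_power_def braid_dual_def Let_def pairing.word_sum_pscale)

lemma braid_in_tensor_power: "f \<in> tensor_power n \<Longrightarrow> braid r q i f \<in> tensor_power n"
  unfolding braid_def linear_ext_eq
  by (intro word_sum_in_tensor_power)
    (auto simp: tensor_power_def Let_def in_keys_iff lookup_basis split: if_splits)

lemma braid_prod_in_tensor_power: "f \<in> tensor_power n \<Longrightarrow> braid_prod r q k f \<in> tensor_power n"
  by (induction k arbitrary: f) (simp_all add: braid_in_tensor_power)

lemma braid_chain_Suc: "braid_chain c (Suc n) k a = c (Suc (k + n)) (braid_chain c n k a)"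
  by (induction n arbitrary: k a) simp_all

lemma pairing_braid_prod:
  assumes "f \<in> tensor_power n" "k < n"
  shows "pairing F (braid_prod r q k f) = pairing (braid_chain (braid_dual r q) k 0 F) f"
  using assms
proof (induction k arbitrary: f)
  case (Suc k)
  then have "pairing F (braid_prod r q (Suc k) f) =
      pairing (braid_dual r q (Suc k) (braid_chain (braid_dual r q) k 0 F)) f"
    by (simp add: pairing_braid braid_in_tensor_power)
  then show ?case
    by (simp only: braid_chain_Suc add_0)
qed simp

lemma pairing_sum_fun: "pairing (\<Sum>k\<in>A. F k) f = (\<Sum>k\<in>A. pairing (F k) f)"
proof (induction A rule: infinite_finite_induct)
  case (insert x A)
  then show ?case by (simp add: plus_fun_def pairing.word_sum_add_fun)
qed (simp_all add: word_sum_def)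

lemma pairing_shuffle_sum:
  assumes "f \<in> tensor_power (Suc n)"
  shows "pairing F (\<Sum>k\<in>{0..n}. braid_prod r q k f) = pairing (shuffle_sum (braid_dual r q) n 0 F) f"
  using assms
  by (simp add: pairing.word_sum_sum shuffle_sum_eq_sum pairing_sum_fun pairing_braid_prod atLeast0AtMost)

text \<open>A crossing that avoids the first letter is a crossing of the rest with index lowered by
  one. On functionals this is the effect of tensoring with the identity in
  \<open>id_tensor\<close>.\<close>

lemma braid_dual_Cons:
  "0 < i \<Longrightarrow> braid_dual r q (Suc i) F (x # xs) = braid_dual r q i (\<lambda>ys. F (x # ys)) xs"
  by (cases i) (simp_all add: braid_dual_def)

lemma shuffle_sum_dual_Cons:
  "(\<lambda>ys. shuffle_sum (braid_dual r q) n (Suc k) F (x # ys)) =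
    shuffle_sum (braid_dual r q) n k (\<lambda>ys. F (x # ys))"
proof (induction n arbitrary: k F)
  case (Suc n)
  show ?case
    by (simp add: Suc.IH[of "Suc k"] braid_dual_Cons fun_eq_iff[symmetric])
      (simp add: fun_eq_iff Suc.IH[of "Suc k", unfolded fun_eq_iff] braid_dual_Cons)
qed simp

lemma symmetrizer_dual_Cons:
  "(\<lambda>ys. symmetrizer (braid_dual r q) n (Suc k) F (x # ys)) =
    symmetrizer (braid_dual r q) n k (\<lambda>ys. F (x # ys))"
  by (induction n arbitrary: k F) (simp_all add: shuffle_sum_dual_Cons)

lemma pairing_id_tensor:
  assumes "f \<in> tensor_power (Suc n)"
    and "\<And>G ys. length ys = n \<Longrightarrow> pairing G (S (basis ys)) = S' G ys"
  shows "pairing F (id_tensor S f) =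
    pairing (\<lambda>xs. case xs of [] \<Rightarrow> 0 | y # ys \<Rightarrow> S' (\<lambda>zs. F (y # zs)) ys) f"
  unfolding id_tensor_def linear_ext_eq pairing_word_sum using assms
  by (intro word_sum_cong)
    (auto simp: tensor_power_def pairing_basis_mult split: list.split)

lemma pairing_qsym:
  assumes "f \<in> tensor_power n"
  shows "pairing F (qsym r q n f) = pairing (qsym_dual r q n F) f"
  using assms
proof (induction r q n f arbitrary: F rule: qsym.induct)
  case (3 r q m f)
  let ?g = "\<Sum>k\<in>{0..Suc m}. braid_prod r q k f" and ?c = "braid_dual r q"
  have g: "?g \<in> tensor_power (Suc (Suc m))"
    using 3 by (intro tensor_power_sum braid_prod_in_tensor_power)
  have "pairing F (qsym r q (Suc (Suc m)) f) = pairing (\<lambda>xs. case xs of [] \<Rightarrow> 0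
      | y # ys \<Rightarrow> qsym_dual r q (Suc m) (\<lambda>zs. F (y # zs)) ys) ?g"
    unfolding qsym.simps using 3 by (intro pairing_id_tensor[OF g]) (simp del: symmetrizer.simps)
  also have "\<dots> = pairing (symmetrizer ?c (Suc m) (Suc 0) F) ?g"
    using g by (intro word_sum_cong)
      (auto simp: tensor_power_def symmetrizer_dual_Cons[symmetric] simp del: symmetrizer.simps
        split: list.split)
  also have "\<dots> = pairing (qsym_dual r q (Suc (Suc m)) F) f"
    using 3 by (subst pairing_shuffle_sum) simp_all
  finally show ?case .
qed simp_all

section \<open>Kernels of the symmetrizers and their closure under multiplication\<close>

lemma qsym_eq_0_iff:
  "f \<in> tensor_power n \<Longrightarrow> qsym r q n f = 0 \<longleftrightarrow> (\<forall>F. pairing (qsym_dual r q n F) f = 0)"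
  by (subst eq_0_iff_pairing) (simp add: pairing_qsym)

definition qsym_kernel :: "('x \<Rightarrow> 'x \<Rightarrow> 'x) \<Rightarrow> ('x \<Rightarrow> 'x \<Rightarrow> 'k::field) \<Rightarrow> nat \<Rightarrow> ('x, 'k) tensor set"
  where "qsym_kernel r q n = {f \<in> tensor_power n. \<forall>F. pairing (qsym_dual r q n F) f = 0}"

lemma nichols_ideal_iff: "f \<in> nichols_ideal r q \<longleftrightarrow> (\<forall>n. homogeneous_part n f \<in> qsym_kernel r q n)"
  by (simp add: nichols_ideal_def qsym_kernel_def qsym_eq_0_iff homogeneous_part_in_tensor_power)

lemma qsym_kernel_subset_nichols_ideal: "qsym_kernel r q n \<subseteq> nichols_ideal r q"
  by (auto simp: nichols_ideal_iff qsym_kernel_def homogeneous_part_tensor_power)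

text \<open>The bound keeps the crossing inside \<open>ys\<close>: at \<open>i = length ys\<close>
  the right-hand side takes the default value 0, while the left-hand side crosses the last letter of
  \<open>ys\<close> with \<open>x\<close>.\<close>

lemma braid_dual_snoc:
  "0 < i \<Longrightarrow> i < length ys \<Longrightarrow> braid_dual r q i F (ys @ [x]) = braid_dual r q i (\<lambda>ys. F (ys @ [x])) ys"
  by (simp add: braid_dual_def nth_append list_update_append less_imp_diff_less)

lemma braid_dual_cong:
  "(\<And>zs. length zs = length ys \<Longrightarrow> F zs = G zs) \<Longrightarrow> braid_dual r q i F ys = braid_dual r q i G ys"
  by (simp add: braid_dual_def)

lemma shuffle_sum_dual_cong:
  "(\<And>zs. length zs = length ys \<Longrightarrow> F zs = G zs) \<Longrightarrow>
    shuffle_sum (braid_dual r q) n k F ys = shuffle_sum (braid_dual r q) n k G ys"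
proof (induction n arbitrary: k F G)
  case (Suc n)
  have "braid_dual r q (Suc k) F zs = braid_dual r q (Suc k) G zs" if "length zs = length ys" for zs
    using Suc.prems that by (intro braid_dual_cong) auto
  then have "shuffle_sum (braid_dual r q) n (Suc k) (braid_dual r q (Suc k) F) ys =
      shuffle_sum (braid_dual r q) n (Suc k) (braid_dual r q (Suc k) G) ys"
    by (rule Suc.IH)
  then show ?case using Suc.prems by simp
qed simp

lemma shuffle_sum_dual_snoc:
  "k + n < length ys \<Longrightarrow> shuffle_sum (braid_dual r q) n k F (ys @ [x]) =
    shuffle_sum (braid_dual r q) n k (\<lambda>ys. F (ys @ [x])) ys"
proof (induction n arbitrary: k F)
  case (Suc n)
  have "shuffle_sum (braid_dual r q) n (Suc k) (\<lambda>ys. braid_dual r q (Suc k) F (ys @ [x])) ys =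
      shuffle_sum (braid_dual r q) n (Suc k) (braid_dual r q (Suc k) (\<lambda>ys. F (ys @ [x]))) ys"
    using Suc.prems by (intro shuffle_sum_dual_cong braid_dual_snoc) auto
  then show ?case
    using Suc by simp
qed simp

lemma symmetrizer_dual_snoc:
  "k + n \<le> length ys \<Longrightarrow> symmetrizer (braid_dual r q) n k F (ys @ [x]) =
    symmetrizer (braid_dual r q) n k (\<lambda>ys. F (ys @ [x])) ys"
proof (induction n arbitrary: k F ys)
  case (Suc n)
  have "shuffle_sum (braid_dual r q) n k (\<lambda>ys. symmetrizer (braid_dual r q) n (Suc k) F (ys @ [x])) ys =
      shuffle_sum (braid_dual r q) n k (symmetrizer (braid_dual r q) n (Suc k) (\<lambda>ys. F (ys @ [x]))) ys"
    using Suc by (intro shuffle_sum_dual_cong) auto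
  then show ?case
    using Suc.prems by (simp add: shuffle_sum_dual_snoc)
qed simp

lemma basis_mult_in_tensor_power:
  "f \<in> tensor_power n \<Longrightarrow> basis xs * f \<in> tensor_power (length xs + n)"
  using keys_mult[of "basis xs" f] by (fastforce simp: tensor_power_def plus_word_def)

lemma mult_basis_in_tensor_power:
  "f \<in> tensor_power n \<Longrightarrow> f * basis xs \<in> tensor_power (n + length xs)"
  using keys_mult[of f "basis xs"] by (fastforce simp: tensor_power_def plus_word_def)

lemma qsym_kernel_0: "0 \<in> qsym_kernel r q n"
  by (simp add: qsym_kernel_def)

text \<open>In \<open>symmetrizer_Suc_left\<close> the outermost map on functionals is the
  symmetrizer of the last strands. With the first letter fixed it becomes the symmetrizer of degree
  \<open>n\<close>, whose values vanish on \<open>f\<close>.\<close>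

lemma qsym_kernel_mult_left:
  assumes "is_rack r" "is_2cocycle r q" "f \<in> qsym_kernel r q n"
  shows "basis [x] * f \<in> qsym_kernel r q (Suc n)"
proof -
  interpret braided "braid_dual r q"
    using assms by (intro braided_braid_dual)
  have "pairing (qsym_dual r q (Suc n) F) (basis [x] * f) = 0" for F
    using assms(3)
    by (simp add: symmetrizer_Suc_left pairing_basis_mult symmetrizer_dual_Cons qsym_kernel_def
        del: symmetrizer.simps)
  then show ?thesis
    using assms basis_mult_in_tensor_power[of f n "[x]"] by (simp add: qsym_kernel_def)
qed

lemma qsym_kernel_mult_right:
  assumes "is_rack r" "is_2cocycle r q" "f \<in> qsym_kernel r q n"
  shows "f * basis [x] \<in> qsym_kernel r q (Suc n)"
proof -
  interpret braided "braid_dual r q"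
    using assms by (intro braided_braid_dual)
  have "pairing (qsym_dual r q (Suc n) F) (f * basis [x]) = 0" for F
  proof -
    let ?G = "shuffle_sum_right (braid_dual r q) n 0 F"
    have "pairing (qsym_dual r q (Suc n) F) (f * basis [x]) =
        pairing (\<lambda>ys. qsym_dual r q n ?G (ys @ [x])) f"
      by (simp only: symmetrizer_Suc_right pairing_mult_basis)
    also have "\<dots> = pairing (qsym_dual r q n (\<lambda>ys. ?G (ys @ [x]))) f"
      using assms(3) by (intro word_sum_cong symmetrizer_dual_snoc)
        (auto simp: qsym_kernel_def tensor_power_def)
    finally show ?thesis
      using assms(3) by (simp add: qsym_kernel_def)
  qed
  then show ?thesis
    using assms mult_basis_in_tensor_power[of f n "[x]"] by (simp add: qsym_kernel_def)
qed

lemma pairing_zero_fun: "pairing (\<lambda>_. 0) f = 0"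
  by (simp add: word_sum_def)

lemma homogeneous_part_basis_mult:
  "homogeneous_part n (basis [x] * f) = (case n of 0 \<Rightarrow> 0 | Suc m \<Rightarrow> basis [x] * homogeneous_part m f)"
  by (rule tensor_eqI)
    (simp add: pairing_homogeneous_part pairing_basis_mult pairing_zero_fun cong: if_cong split: nat.split)

lemma homogeneous_part_mult_basis:
  "homogeneous_part n (f * basis [x]) = (case n of 0 \<Rightarrow> 0 | Suc m \<Rightarrow> homogeneous_part m f * basis [x])"
  by (rule tensor_eqI)
    (simp add: pairing_homogeneous_part pairing_mult_basis pairing_zero_fun split: nat.split)

lemma nichols_ideal_add: "f \<in> nichols_ideal r q \<Longrightarrow> g \<in> nichols_ideal r q \<Longrightarrow> f + g \<in> nichols_ideal r q"
  by (auto simp: nichols_ideal_iff qsym_kernel_def homogeneous_part_add tensor_power_add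
      pairing.word_sum_add)

lemma nichols_ideal_pscale: "f \<in> nichols_ideal r q \<Longrightarrow> pscale c f \<in> nichols_ideal r q"
  by (auto simp: nichols_ideal_iff qsym_kernel_def homogeneous_part_pscale tensor_power_pscale
      pairing.word_sum_pscale)

lemma nichols_ideal_0: "0 \<in> nichols_ideal r q"
  using qsym_kernel_subset_nichols_ideal qsym_kernel_0 by blast

lemma nichols_ideal_minus: "f \<in> nichols_ideal r q \<Longrightarrow> - f \<in> nichols_ideal r q"
proof -
  have "- f = pscale (- 1) f"
    by (rule poly_mapping_eqI) simp
  then show "f \<in> nichols_ideal r q \<Longrightarrow> - f \<in> nichols_ideal r q"
    by (simp only: nichols_ideal_pscale)
qed

lemma basis_Nil: "basis [] = 1"
  by (simp add: basis_def zero_word_def flip: single_one)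

lemma nichols_ideal_mult_left:
  assumes "is_rack r" "is_2cocycle r q" "f \<in> nichols_ideal r q"
  shows "g * f \<in> nichols_ideal r q"
proof (induction g rule: tensor_induct)
  case (basis c xs)
  have "basis xs * f \<in> nichols_ideal r q"
  proof (induction xs)
    case (Cons x xs)
    have "basis (x # xs) * f = basis [x] * (basis xs * f)"
      by (simp add: basis_mult flip: mult.assoc)
    moreover have "basis [x] * h \<in> nichols_ideal r q" if "h \<in> nichols_ideal r q" for h
      using that assms
      by (auto simp: nichols_ideal_iff homogeneous_part_basis_mult qsym_kernel_0
          intro!: qsym_kernel_mult_left split: nat.split)
    ultimately show ?case using Cons by simp
  qed (simp add: basis_Nil assms)
  then show ?case
    by (simp add: pscale_mult_left nichols_ideal_pscale)
qed (simp_all add: distrib_right nichols_ideal_0 nichols_ideal_add)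

lemma nichols_ideal_mult_right:
  assumes "is_rack r" "is_2cocycle r q" "f \<in> nichols_ideal r q"
  shows "f * g \<in> nichols_ideal r q"
proof (induction g rule: tensor_induct)
  case (basis c xs)
  have "f * basis xs \<in> nichols_ideal r q"
  proof (induction xs rule: rev_induct)
    case (snoc x xs)
    have "f * basis (xs @ [x]) = f * basis xs * basis [x]"
      by (simp add: basis_mult mult.assoc)
    moreover have "h * basis [x] \<in> nichols_ideal r q" if "h \<in> nichols_ideal r q" for h
      using that assms
      by (auto simp: nichols_ideal_iff homogeneous_part_mult_basis qsym_kernel_0
          intro!: qsym_kernel_mult_right split: nat.split)
    ultimately show ?case using snoc by simp
  qed (simp add: basis_Nil assms)
  then show ?case
    by (simp add: pscale_mult_right nichols_ideal_pscale)
qed (simp_all add: distrib_left nichols_ideal_0 nichols_ideal_add)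

lemma ring_type_algebra: "ring (ring_of_type_algebra :: 'a::ring_1 ring)"
proof -
  have "\<exists>y. y + x = 0" for x :: 'a
    by (rule exI[of _ "- x"]) simp
  then show ?thesis
    unfolding ring_of_type_algebra_def
    by (intro ringI abelian_groupI monoidI) (auto simp: algebra_simps)
qed

theorem ideal_nichols_ideal:
  assumes "is_rack r" "is_2cocycle r q"
  shows "ideal (nichols_ideal r q) ring_of_type_algebra"
proof (rule idealI)
  show "ring (ring_of_type_algebra :: ('a, 'b) tensor ring)"
    by (rule ring_type_algebra)
  show "subgroup (nichols_ideal r q) (add_monoid (ring_of_type_algebra :: ('a, 'b) tensor ring))"
  proof (rule group.subgroupI)
    show "Group.group (add_monoid (ring_of_type_algebra :: ('a, 'b) tensor ring))"
      using ring_type_algebra abelian_group.a_group ring.is_abelian_group by blast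
    fix f assume "f \<in> nichols_ideal r q"
    moreover have "inv\<^bsub>add_monoid (ring_of_type_algebra :: ('a, 'b) tensor ring)\<^esub> f = - f"
      unfolding m_inv_def by (rule the_equality)
        (simp_all add: ring_of_type_algebra_def eq_neg_iff_add_eq_0)
    ultimately show "inv\<^bsub>add_monoid (ring_of_type_algebra :: ('a, 'b) tensor ring)\<^esub> f \<in> nichols_ideal r q"
      by (simp only: nichols_ideal_minus)
  qed (use nichols_ideal_0 in \<open>auto simp: ring_of_type_algebra_def nichols_ideal_add\<close>)
qed (use assms in \<open>auto simp: ring_of_type_algebra_def nichols_ideal_mult_left nichols_ideal_mult_right\<close>)

section \<open>Modules over a Nichols algebra\<close>

abbreviation nichols_class :: "('x \<Rightarrow> 'x \<Rightarrow> 'x) \<Rightarrow> ('x \<Rightarrow> 'x \<Rightarrow> 'k::field) \<Rightarrow>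
    ('x, 'k) tensor \<Rightarrow> ('x, 'k) tensor set" where
  "nichols_class r q f \<equiv> nichols_ideal r q +>\<^bsub>ring_of_type_algebra\<^esub> f"

lemma nichols_class_eq: "nichols_class r q f = {h. h - f \<in> nichols_ideal r q}"
proof -
  have "h = (h - f) + f" for h :: "('a, 'b) tensor" by simp
  then show ?thesis
    by (auto simp: a_r_coset_def r_coset_def ring_of_type_algebra_def)
qed

lemma nichols_ideal_diff:
  "f \<in> nichols_ideal r q \<Longrightarrow> g \<in> nichols_ideal r q \<Longrightarrow> f - g \<in> nichols_ideal r q"
  using nichols_ideal_add[of f r q "- g"] nichols_ideal_minus[of g r q] by simp

lemma nichols_class_self: "f \<in> nichols_class r q f"
  by (simp add: nichols_class_eq nichols_ideal_0)

lemma nichols_class_eqI: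
  assumes "f - g \<in> nichols_ideal r q"
  shows "nichols_class r q f = nichols_class r q g"
proof -
  have "h - g = (h - f) + (f - g)" "h - f = (h - g) - (f - g)" for h
    by simp_all
  then show ?thesis
    unfolding nichols_class_eq using assms nichols_ideal_add nichols_ideal_diff
    by (metis (no_types, lifting))
qed

lemma nichols_algebra_simps:
  assumes "is_rack r" "is_2cocycle r q"
  shows "carrier (nichols_algebra r q) = range (nichols_class r q)"
    and "nichols_class r q f \<oplus>\<^bsub>nichols_algebra r q\<^esub> nichols_class r q g = nichols_class r q (f + g)"
    and "nichols_class r q f \<otimes>\<^bsub>nichols_algebra r q\<^esub> nichols_class r q g = nichols_class r q (f * g)"
    and "\<one>\<^bsub>nichols_algebra r q\<^esub> = nichols_class r q 1"
    and "scal (nichols_algebra r q) c (nichols_class r q f) = nichols_class r q (pscale c f)"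
    and "acomp (nichols_algebra r q) n = {nichols_class r q f |f. f \<in> tensor_power n}"
proof -
  let ?T = "ring_of_type_algebra :: ('a, 'b) tensor ring"
  interpret ideal "nichols_ideal r q" ?T
    using assms by (rule ideal_nichols_ideal)
  have T: "carrier ?T = UNIV" "\<And>a b. a \<oplus>\<^bsub>?T\<^esub> b = a + b" "\<And>a b. a \<otimes>\<^bsub>?T\<^esub> b = a * b" "\<one>\<^bsub>?T\<^esub> = 1"
    by (simp_all add: ring_of_type_algebra_def)
  show "carrier (nichols_algebra r q) = range (nichols_class r q)"
    by (auto simp: nichols_algebra_def Let_def ring.defs FactRing_def A_RCOSETS_def' T)
  show "nichols_class r q f \<oplus>\<^bsub>nichols_algebra r q\<^esub> nichols_class r q g = nichols_class r q (f + g)"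
    using a_rcos_sum[of f g] by (simp add: nichols_algebra_def Let_def ring.defs FactRing_def T)
  show "nichols_class r q f \<otimes>\<^bsub>nichols_algebra r q\<^esub> nichols_class r q g = nichols_class r q (f * g)"
    using rcoset_mult_add[of f g] by (simp add: nichols_algebra_def Let_def ring.defs FactRing_def T)
  show "\<one>\<^bsub>nichols_algebra r q\<^esub> = nichols_class r q 1"
    by (simp add: nichols_algebra_def Let_def ring.defs FactRing_def T)
  \<comment> \<open>The union defining \<open>scal\<close> runs over all representatives of the
    coset. Each contributes the same coset, so the union collapses.\<close>
  have "nichols_class r q (pscale c h) = nichols_class r q (pscale c f)" if "h \<in> nichols_class r q f" for h
  proof (rule nichols_class_eqI)
    have "pscale c h - pscale c f = pscale c (h - f)"
      by (rule poly_mapping_eqI) (simp add: lookup_minus algebra_simps)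
    then show "pscale c h - pscale c f \<in> nichols_ideal r q"
      using that by (simp add: nichols_class_eq nichols_ideal_pscale)
  qed
  then have "(\<Union>h\<in>nichols_class r q f. nichols_class r q (pscale c h)) = nichols_class r q (pscale c f)"
    using nichols_class_self[of f r q] by blast
  then show "scal (nichols_algebra r q) c (nichols_class r q f) = nichols_class r q (pscale c f)"
    by (simp add: nichols_algebra_def Let_def ring.defs graded_algebra.defs)
  show "acomp (nichols_algebra r q) n = {nichols_class r q f |f. f \<in> tensor_power n}"
    by (simp add: nichols_algebra_def Let_def ring.defs graded_algebra.defs)
qed

lemma graded_left_module_nichols:
  assumes "is_rack r" "is_2cocycle r q"
  shows "graded_left_module s (nichols_algebra r q) M \<longleftrightarrow>
     (\<forall>j. Modules.module.subspace s (mcomp M j)) \<and>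
     (\<forall>I v. finite I \<and> (\<forall>j\<in>I. v j \<in> mcomp M j) \<and> (\<Sum>j\<in>I. v j) = 0 \<longrightarrow> (\<forall>j\<in>I. v j = 0)) \<and>
     (\<forall>f. \<forall>m\<in>mspace s M. act M (nichols_class r q f) m \<in> mspace s M) \<and>
     (\<forall>f g. \<forall>m\<in>mspace s M. act M (nichols_class r q (f + g)) m =
       act M (nichols_class r q f) m + act M (nichols_class r q g) m) \<and>
     (\<forall>f. \<forall>m\<in>mspace s M. \<forall>m'\<in>mspace s M. act M (nichols_class r q f) (m + m') =
       act M (nichols_class r q f) m + act M (nichols_class r q f) m') \<and>
     (\<forall>f g. \<forall>m\<in>mspace s M. act M (nichols_class r q (f * g)) m =
       act M (nichols_class r q f) (act M (nichols_class r q g) m)) \<and>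
     (\<forall>m\<in>mspace s M. act M (nichols_class r q 1) m = m) \<and>
     (\<forall>c f. \<forall>m\<in>mspace s M. act M (nichols_class r q (pscale c f)) m = s c (act M (nichols_class r q f) m)) \<and>
     (\<forall>i j. \<forall>f\<in>tensor_power i. \<forall>m\<in>mcomp M j. act M (nichols_class r q f) m \<in> mcomp M (i + j))"
proof -
  have 1: "(\<forall>a\<in>carrier (nichols_algebra r q). P a) \<longleftrightarrow> (\<forall>f. P (nichols_class r q f))" for P
    unfolding nichols_algebra_simps(1)[OF assms] by blast
  have 2: "(\<forall>a\<in>acomp (nichols_algebra r q) i. P a) \<longleftrightarrow> (\<forall>f\<in>tensor_power i. P (nichols_class r q f))" for P i
    unfolding nichols_algebra_simps(6)[OF assms] by blast
  show ?thesis
    unfolding graded_left_module_def 1 2 nichols_algebra_simps(2-5)[OF assms] by (rule refl)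
qed

text \<open>The last letter acts first, so the letter in front of \<open>xs\<close> meets the basis
  vector of degree \<open>j + length xs\<close>. The arguments of \<open>lam\<close> come in the
  order degree, letter, opposite to \<open>has_points\<close>.\<close>

primrec word_weight :: "(nat \<Rightarrow> 'x \<Rightarrow> 'k::field) \<Rightarrow> nat \<Rightarrow> 'x list \<Rightarrow> 'k" where
  "word_weight lam j [] = 1"
| "word_weight lam j (x # xs) = lam (j + length xs) x * word_weight lam j xs"

lemma word_weight_append:
  "word_weight lam j (xs @ ys) = word_weight lam (j + length ys) xs * word_weight lam j ys"
  by (induction xs) (simp_all add: add.commute add.left_commute)

definition path_act :: "(nat \<Rightarrow> ('b \<Rightarrow>\<^sub>0 'k)) \<Rightarrow> (nat \<Rightarrow> 'x \<Rightarrow> 'k::field) \<Rightarrow> ('x, 'k) tensor \<Rightarrow> nat \<Rightarrow> ('b \<Rightarrow>\<^sub>0 'k)"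
  where "path_act e lam f j = word_sum pscale (\<lambda>xs. pscale (word_weight lam j xs) (e (j + length xs))) f"

text \<open>A homogeneous basis with its structure constants. Setting the vectors above degree
  \<open>n\<close> to 0 makes the formula for the action of a word valid in all degrees.\<close>

definition point_frame :: "('x \<Rightarrow> 'a) \<Rightarrow> nat \<Rightarrow> ('a, 'b \<Rightarrow>\<^sub>0 'k::field) graded_module \<Rightarrow>
    (nat \<Rightarrow> ('b \<Rightarrow>\<^sub>0 'k)) \<Rightarrow> (nat \<Rightarrow> 'x \<Rightarrow> 'k) \<Rightarrow> bool" where
  "point_frame gen n M e lam \<longleftrightarrow>
     (\<forall>j\<le>n. e j \<noteq> 0 \<and> mcomp M j = pscale.span {e j}) \<and> (\<forall>j>n. e j = 0) \<and>
     (\<forall>j<n. \<forall>i. act M (gen i) (e j) = pscale (lam j i) (e (Suc j)))"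

lemma has_points_iff_frame:
  "has_points pscale gen n M ps \<longleftrightarrow>
    (\<exists>e lam. point_frame gen n M e lam \<and> ps = map (\<lambda>j. proj_point (lam j)) [0..<n])"
proof
  assume "has_points pscale gen n M ps"
  then obtain e lam where
    "\<forall>j\<le>n. e j \<noteq> 0 \<and> mcomp M j = pscale.span {e j}"
    "\<forall>j<n. \<forall>i. act M (gen i) (e j) = pscale (lam i j) (e (Suc j))"
    "ps = map (\<lambda>j. proj_point (\<lambda>i. lam i j)) [0..<n]"
    unfolding has_points_def by blast
  then show "\<exists>e lam. point_frame gen n M e lam \<and> ps = map (\<lambda>j. proj_point (lam j)) [0..<n]"
    by (intro exI[of _ "\<lambda>j. if j \<le> n then e j else 0"] exI[of _ "\<lambda>j i. lam i j"])
      (auto simp: point_frame_def)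
next
  assume "\<exists>e lam. point_frame gen n M e lam \<and> ps = map (\<lambda>j. proj_point (lam j)) [0..<n]"
  then obtain e lam where "point_frame gen n M e lam" "ps = map (\<lambda>j. proj_point (lam j)) [0..<n]"
    by blast
  then show "has_points pscale gen n M ps"
    unfolding has_points_def point_frame_def
    by (intro exI[of _ e] exI[of _ "\<lambda>i j. lam j i"]) auto
qed

lemma proj_point_scale: "c \<noteq> 0 \<Longrightarrow> proj_point (\<lambda>i. c * u i) = proj_point u"
proof -
  assume c: "c \<noteq> 0"
  have "(\<exists>d. d \<noteq> 0 \<and> v = (\<lambda>i. d * (c * u i))) \<longleftrightarrow> (\<exists>d. d \<noteq> 0 \<and> v = (\<lambda>i. d * u i))" for v
  proof
    assume "\<exists>d. d \<noteq> 0 \<and> v = (\<lambda>i. d * (c * u i))"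
    then show "\<exists>d. d \<noteq> 0 \<and> v = (\<lambda>i. d * u i)"
      using c by (metis (no_types, lifting) ext mult.assoc mult_eq_0_iff)
  next
    assume "\<exists>d. d \<noteq> 0 \<and> v = (\<lambda>i. d * u i)"
    then obtain d where "d \<noteq> 0" "v = (\<lambda>i. d * u i)" by blast
    then show "\<exists>d. d \<noteq> 0 \<and> v = (\<lambda>i. d * (c * u i))"
      using c by (intro exI[of _ "d / c"]) auto
  qed
  moreover have "(\<lambda>i. c * u i) \<noteq> (\<lambda>_. 0) \<longleftrightarrow> u \<noteq> (\<lambda>_. 0)"
    using c by (simp add: fun_eq_iff)
  ultimately show ?thesis
    by (simp add: proj_point_def proj_rel_def Image_def)
qed

lemma proj_point_eqD:
  assumes "proj_point u = proj_point v" "u \<noteq> (\<lambda>_. 0)"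
  obtains c where "c \<noteq> 0" "v = (\<lambda>i. c * u i)"
proof -
  have "u \<in> proj_point u"
    using assms(2) by (auto simp: proj_point_def proj_rel_def intro: exI[of _ 1])
  then have "u \<in> proj_point v" by (simp add: assms)
  then obtain c where "c \<noteq> 0" "u = (\<lambda>i. c * v i)"
    by (auto simp: proj_point_def proj_rel_def)
  then show ?thesis
    using that[of "1 / c"] by auto
qed

section \<open>Frames of a given truncated point module\<close>

locale nichols_module =
  fixes r :: "'x \<Rightarrow> 'x \<Rightarrow> 'x" and q :: "'x \<Rightarrow> 'x \<Rightarrow> 'k::field" and n :: nat
    and M :: "(('x, 'k) tensor set, nat \<Rightarrow>\<^sub>0 'k) graded_module"
  assumes rack: "is_rack r" and cocycle: "is_2cocycle r q"
    and truncated: "truncated_point_module pscale (nichols_algebra r q) n M"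
begin

abbreviation "cls \<equiv> nichols_class r q"
abbreviation "S \<equiv> mspace pscale M"

lemma graded_module: "graded_left_module pscale (nichols_algebra r q) M"
  using truncated by (simp add: truncated_point_module_def)

lemmas module_axioms = graded_module[unfolded graded_left_module_nichols[OF rack cocycle]]

lemmas subspace_mcomp = module_axioms[THEN conjunct1, rule_format]
  and direct_sum = module_axioms[THEN conjunct2, THEN conjunct1]
  and act_add = module_axioms[THEN conjunct2, THEN conjunct2, THEN conjunct2, THEN conjunct1, rule_format]
  and act_add_right = module_axioms[THEN conjunct2, THEN conjunct2, THEN conjunct2, THEN conjunct2, THEN conjunct1, rule_format]
  and act_mult = module_axioms[THEN conjunct2, THEN conjunct2, THEN conjunct2, THEN conjunct2, THEN conjunct2, THEN conjunct1, rule_format]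
  and act_one = module_axioms[THEN conjunct2, THEN conjunct2, THEN conjunct2, THEN conjunct2, THEN conjunct2, THEN conjunct2, THEN conjunct1, rule_format]
  and act_pscale = module_axioms[THEN conjunct2, THEN conjunct2, THEN conjunct2, THEN conjunct2, THEN conjunct2, THEN conjunct2, THEN conjunct2, THEN conjunct1, rule_format]
  and act_mcomp = module_axioms[THEN conjunct2, THEN conjunct2, THEN conjunct2, THEN conjunct2, THEN conjunct2, THEN conjunct2, THEN conjunct2, THEN conjunct2, rule_format]

lemma direct:
  assumes "finite I" "\<And>j. j \<in> I \<Longrightarrow> v j \<in> mcomp M j" "(\<Sum>j\<in>I. v j) = 0" "j \<in> I"
  shows "v j = 0"
  by (rule direct_sum[rule_format, of I]) (use assms in auto)

lemma mcomp_subset: "mcomp M j \<subseteq> S"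
  unfolding mspace_def by (rule order_trans[OF _ pscale.span_superset]) auto

lemma subspace_S: "pscale.subspace S"
  unfolding mspace_def by (rule pscale.subspace_span)

text \<open>The module axioms state compatibility with scalars only for the algebra argument. The
  scalar is therefore realised as the algebra element \<open>pscale c 1\<close> and moved through
  the product.\<close>

lemma act_pscale_right:
  assumes "m \<in> S"
  shows "act M (cls f) (pscale c m) = pscale c (act M (cls f) m)"
proof -
  have "act M (cls f) (pscale c m) = act M (cls f) (act M (cls (pscale c 1)) m)"
    using assms by (simp only: act_pscale act_one)
  also have "\<dots> = act M (cls (f * pscale c 1)) m"
    using assms by (simp only: act_mult)
  also have "f * pscale c 1 = pscale c f"
    by (simp only: pscale_mult_right mult_1_right)
  finally show ?thesis
    using assms by (simp only: act_pscale)
qed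

lemma act_0: "m \<in> S \<Longrightarrow> act M (cls 0) m = 0"
  using act_pscale[of m 0 0] by simp

lemma act_0_right: "act M (cls f) 0 = 0"
  using act_pscale_right[of 0 f 0] pscale.subspace_0[OF subspace_S] by simp

lemma act_sum_right: "(\<And>i. i \<in> I \<Longrightarrow> m i \<in> S) \<Longrightarrow> act M (cls f) (sum m I) = (\<Sum>i\<in>I. act M (cls f) (m i))"
proof (induction I rule: infinite_finite_induct)
  case (insert i I)
  then have "sum m I \<in> S"
    by (intro pscale.subspace_sum[OF subspace_S]) auto
  then show ?case
    using insert by (simp add: act_add_right)
qed (simp_all add: act_0_right)

lemma mcomp_above: "n < j \<Longrightarrow> mcomp M j = {0}"
proof -
  assume "n < j"
  then have "pscale.dim (mcomp M j) = 0" "\<exists>E. finite E \<and> mcomp M j \<subseteq> pscale.span E"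
    using truncated by (auto simp: truncated_point_module_def has_hilbert_series_def)
  then obtain E where E: "finite E" "mcomp M j \<subseteq> pscale.span E" by blast
  obtain B where B: "B \<subseteq> mcomp M j" "pscale.independent B" "mcomp M j \<subseteq> pscale.span B"
      "card B = pscale.dim (mcomp M j)"
    using pscale.basis_exists by blast
  \<comment> \<open>Finiteness has to come first, because \<open>card\<close> is 0 on infinite sets
    as well.\<close>
  have "finite B"
    using pscale.independent_span_bound[OF E(1) B(2)] B(1) E(2) by auto
  then have "B = {}" using B \<open>pscale.dim (mcomp M j) = 0\<close> by auto
  then show ?thesis
    using B pscale.subspace_0[OF subspace_mcomp] by auto
qed

lemma mcomp_below: "j \<le> n \<Longrightarrow> \<exists>v. v \<noteq> 0 \<and> mcomp M j = pscale.span {v}"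
proof -
  assume "j \<le> n"
  then have "pscale.dim (mcomp M j) = 1"
    using truncated by (auto simp: truncated_point_module_def has_hilbert_series_def)
  moreover obtain B where B: "B \<subseteq> mcomp M j" "pscale.independent B" "mcomp M j \<subseteq> pscale.span B"
      "card B = pscale.dim (mcomp M j)"
    using pscale.basis_exists by blast
  ultimately obtain v where v: "B = {v}"
    using card_1_singletonE by metis
  have "mcomp M j = pscale.span {v}"
    using B v pscale.span_minimal[OF _ subspace_mcomp] by blast
  moreover have "v \<noteq> 0"
    using B v by (auto simp: pscale.dependent_zero)
  ultimately show ?thesis by blast
qed

lemma nichols_gen_eq: "nichols_gen r q x = cls (basis [x])"
  by (simp add: nichols_gen_def)

lemma frame_exists: "\<exists>e lam. point_frame (nichols_gen r q) n M e lam"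
proof -
  obtain e where e: "\<And>j. j \<le> n \<Longrightarrow> e j \<noteq> 0 \<and> mcomp M j = pscale.span {e j}"
    using mcomp_below by metis
  have "act M (nichols_gen r q i) (e j) \<in> pscale.span {e (Suc j)}" if "j < n" for i j
    using act_mcomp[of "basis [i]" 1 "e j" j] e[of j] e[of "Suc j"] that pscale.span_base[of "e j" "{e j}"]
    by (simp add: nichols_gen_eq)
  then have "\<exists>c. act M (nichols_gen r q i) (e j) = pscale c (e (Suc j))" if "j < n" for i j
    using that by (auto simp: pscale.span_singleton)
  then obtain lam where "\<And>i j. j < n \<Longrightarrow> act M (nichols_gen r q i) (e j) = pscale (lam j i) (e (Suc j))"
    by metis
  with e show ?thesis
    by (intro exI[of _ "\<lambda>j. if j \<le> n then e j else 0"] exI[of _ lam]) (auto simp: point_frame_def)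
qed

end

definition frame_comb :: "nat \<Rightarrow> (nat \<Rightarrow> ('b \<Rightarrow>\<^sub>0 'k::field)) \<Rightarrow> (nat \<Rightarrow> 'k) \<Rightarrow> ('b \<Rightarrow>\<^sub>0 'k)" where
  "frame_comb n e a = (\<Sum>j\<le>n. pscale (a j) (e j))"

lemma frame_comb_add: "frame_comb n e (\<lambda>j. a j + b j) = frame_comb n e a + frame_comb n e b"
  by (simp add: frame_comb_def pscale_add_left sum.distrib)

lemma frame_comb_pscale: "frame_comb n e (\<lambda>j. c * a j) = pscale c (frame_comb n e a)"
  by (simp add: frame_comb_def pscale_sum)

lemma frame_comb_sum:
  "frame_comb n e (\<lambda>j. \<Sum>i\<in>I. b i j) = (\<Sum>i\<in>I. frame_comb n e (b i))"
  by (induction I rule: infinite_finite_induct) (simp_all add: frame_comb_add, simp_all add: frame_comb_def)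

lemma frame_comb_single:
  assumes "j \<le> n"
  shows "frame_comb n e (\<lambda>i. if i = j then c else 0) = pscale c (e j)"
proof -
  have "frame_comb n e (\<lambda>i. if i = j then c else 0) = (\<Sum>i\<le>n. if i = j then pscale c (e j) else 0)"
    unfolding frame_comb_def by (intro sum.cong) auto
  then show ?thesis using assms by simp
qed

definition path_coeff :: "(nat \<Rightarrow> 'x \<Rightarrow> 'k::field) \<Rightarrow> ('x, 'k) tensor \<Rightarrow> nat \<Rightarrow> nat \<Rightarrow> 'k" where
  "path_coeff lam f i j = pairing (\<lambda>xs. if i + length xs = j then word_weight lam i xs else 0) f"

lemma path_act_eq_frame_comb:
  assumes "\<And>j. n < j \<Longrightarrow> e j = 0"
  shows "path_act e lam f i = frame_comb n e (path_coeff lam f i)"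
  unfolding path_act_def path_coeff_def
proof (induction f rule: tensor_induct)
  case zero
  then show ?case by (simp add: frame_comb_def)
next
  case (basis c xs)
  have "frame_comb n e (\<lambda>j. pairing (\<lambda>xs. if i + length xs = j then word_weight lam i xs else 0) (pscale c (basis xs))) =
      (\<Sum>j\<le>n. if j = i + length xs then pscale (c * word_weight lam i xs) (e (i + length xs)) else 0)"
    unfolding frame_comb_def by (intro sum.cong) (auto simp: pairing.word_sum_pscale)
  then show ?case
    using assms[of "i + length xs"] by (simp add: pscale.word_sum_pscale)
next
  case (add f g)
  then show ?case
    by (simp add: pscale.word_sum_add pairing.word_sum_add frame_comb_add)
qed

definition is_point_path :: "('x \<Rightarrow> 'x \<Rightarrow> 'x) \<Rightarrow> ('x \<Rightarrow> 'x \<Rightarrow> 'k::field) \<Rightarrow> nat \<Rightarrow> (nat \<Rightarrow> 'x \<Rightarrow> 'k) \<Rightarrow> bool"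
  where "is_point_path r q n lam \<longleftrightarrow> (\<forall>j<n. lam j \<noteq> (\<lambda>_. 0)) \<and>
    (\<forall>j k. j + k \<le> n \<longrightarrow> (\<forall>f\<in>qsym_kernel r q k. pairing (word_weight lam j) f = 0))"

context nichols_module
begin

abbreviation "frame e lam \<equiv> point_frame (nichols_gen r q) n M e lam"

lemma frame_mcomp: "frame e lam \<Longrightarrow> mcomp M j = pscale.span {e j}"
  using mcomp_above[of j] by (cases "j \<le> n") (auto simp: point_frame_def pscale.span_singleton)

lemma frame_in_mcomp: "frame e lam \<Longrightarrow> e j \<in> mcomp M j"
  using pscale.span_base[of "e j" "{e j}"] by (simp add: frame_mcomp)

lemma frame_in_S: "frame e lam \<Longrightarrow> e j \<in> S"
  using frame_in_mcomp mcomp_subset by blast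

lemma frame_act_basis:
  assumes "frame e lam"
  shows "act M (cls (basis xs)) (e j) = pscale (word_weight lam j xs) (e (j + length xs))"
proof (induction xs)
  case Nil
  then show ?case
    using frame_in_S[OF assms] by (simp add: basis_Nil act_one)
next
  case (Cons x xs)
  let ?i = "j + length xs"
  have "act M (cls (basis [x])) (e ?i) = pscale (lam ?i x) (e (Suc ?i))"
  proof (cases "?i < n")
    case True
    then show ?thesis
      using assms by (simp add: point_frame_def nichols_gen_eq)
  next
    case False
    then have "e (Suc ?i) = 0" using assms by (simp add: point_frame_def)
    moreover have "act M (cls (basis [x])) (e ?i) \<in> mcomp M (1 + ?i)"
      using frame_in_mcomp[OF assms] by (intro act_mcomp) auto
    ultimately show ?thesis
      using mcomp_above[of "Suc ?i"] False by simp
  qed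
  moreover have "act M (cls (basis (x # xs))) (e j) = act M (cls (basis [x])) (act M (cls (basis xs)) (e j))"
    using frame_in_S[OF assms] act_mult[of "e j" "basis [x]" "basis xs"] by (simp add: basis_mult)
  ultimately show ?case
    using frame_in_S[OF assms] by (simp add: Cons act_pscale_right mult.commute)
qed

lemma frame_act:
  assumes "frame e lam"
  shows "act M (cls f) (e j) = path_act e lam f j"
  using frame_in_S[OF assms, of j]
  by (induction f rule: tensor_induct)
    (simp_all add: path_act_def act_0 act_pscale frame_act_basis[OF assms] act_add
      pscale.word_sum_pscale pscale.word_sum_add)

lemma frame_act_comb:
  assumes "frame e lam"
  shows "act M (cls f) (frame_comb n e a) = frame_comb n e (\<lambda>j. \<Sum>i\<le>n. a i * path_coeff lam f i j)"
proof -
  have "act M (cls f) (frame_comb n e a) = (\<Sum>i\<le>n. pscale (a i) (path_act e lam f i))"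
    unfolding frame_comb_def using frame_in_S[OF assms] pscale.subspace_scale[OF subspace_S]
    by (subst act_sum_right) (auto simp: act_pscale_right frame_act[OF assms])
  also have "\<dots> = (\<Sum>i\<le>n. frame_comb n e (\<lambda>j. a i * path_coeff lam f i j))"
    using assms by (simp add: point_frame_def frame_comb_pscale path_act_eq_frame_comb[of n e])
  finally show ?thesis
    by (simp add: frame_comb_sum)
qed

lemma frame_comb_eqD:
  assumes "frame e lam" "frame_comb n e a = frame_comb n e b" "j \<le> n"
  shows "a j = b j"
proof -
  have "(\<Sum>j\<le>n. pscale (a j - b j) (e j)) = frame_comb n e (\<lambda>j. a j + (- 1) * b j)"
    by (simp add: frame_comb_def)
  also have "\<dots> = 0"
    unfolding frame_comb_add frame_comb_pscale assms(2) by (rule poly_mapping_eqI) (simp add: lookup_add)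
  finally have "pscale (a j - b j) (e j) = 0"
    using assms(3) frame_mcomp[OF assms(1)]
    by (intro direct[of "{..n}" "\<lambda>j. pscale (a j - b j) (e j)"]) (auto simp: pscale.span_singleton)
  then show ?thesis
    using assms by (auto simp: point_frame_def)
qed

lemma frame_comb_in_S: "frame e lam \<Longrightarrow> frame_comb n e a \<in> S"
  unfolding frame_comb_def
  by (intro pscale.subspace_sum pscale.subspace_scale subspace_S frame_in_S)

lemma S_eq_frame_comb:
  assumes "frame e lam"
  shows "S = range (frame_comb n e)"
proof
  show "range (frame_comb n e) \<subseteq> S"
    using frame_comb_in_S[OF assms] by auto
  have sub: "pscale.subspace (range (frame_comb n e))"
  proof (rule pscale.subspaceI)
    show "0 \<in> range (frame_comb n e)"
      by (rule range_eqI[of _ _ "\<lambda>_. 0"]) (simp add: frame_comb_def)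
    show "x + y \<in> range (frame_comb n e)" if "x \<in> range (frame_comb n e)" "y \<in> range (frame_comb n e)" for x y
      using that by (auto simp flip: frame_comb_add)
    show "pscale c x \<in> range (frame_comb n e)" if "x \<in> range (frame_comb n e)" for c x
      using that by (auto simp flip: frame_comb_pscale)
  qed
  have "mcomp M j \<subseteq> range (frame_comb n e)" for j
  proof (cases "j \<le> n")
    case True
    then have "pscale c (e j) \<in> range (frame_comb n e)" for c
      by (metis frame_comb_single rangeI)
    then show ?thesis
      using frame_mcomp[OF assms] by (auto simp: pscale.span_singleton)
  next
    case False
    then show ?thesis
      using mcomp_above[of j] pscale.subspace_0[OF sub] by simp
  qed
  then show "S \<subseteq> range (frame_comb n e)"
    unfolding mspace_def by (intro pscale.span_minimal sub) blast
qed

text \<open>If the coordinates in degree \<open>j\<close> vanish, no word leads from degree 0 to a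
  degree above \<open>j\<close>. Generation in degree 0 then puts \<open>e (Suc j)\<close> into the
  span of the lower components, against the directness of the sum.\<close>

lemma frame_nonzero:
  assumes "frame e lam" "j < n"
  shows "lam j \<noteq> (\<lambda>_. 0)"
proof
  assume lam: "lam j = (\<lambda>_. 0)"
  have zero: "word_weight lam 0 xs = 0" if "j < length xs" for xs
    using that
  proof (induction xs)
    case (Cons x xs)
    then show ?case by (cases "j = length xs") (use lam in auto)
  qed simp
  let ?Y = "range (frame_comb j e)"
  have sub: "pscale.subspace ?Y"
  proof (rule pscale.subspaceI)
    show "0 \<in> ?Y"
      by (rule range_eqI[of _ _ "\<lambda>_. 0"]) (simp add: frame_comb_def)
    show "x + y \<in> ?Y" if "x \<in> ?Y" "y \<in> ?Y" for x y
      using that by (auto simp flip: frame_comb_add)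
    show "pscale c x \<in> ?Y" if "x \<in> ?Y" for c x
      using that by (auto simp flip: frame_comb_pscale)
  qed
  have e: "e i \<in> ?Y" if "i \<le> j" for i
    using frame_comb_single[OF that, of e 1] by (metis pscale_1 rangeI)
  have "path_act e lam f 0 \<in> ?Y" for f
    unfolding path_act_def
  proof (induction f rule: tensor_induct)
    case (basis c xs)
    then show ?case
      using zero[of xs] e[of "length xs"] pscale.subspace_0[OF sub] pscale.subspace_scale[OF sub]
      by (cases "j < length xs") (simp_all add: pscale.word_sum_pscale)
  qed (simp_all add: pscale.subspace_0[OF sub] pscale.subspace_add[OF sub] pscale.word_sum_add)
  then have "act M a m \<in> ?Y" if "a \<in> carrier (nichols_algebra r q)" "m \<in> mcomp M 0" for a m
    using that frame_mcomp[OF assms(1), of 0] frame_in_S[OF assms(1)] pscale.subspace_scale[OF sub]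
    by (auto simp: nichols_algebra_simps(1)[OF rack cocycle] pscale.span_singleton act_pscale_right
        frame_act[OF assms(1)])
  then have "S \<subseteq> ?Y"
    using truncated unfolding truncated_point_module_def generated_in_degree_0_def
    by (auto intro!: pscale.span_minimal[OF _ sub])
  then obtain a where a: "e (Suc j) = frame_comb j e a"
    using frame_in_S[OF assms(1)] by blast
  let ?v = "\<lambda>i. if i \<le> j then pscale (- a i) (e i) else e i"
  have "(\<Sum>i\<le>Suc j. ?v i) = e (Suc j) + frame_comb j e (\<lambda>i. (- 1) * a i)"
    by (simp add: frame_comb_def)
  also have "\<dots> = 0"
    unfolding frame_comb_pscale a by (rule poly_mapping_eqI) (simp add: lookup_add)
  finally have "?v (Suc j) = 0"
    using frame_in_mcomp[OF assms(1)] pscale.subspace_scale[OF subspace_mcomp]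
      pscale.subspace_neg[OF subspace_mcomp]
    by (intro direct[of "{..Suc j}" ?v]) auto
  then show False
    using assms by (simp add: point_frame_def)
qed

text \<open>An element of the kernel acts as 0. Being homogeneous of degree \<open>k\<close>, it
  also sends \<open>e j\<close> to its pairing with the word weights times \<open>e (j + k)\<close>,
  which is non-zero up to degree \<open>n\<close>.\<close>

lemma frame_point_path:
  assumes "frame e lam"
  shows "is_point_path r q n lam"
  unfolding is_point_path_def
proof (intro conjI allI impI ballI)
  fix j k f
  assume jk: "j + k \<le> n" and f: "f \<in> qsym_kernel r q k"
  have "f - 0 \<in> nichols_ideal r q"
    using f qsym_kernel_subset_nichols_ideal by auto
  then have "cls f = cls 0" by (rule nichols_class_eqI)
  then have "path_act e lam f j = 0"
    using frame_act[OF assms, of f j] act_0[OF frame_in_S[OF assms]] by simp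
  moreover have "path_act e lam f j = word_sum pscale (\<lambda>xs. pscale (word_weight lam j xs) (e (j + k))) f"
    unfolding path_act_def using f
    by (intro word_sum_cong) (auto simp: qsym_kernel_def tensor_power_def)
  moreover have "\<dots> = pscale (pairing (word_weight lam j) f) (e (j + k))"
    by (simp add: word_sum_def pscale.scale_sum_left)
  ultimately show "pairing (word_weight lam j) f = 0"
    using assms jk by (simp add: point_frame_def)
qed (use frame_nonzero[OF assms] in auto)

lemma frame_points_unique:
  assumes "frame e lam" "frame e' lam'" "j < n"
  shows "proj_point (lam' j) = proj_point (lam j)"
proof -
  have *: "\<exists>c. c \<noteq> 0 \<and> e' i = pscale c (e i)" if "i \<le> n" for i
  proof -
    have "e' i \<in> pscale.span {e i}"
      using frame_in_mcomp[OF assms(2), of i] unfolding frame_mcomp[OF assms(1)] .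
    moreover have "e' i \<noteq> 0"
      using assms(2) that by (simp add: point_frame_def)
    ultimately show ?thesis
      by (auto simp: pscale.span_singleton)
  qed
  obtain c d where c: "c \<noteq> 0" "e' j = pscale c (e j)" and d: "d \<noteq> 0" "e' (Suc j) = pscale d (e (Suc j))"
    using *[of j] *[of "Suc j"] assms(3) by auto
  have "lam' j i = c / d * lam j i" for i
  proof -
    have "act M (nichols_gen r q i) (e' j) = pscale (lam' j i) (e' (Suc j))"
      "act M (nichols_gen r q i) (e j) = pscale (lam j i) (e (Suc j))"
      using assms by (simp_all add: point_frame_def)
    moreover have "act M (nichols_gen r q i) (e' j) = pscale c (act M (nichols_gen r q i) (e j))"
      unfolding c(2) nichols_gen_eq by (rule act_pscale_right[OF frame_in_S[OF assms(1)]])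
    moreover have "e (Suc j) \<noteq> 0"
      using assms by (simp add: point_frame_def)
    ultimately have "lam' j i * d = c * lam j i"
      by (simp add: d)
    then show ?thesis using d by (simp add: field_simps)
  qed
  then have "lam' j = (\<lambda>i. c / d * lam j i)" by blast
  then show ?thesis
    using c d proj_point_scale[of "c / d" "lam j"] by simp
qed

lemma frame_rescale:
  assumes "frame e lam" "\<And>j. j < n \<Longrightarrow> proj_point (lam' j) = proj_point (lam j)"
  shows "\<exists>e'. frame e' lam'"
proof -
  have "\<exists>c. c \<noteq> 0 \<and> lam' j = (\<lambda>i. c * lam j i)" if "j < n" for j
    using proj_point_eqD[OF assms(2)[OF that, symmetric] frame_nonzero[OF assms(1) that]] by metis
  then obtain c where c: "\<And>j. j < n \<Longrightarrow> c j \<noteq> 0" "\<And>j. j < n \<Longrightarrow> lam' j = (\<lambda>i. c j * lam j i)"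
    by metis
  \<comment> \<open>The basis is rescaled recursively: dividing by \<open>c j\<close> in the step
    from \<open>j\<close> to \<open>Suc j\<close> gives
    \<open>d j * lam j i = lam' j i * d (Suc j)\<close>.\<close>
  define d where "d j = (\<Prod>i<j. inverse (c i))" for j
  have d: "d j \<noteq> 0" if "j \<le> n" for j
    using c(1) that by (auto simp: d_def)
  have span: "pscale.span {pscale a v} = pscale.span {v}" if "a \<noteq> 0" for a :: 'k and v :: "nat \<Rightarrow>\<^sub>0 'k"
  proof -
    have "pscale b v = pscale (b / a) (pscale a v)" for b using that by simp
    then have "range (\<lambda>b. pscale b v) \<subseteq> range (\<lambda>b. pscale b (pscale a v))" by blast
    moreover have "range (\<lambda>b. pscale b (pscale a v)) \<subseteq> range (\<lambda>b. pscale b v)" by auto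
    ultimately show ?thesis
      unfolding pscale.span_singleton by blast
  qed
  have "frame (\<lambda>j. pscale (d j) (e j)) lam'"
    unfolding point_frame_def
  proof (intro conjI allI impI)
    fix j i assume j: "j < n"
    have "act M (nichols_gen r q i) (pscale (d j) (e j)) = pscale (d j) (pscale (lam j i) (e (Suc j)))"
      using assms(1) j frame_in_S[OF assms(1)] by (simp add: nichols_gen_eq act_pscale_right point_frame_def)
    also have "d j * lam j i = lam' j i * d (Suc j)"
      using c[OF j] by (simp add: d_def)
    then have "pscale (d j) (pscale (lam j i) (e (Suc j))) = pscale (lam' j i) (pscale (d (Suc j)) (e (Suc j)))"
      by simp
    finally show "act M (nichols_gen r q i) (pscale (d j) (e j)) =
        pscale (lam' j i) (pscale (d (Suc j)) (e (Suc j)))" .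
  qed (use assms(1) d span in \<open>auto simp: point_frame_def\<close>)
  then show ?thesis by blast
qed

lemma ex1_has_points: "\<exists>!ps. has_points pscale (nichols_gen r q) n M ps"
proof -
  obtain e lam where "frame e lam" using frame_exists by blast
  moreover have "map (\<lambda>j. proj_point (lam' j)) [0..<n] = map (\<lambda>j. proj_point (lam j)) [0..<n]"
    if "frame e' lam'" for e' lam'
    using frame_points_unique[OF \<open>frame e lam\<close> that] by simp
  ultimately show ?thesis
    unfolding has_points_iff_frame by metis
qed

end

section \<open>Graded isomorphisms in terms of frames\<close>

lemma graded_isomorphic_same_frame:
  assumes "nichols_module r q n M" "nichols_module r q n N"
    and "point_frame (nichols_gen r q) n M e lam" "point_frame (nichols_gen r q) n N e' lam"
  shows "graded_isomorphic pscale (nichols_algebra r q) M N"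
proof -
  interpret M: nichols_module r q n M by fact
  interpret N: nichols_module r q n N by fact
  \<comment> \<open>\<open>frame_comb\<close> sees the coordinates up to \<open>n\<close> only.
    Forcing the others to be 0 makes coordinates unique, so that the isomorphism can be defined
    through an inverse.\<close>
  define A where "A = {a :: nat \<Rightarrow> 'b. \<forall>j>n. a j = 0}"
  define cut where "cut a j = (if j \<le> n then a j else 0)" for a :: "nat \<Rightarrow> 'b" and j
  have cut: "cut a \<in> A" "frame_comb n e (cut a) = frame_comb n e a" "frame_comb n e' (cut a) = frame_comb n e' a" for a
    by (auto simp: A_def cut_def frame_comb_def intro!: sum.cong)
  have bij: "bij_betw (frame_comb n e) A M.S" "bij_betw (frame_comb n e') A N.S"
  proof -
    have "range (frame_comb n e) = frame_comb n e ` A" "range (frame_comb n e') = frame_comb n e' ` A"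
      using cut by (auto simp: image_iff) metis+
    moreover have A_eqI: "a = b" if "a \<in> A" "b \<in> A" "\<And>j. j \<le> n \<Longrightarrow> a j = b j" for a b
      using that by (auto simp: A_def fun_eq_iff) (metis not_le)
    have "inj_on (frame_comb n e) A"
      by (intro inj_onI A_eqI) (auto dest: M.frame_comb_eqD[OF assms(3)])
    moreover have "inj_on (frame_comb n e') A"
      by (intro inj_onI A_eqI) (auto dest: N.frame_comb_eqD[OF assms(4)])
    ultimately show "bij_betw (frame_comb n e) A M.S" "bij_betw (frame_comb n e') A N.S"
      using M.S_eq_frame_comb[OF assms(3)] N.S_eq_frame_comb[OF assms(4)]
      by (simp_all add: bij_betw_def)
  qed
  define h where "h = frame_comb n e' \<circ> inv_into A (frame_comb n e)"
  have h: "h (frame_comb n e a) = frame_comb n e' a" for a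
    using bij_betw_inv_into_left[OF bij(1) cut(1)[of a]] by (simp add: h_def cut)
  have "bij_betw h M.S N.S"
    unfolding h_def by (rule bij_betw_trans[OF bij_betw_inv_into[OF bij(1)] bij(2)])
  moreover have "h (x + y) = h x + h y" if "x \<in> M.S" "y \<in> M.S" for x y
    using that M.S_eq_frame_comb[OF assms(3)] by (auto simp: h frame_comb_add simp flip: frame_comb_add)
  moreover have "h (act M a x) = act N a (h x)" if "a \<in> carrier (nichols_algebra r q)" "x \<in> M.S" for a x
    using that M.S_eq_frame_comb[OF assms(3)]
    by (auto simp: nichols_algebra_simps(1)[OF M.rack M.cocycle] h M.frame_act_comb[OF assms(3)]
        N.frame_act_comb[OF assms(4)])
  moreover have "h ` mcomp M j = mcomp N j" for j
  proof (cases "j \<le> n")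
    case True
    have "h (pscale c (e j)) = pscale c (e' j)" for c
      using h[of "\<lambda>i. if i = j then c else 0"] by (simp add: frame_comb_single[OF True])
    then show ?thesis
      using M.frame_mcomp[OF assms(3)] N.frame_mcomp[OF assms(4)]
      by (simp add: pscale.span_singleton image_image)
  next
    case False
    have "h 0 = 0"
      using h[of "\<lambda>_. 0"] by (simp add: frame_comb_def)
    then show ?thesis
      using False M.mcomp_above[of j] N.mcomp_above[of j] by simp
  qed
  ultimately show ?thesis
    unfolding graded_isomorphic_def by blast
qed

lemma graded_isomorphic_frame:
  assumes "nichols_module r q n M" "nichols_module r q n N"
    and "point_frame (nichols_gen r q) n M e lam" "graded_isomorphic pscale (nichols_algebra r q) M N"
  shows "\<exists>e'. point_frame (nichols_gen r q) n N e' lam"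
proof -
  interpret M: nichols_module r q n M by fact
  interpret N: nichols_module r q n N by fact
  obtain h where bij: "bij_betw h M.S N.S"
    and add: "\<And>x y. x \<in> M.S \<Longrightarrow> y \<in> M.S \<Longrightarrow> h (x + y) = h x + h y"
    and act: "\<And>f x. x \<in> M.S \<Longrightarrow> h (act M (M.cls f) x) = act N (M.cls f) (h x)"
    and comp: "\<And>j. h ` mcomp M j = mcomp N j"
    using assms(4) by (auto simp: graded_isomorphic_def nichols_algebra_simps(1)[OF M.rack M.cocycle])
  have in_N: "h x \<in> N.S" if "x \<in> M.S" for x
    using bij that by (auto simp: bij_betw_def)
  \<comment> \<open>Isomorphisms are assumed to be additive and compatible with the algebra; scalars
    enter as the algebra elements \<open>pscale c 1\<close>.\<close>
  have scale: "h (pscale c x) = pscale c (h x)" if "x \<in> M.S" for c x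
    using act[OF that, of "pscale c 1"] that in_N[OF that]
    by (simp add: M.act_pscale M.act_one N.act_pscale N.act_one)
  have e: "e j \<in> M.S" for j using M.frame_in_S[OF assms(3)] .
  have h0: "h 0 = 0"
    using scale[OF e[of 0], of 0] by simp
  have "h (e j) \<noteq> 0" if "j \<le> n" for j
  proof
    assume "h (e j) = 0"
    then have "e j = 0"
      using bij h0 e[of j] pscale.subspace_0[OF M.subspace_S] by (metis bij_betw_def inj_on_def)
    then show False using assms(3) that by (simp add: point_frame_def)
  qed
  moreover have "mcomp N j = pscale.span {h (e j)}" for j
    using comp[of j] M.frame_mcomp[OF assms(3), of j] e
    by (auto simp: pscale.span_singleton scale image_image)
  moreover have "act N (nichols_gen r q i) (h (e j)) = pscale (lam j i) (h (e (Suc j)))" if "j < n" for i j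
    using act[OF e[of j], of "basis [i]"] assms(3) that e
    by (simp add: point_frame_def M.nichols_gen_eq scale)
  moreover have "h (e j) = 0" if "n < j" for j
    using that assms(3) h0 by (simp add: point_frame_def)
  ultimately show ?thesis
    by (intro exI[of _ "h \<circ> e"]) (simp add: point_frame_def)
qed

section \<open>The truncated point module of a point path\<close>

definition std_vec :: "nat \<Rightarrow> nat \<Rightarrow> (nat \<Rightarrow>\<^sub>0 'k::field)" where
  "std_vec n j = (if j \<le> n then Poly_Mapping.single j 1 else 0)"

lemma lookup_std_vec: "Poly_Mapping.lookup (std_vec n j) i = (if i = j \<and> j \<le> n then 1 else 0)"
  by (auto simp: std_vec_def lookup_single when_def)

definition word_act :: "nat \<Rightarrow> (nat \<Rightarrow> 'x \<Rightarrow> 'k::field) \<Rightarrow> 'x list \<Rightarrow> (nat \<Rightarrow>\<^sub>0 'k) \<Rightarrow> (nat \<Rightarrow>\<^sub>0 'k)" where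
  "word_act n lam xs m =
     (\<Sum>i\<le>n. pscale (Poly_Mapping.lookup m i * word_weight lam i xs) (std_vec n (i + length xs)))"

lemma lookup_word_act:
  "Poly_Mapping.lookup (word_act n lam xs m) j =
    (if length xs \<le> j \<and> j \<le> n
     then Poly_Mapping.lookup m (j - length xs) * word_weight lam (j - length xs) xs else 0)"
proof -
  have "Poly_Mapping.lookup (word_act n lam xs m) j =
      (\<Sum>i\<le>n. if i = j - length xs then if length xs \<le> j \<and> j \<le> n
       then Poly_Mapping.lookup m (j - length xs) * word_weight lam (j - length xs) xs else 0 else 0)"
    unfolding word_act_def lookup_sum lookup_pscale lookup_std_vec by (intro sum.cong) auto
  then show ?thesis by auto
qed

lemma word_act_add: "word_act n lam xs (m + m') = word_act n lam xs m + word_act n lam xs m'"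
  by (rule poly_mapping_eqI) (simp add: lookup_word_act lookup_add distrib_right)

lemma word_act_pscale: "word_act n lam xs (pscale c m) = pscale c (word_act n lam xs m)"
  by (rule poly_mapping_eqI) (simp add: lookup_word_act)

lemma word_act_append: "word_act n lam (xs @ ys) m = word_act n lam xs (word_act n lam ys m)"
proof (rule poly_mapping_eqI)
  fix j
  show "Poly_Mapping.lookup (word_act n lam (xs @ ys) m) j =
      Poly_Mapping.lookup (word_act n lam xs (word_act n lam ys m)) j"
  proof (cases "length xs + length ys \<le> j")
    case True
    then have "j - (length xs + length ys) + length ys = j - length xs" "length ys \<le> j - length xs"
      by simp_all
    then show ?thesis
      using True by (cases "j \<le> n") (simp_all add: lookup_word_act word_weight_append)
  next
    case False
    then have "length xs \<le> j \<Longrightarrow> \<not> length ys \<le> j - length xs" by linarith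
    then show ?thesis
      using False by (auto simp: lookup_word_act)
  qed
qed

definition tensor_act :: "nat \<Rightarrow> (nat \<Rightarrow> 'x \<Rightarrow> 'k::field) \<Rightarrow> ('x, 'k) tensor \<Rightarrow> (nat \<Rightarrow>\<^sub>0 'k) \<Rightarrow> (nat \<Rightarrow>\<^sub>0 'k)"
  where "tensor_act n lam f m = word_sum pscale (\<lambda>xs. word_act n lam xs m) f"

lemma lookup_word_sum: "Poly_Mapping.lookup (word_sum pscale \<phi> f) j = pairing (\<lambda>xs. Poly_Mapping.lookup (\<phi> xs) j) f"
  by (simp add: word_sum_def lookup_sum)

lemma tensor_act_add: "tensor_act n lam (f + g) m = tensor_act n lam f m + tensor_act n lam g m"
  and tensor_act_diff: "tensor_act n lam (f - g) m = tensor_act n lam f m - tensor_act n lam g m"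
  and tensor_act_pscale: "tensor_act n lam (pscale c f) m = pscale c (tensor_act n lam f m)"
  and tensor_act_basis: "tensor_act n lam (basis xs) m = word_act n lam xs m"
  and tensor_act_0: "tensor_act n lam 0 m = 0"
  by (simp_all add: tensor_act_def pscale.word_sum_add pscale.word_sum_diff pscale.word_sum_pscale)

lemma tensor_act_add_right: "tensor_act n lam f (m + m') = tensor_act n lam f m + tensor_act n lam f m'"
  by (simp add: tensor_act_def word_act_add pscale.word_sum_add_fun)

lemma tensor_act_mult: "tensor_act n lam (f * g) m = tensor_act n lam f (tensor_act n lam g m)"
proof (induction f rule: tensor_induct)
  case (basis c xs)
  have "tensor_act n lam (basis xs * g) m = word_act n lam xs (tensor_act n lam g m)"
  proof (induction g rule: tensor_induct)
    case zero
    show ?case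
      using word_act_pscale[of n lam xs 0 0] by (simp add: tensor_act_0)
  qed (simp_all add: pscale_mult_right basis_mult tensor_act_pscale tensor_act_basis word_act_append
      word_act_pscale distrib_left tensor_act_add word_act_add)
  then show ?case
    by (simp add: pscale_mult_left tensor_act_pscale tensor_act_basis)
qed (simp_all add: distrib_right tensor_act_add tensor_act_0)

lemma pairing_const_mult: "pairing (\<lambda>xs. c * F xs) f = c * pairing F f"
  by (simp add: word_sum_def sum_distrib_left mult.left_commute)

lemma sum_fun_apply: "(\<Sum>i\<in>A. h i) x = (\<Sum>i\<in>A. h i x)"
  for h :: "'i \<Rightarrow> 'b \<Rightarrow> 'c::comm_monoid_add"
  by (induction A rule: infinite_finite_induct) simp_all

text \<open>The coefficient in degree \<open>j\<close> is a sum over \<open>k\<close>: the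
  coordinate of \<open>m\<close> in degree \<open>j - k\<close> times the pairing of the part of
  \<open>f\<close> of degree \<open>k\<close> with the word weights starting at
  \<open>j - k\<close>. For a point path each of these pairings is 0.\<close>

lemma tensor_act_nichols_ideal:
  assumes "is_point_path r q n lam" "f \<in> nichols_ideal r q"
  shows "tensor_act n lam f m = 0"
proof (rule poly_mapping_eqI)
  fix j
  let ?w = "\<lambda>k xs. word_weight lam (j - k) xs"
  show "Poly_Mapping.lookup (tensor_act n lam f m) j = Poly_Mapping.lookup 0 j"
  proof (cases "j \<le> n")
    case True
    have "Poly_Mapping.lookup (tensor_act n lam f m) j =
        pairing (\<Sum>k\<le>j. (\<lambda>xs. if length xs = k then Poly_Mapping.lookup m (j - k) * ?w k xs else 0)) f"
      unfolding tensor_act_def lookup_word_sum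
    proof (rule word_sum_cong)
      fix w
      have "(\<Sum>k\<le>j. (\<lambda>xs. if length xs = k then Poly_Mapping.lookup m (j - k) * ?w k xs else 0)) xs =
          (\<Sum>k\<le>j. if length xs = k then Poly_Mapping.lookup m (j - k) * ?w k xs else 0)" for xs :: "'a list"
        by (rule sum_fun_apply)
      then show "Poly_Mapping.lookup (word_act n lam (letters w) m) j =
        (\<Sum>k\<le>j. (\<lambda>xs. if length xs = k then Poly_Mapping.lookup m (j - k) * ?w k xs else 0)) (letters w)"
        using True by (simp add: lookup_word_act)
    qed
    also have "\<dots> = (\<Sum>k\<le>j. Poly_Mapping.lookup m (j - k) * pairing (?w k) (homogeneous_part k f))"
      by (simp only: pairing_sum_fun pairing_homogeneous_part flip: pairing_const_mult)
        (simp add: if_distrib cong: if_cong)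
    also have "\<dots> = 0"
    proof (intro sum.neutral ballI)
      fix k assume "k \<in> {..j}"
      then have "j - k + k \<le> n" using True by simp
      moreover have "homogeneous_part k f \<in> qsym_kernel r q k"
        using assms(2) by (simp add: nichols_ideal_iff)
      ultimately have "pairing (?w k) (homogeneous_part k f) = 0"
        using assms(1) unfolding is_point_path_def by blast
      then show "Poly_Mapping.lookup m (j - k) * pairing (?w k) (homogeneous_part k f) = 0"
        by simp
    qed
    finally show ?thesis by simp
  qed (simp add: tensor_act_def lookup_word_sum lookup_word_act pairing_zero_fun)
qed

text \<open>A coset acts through an arbitrary representative.\<close>

definition point_module :: "nat \<Rightarrow> (nat \<Rightarrow> 'x \<Rightarrow> 'k::field) \<Rightarrow>
    (('x, 'k) tensor set, nat \<Rightarrow>\<^sub>0 'k) graded_module" where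
  "point_module n lam =
     \<lparr>mcomp = \<lambda>j. pscale.span {std_vec n j}, act = \<lambda>C m. tensor_act n lam (SOME f. f \<in> C) m\<rparr>"

lemma act_point_module:
  assumes "is_point_path r q n lam"
  shows "act (point_module n lam) (nichols_class r q f) m = tensor_act n lam f m"
proof -
  let ?g = "SOME g. g \<in> nichols_class r q f"
  have "?g \<in> nichols_class r q f"
    using nichols_class_self by (rule someI)
  then have "tensor_act n lam (?g - f) m = 0"
    by (intro tensor_act_nichols_ideal[OF assms]) (simp add: nichols_class_eq)
  then show ?thesis
    by (simp add: point_module_def tensor_act_diff)
qed

lemma mcomp_point_module:
  "mcomp (point_module n lam) j = (if j \<le> n then {m. \<forall>i. i \<noteq> j \<longrightarrow> Poly_Mapping.lookup m i = 0} else {0})"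
  for lam :: "nat \<Rightarrow> 'x \<Rightarrow> 'k::field"
proof -
  have "m \<in> range (\<lambda>k. pscale k (Poly_Mapping.single j 1))" if "\<forall>i. i \<noteq> j \<longrightarrow> Poly_Mapping.lookup m i = 0"
    for m :: "nat \<Rightarrow>\<^sub>0 'k"
  proof (rule range_eqI)
    show "m = pscale (Poly_Mapping.lookup m j) (Poly_Mapping.single j 1)"
      using that by (intro poly_mapping_eqI) (auto simp: lookup_single when_def)
  qed
  then show ?thesis
    by (auto simp: point_module_def pscale.span_singleton std_vec_def lookup_single when_def)
qed

lemma mspace_point_module:
  "mspace pscale (point_module n lam) = {m. \<forall>i>n. Poly_Mapping.lookup m i = 0}"
  for lam :: "nat \<Rightarrow> 'x \<Rightarrow> 'k::field"
proof
  have "pscale.subspace {m :: nat \<Rightarrow>\<^sub>0 'k. \<forall>i>n. Poly_Mapping.lookup m i = 0}"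
    by (auto simp: pscale.subspace_def lookup_add)
  moreover have "mcomp (point_module n lam) j \<subseteq> {m. \<forall>i>n. Poly_Mapping.lookup m i = 0}" for j
    by (cases "j \<le> n") (auto simp: mcomp_point_module)
  ultimately show "mspace pscale (point_module n lam) \<subseteq> {m. \<forall>i>n. Poly_Mapping.lookup m i = 0}"
    unfolding mspace_def by (intro pscale.span_minimal) blast
  show "{m. \<forall>i>n. Poly_Mapping.lookup m i = 0} \<subseteq> mspace pscale (point_module n lam)"
  proof
    fix m :: "nat \<Rightarrow>\<^sub>0 'k" assume m: "m \<in> {m. \<forall>i>n. Poly_Mapping.lookup m i = 0}"
    have "m = (\<Sum>i\<le>n. pscale (Poly_Mapping.lookup m i) (std_vec n i))"
    proof (rule poly_mapping_eqI)
      fix j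
      have "Poly_Mapping.lookup (\<Sum>i\<le>n. pscale (Poly_Mapping.lookup m i) (std_vec n i)) j =
          (\<Sum>i\<le>n. if i = j then Poly_Mapping.lookup m j else 0)"
        unfolding lookup_sum lookup_pscale lookup_std_vec by (intro sum.cong) auto
      then show "Poly_Mapping.lookup m j = Poly_Mapping.lookup (\<Sum>i\<le>n. pscale (Poly_Mapping.lookup m i) (std_vec n i)) j"
        using m by simp
    qed
    moreover have "std_vec n i \<in> mcomp (point_module n lam) i" for i
      by (simp add: point_module_def pscale.span_base)
    then have "(\<Sum>i\<le>n. pscale (Poly_Mapping.lookup m i) (std_vec n i)) \<in> mspace pscale (point_module n lam)"
      unfolding mspace_def
      by (intro pscale.subspace_sum pscale.subspace_scale pscale.subspace_span) (blast intro: pscale.span_base)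
    ultimately show "m \<in> mspace pscale (point_module n lam)"
      by metis
  qed
qed

lemma lookup_tensor_act_above: "n < i \<Longrightarrow> Poly_Mapping.lookup (tensor_act n lam f m) i = 0"
  by (simp add: tensor_act_def lookup_word_sum lookup_word_act pairing_zero_fun)

lemma word_act_std_vec: "word_act n lam xs (std_vec n j) = pscale (word_weight lam j xs) (std_vec n (j + length xs))"
  by (rule poly_mapping_eqI) (auto simp: lookup_word_act lookup_std_vec)

lemma truncated_point_module_point_module:
  fixes r :: "'x \<Rightarrow> 'x \<Rightarrow> 'x" and q :: "'x \<Rightarrow> 'x \<Rightarrow> 'k::field"
  assumes "is_rack r" "is_2cocycle r q" "is_point_path r q n lam"
  shows "truncated_point_module pscale (nichols_algebra r q) n (point_module n lam)"
  unfolding truncated_point_module_def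
proof (intro conjI)
  let ?M = "point_module n lam"
  have sub: "pscale.subspace (mcomp ?M j)" for j
    by (simp add: point_module_def)
  show graded: "graded_left_module pscale (nichols_algebra r q) ?M"
    unfolding graded_left_module_nichols[OF assms(1,2)] act_point_module[OF assms(3)]
  proof (intro conjI allI ballI impI)
    fix I v j assume *: "finite I \<and> (\<forall>j\<in>I. v j \<in> mcomp ?M j) \<and> (\<Sum>j\<in>I. v j) = 0" and j: "j \<in> I"
    show "v j = 0"
    proof (rule poly_mapping_eqI)
      fix i
      have 0: "Poly_Mapping.lookup (v l) i = 0" if "l \<in> I" "l \<noteq> i" for l
        using * that by (auto simp: mcomp_point_module split: if_splits)
      show "Poly_Mapping.lookup (v j) i = Poly_Mapping.lookup 0 i"
      proof (cases "i = j")
        case True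
        have "Poly_Mapping.lookup (\<Sum>l\<in>I. v l) i = (\<Sum>l\<in>I. if l = i then Poly_Mapping.lookup (v l) i else 0)"
          unfolding lookup_sum using 0 by (intro sum.cong) auto
        then show ?thesis using * True j by simp
      qed (use 0 j in auto)
    qed
  next
    fix i j and f :: "('x, 'k) tensor" and m assume f: "f \<in> tensor_power i" and m: "m \<in> mcomp ?M j"
    obtain c where "m = pscale c (std_vec n j)"
      using m by (auto simp: point_module_def pscale.span_singleton)
    then have "tensor_act n lam f m = word_sum pscale (\<lambda>xs. pscale (c * word_weight lam j xs) (std_vec n (i + j))) f"
      unfolding tensor_act_def using f
      by (intro word_sum_cong) (auto simp: tensor_power_def word_act_pscale word_act_std_vec add.commute)
    then show "tensor_act n lam f m \<in> mcomp ?M (i + j)"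
      using sub by (simp add: word_sum_def point_module_def pscale.subspace_sum pscale.subspace_scale pscale.span_base)
  next
    fix m assume "m \<in> mspace pscale ?M"
    then show "tensor_act n lam 1 m = m"
      unfolding mspace_point_module basis_Nil[symmetric] tensor_act_basis
      by (intro poly_mapping_eqI) (auto simp: lookup_word_act)
  qed (auto simp: sub mspace_point_module tensor_act_add tensor_act_pscale tensor_act_add_right
      tensor_act_mult lookup_tensor_act_above)
  let ?G = "{act ?M a m |a m. a \<in> carrier (nichols_algebra r q) \<and> m \<in> mcomp ?M 0}"
  show "generated_in_degree_0 pscale (nichols_algebra r q) ?M"
    unfolding generated_in_degree_0_def
  proof
    have "std_vec n j \<in> pscale.span ?G" if "j \<le> n" for j
    proof -
      \<comment> \<open>As no \<open>lam j\<close> vanishes, a word of non-zero weight is built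
        letter by letter. It carries \<open>std_vec n 0\<close> to a non-zero multiple of
        \<open>std_vec n j\<close>.\<close>
      have "\<exists>xs. length xs = j \<and> word_weight lam 0 xs \<noteq> 0"
        using that
      proof (induction j)
        case (Suc j)
        then obtain xs where "length xs = j" "word_weight lam 0 xs \<noteq> 0" by auto
        moreover obtain x where "lam j x \<noteq> 0"
          using assms(3) Suc.prems by (auto simp: is_point_path_def fun_eq_iff Suc_le_eq)
        ultimately show ?case
          by (intro exI[of _ "x # xs"]) simp
      qed simp
      then obtain xs where xs: "length xs = j" "word_weight lam 0 xs \<noteq> 0" by blast
      have "act ?M (nichols_class r q (basis xs)) (std_vec n 0) \<in> ?G"
        using pscale.span_base[of "std_vec n 0" "{std_vec n 0}"]
        by (intro CollectI exI[of _ "nichols_class r q (basis xs)"] exI[of _ "std_vec n 0"])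
          (simp add: nichols_algebra_simps(1)[OF assms(1,2)] point_module_def)
      then have "pscale (word_weight lam 0 xs) (std_vec n j) \<in> pscale.span ?G"
        unfolding act_point_module[OF assms(3)] tensor_act_basis word_act_std_vec
        by (intro pscale.span_base) (simp add: xs)
      then have "pscale (1 / word_weight lam 0 xs) (pscale (word_weight lam 0 xs) (std_vec n j)) \<in> pscale.span ?G"
        by (rule pscale.span_scale)
      then show ?thesis using xs by simp
    qed
    then have "std_vec n j \<in> pscale.span ?G" for j
      by (cases "j \<le> n") (simp_all add: std_vec_def pscale.span_zero)
    then have "mcomp ?M j \<subseteq> pscale.span ?G" for j
      by (simp add: point_module_def pscale.span_minimal)
    then show "mspace pscale ?M \<subseteq> pscale.span ?G"
      unfolding mspace_def by (intro pscale.span_minimal) auto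
    have "pscale.subspace (mspace pscale ?M)"
      by (simp add: mspace_def)
    moreover have "?G \<subseteq> mspace pscale ?M"
      by (auto simp: nichols_algebra_simps(1)[OF assms(1,2)] act_point_module[OF assms(3)]
          mspace_point_module lookup_tensor_act_above)
    ultimately show "pscale.span ?G \<subseteq> mspace pscale ?M"
      by (intro pscale.span_minimal)
  qed
  show "has_hilbert_series pscale ?M (\<lambda>j. if j \<le> n then 1 else 0)"
    unfolding has_hilbert_series_def
  proof (intro allI conjI)
    fix j
    show "\<exists>E. finite E \<and> mcomp ?M j \<subseteq> pscale.span E"
      by (rule exI[of _ "{std_vec n j}"]) (simp add: point_module_def)
    show "pscale.dim (mcomp ?M j) = (if j \<le> n then 1 else 0)"
    proof (cases "j \<le> n")
      case True
      then have "(std_vec n j :: nat \<Rightarrow>\<^sub>0 'k) \<noteq> 0"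
        by (metis lookup_std_vec lookup_zero zero_neq_one)
      then have "pscale.dim (pscale.span {std_vec n j :: nat \<Rightarrow>\<^sub>0 'k}) = card {std_vec n j :: nat \<Rightarrow>\<^sub>0 'k}"
        by (intro pscale.dim_span_eq_card_independent) simp
      then show ?thesis
        using True by (simp add: point_module_def)
    next
      case False
      have "pscale.dim (pscale.span ({} :: (nat \<Rightarrow>\<^sub>0 'k) set)) = 0"
        by (subst pscale.dim_span_eq_card_independent) (simp_all add: pscale.independent_empty)
      then show ?thesis
        using False by (simp add: point_module_def std_vec_def)
    qed
  qed
qed

lemma point_frame_point_module:
  assumes "is_rack r" "is_2cocycle r q" "is_point_path r q n lam"
  shows "point_frame (nichols_gen r q) n (point_module n lam) (std_vec n) lam"
  unfolding point_frame_def
proof (intro conjI allI impI)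
  fix j assume "j \<le> n"
  then show "std_vec n j \<noteq> (0 :: nat \<Rightarrow>\<^sub>0 'b)"
    by (metis lookup_std_vec lookup_zero zero_neq_one)
  show "mcomp (point_module n lam) j = pscale.span {std_vec n j}"
    by (simp add: point_module_def)
next
  fix j i
  show "act (point_module n lam) (nichols_gen r q i) (std_vec n j) = pscale (lam j i) (std_vec n (Suc j))"
    unfolding nichols_gen_def act_point_module[OF assms(3)] tensor_act_basis word_act_std_vec
    by simp
qed (simp add: std_vec_def)

text \<open>Truncated point modules are isomorphic precisely if they have the same points.\<close>

theorem bij_betw_point_sequence:
  fixes r :: "'x \<Rightarrow> 'x \<Rightarrow> 'x" and q :: "'x \<Rightarrow> 'x \<Rightarrow> 'k::field"
  assumes "is_rack r" "is_2cocycle r q"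
  shows "bij_betw (point_sequence (nichols_gen r q) n) (Gamma (nichols_algebra r q) n)
    {map (\<lambda>j. proj_point (lam j)) [0..<n] |lam. is_point_path r q n lam}"
proof -
  define mods :: "(('x, 'k) tensor set, nat \<Rightarrow>\<^sub>0 'k) graded_module set" where "mods = {M. truncated_point_module pscale (nichols_algebra r q) n M}"
  define pts where "pts M = (THE ps. has_points pscale (nichols_gen r q) n M ps)"
    for M :: "(('x, 'k) tensor set, nat \<Rightarrow>\<^sub>0 'k) graded_module"
  have loc: "nichols_module r q n M" if "M \<in> mods" for M
    using that assms by unfold_locales (simp_all add: mods_def)
  have pts: "has_points pscale (nichols_gen r q) n M ps \<longleftrightarrow> ps = pts M" if "M \<in> mods" for M ps
    using nichols_module.ex1_has_points[OF loc[OF that]] unfolding pts_def by (metis theI')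
  have pts_frame: "pts M = map (\<lambda>j. proj_point (lam j)) [0..<n]"
    if "M \<in> mods" "point_frame (nichols_gen r q) n M e lam" for M e lam
    using pts[OF that(1)] that(2) unfolding has_points_iff_frame by metis
  have iso: "graded_isomorphic pscale (nichols_algebra r q) M N \<longleftrightarrow> pts M = pts N"
    if MN: "M \<in> mods" "N \<in> mods" for M N
  proof -
    obtain e lam where M: "point_frame (nichols_gen r q) n M e lam"
      using nichols_module.frame_exists[OF loc[OF MN(1)]] by blast
    obtain e' lam' where N: "point_frame (nichols_gen r q) n N e' lam'"
      using nichols_module.frame_exists[OF loc[OF MN(2)]] by blast
    show ?thesis
    proof
      assume "graded_isomorphic pscale (nichols_algebra r q) M N"
      then show "pts M = pts N"
        using graded_isomorphic_frame[OF loc[OF MN(1)] loc[OF MN(2)] M] pts_frame[OF MN(2)]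
          pts_frame[OF MN(1) M] by metis
    next
      assume "pts M = pts N"
      then have "proj_point (lam j) = proj_point (lam' j)" if "j < n" for j
        using that by (simp add: pts_frame[OF MN(1) M] pts_frame[OF MN(2) N])
      then obtain e'' where "point_frame (nichols_gen r q) n N e'' lam"
        using nichols_module.frame_rescale[OF loc[OF MN(2)] N] by metis
      then show "graded_isomorphic pscale (nichols_algebra r q) M N"
        using graded_isomorphic_same_frame[OF loc[OF MN(1)] loc[OF MN(2)] M] by blast
    qed
  qed
  define R where "R = {(M, N). M \<in> mods \<and> N \<in> mods \<and> graded_isomorphic pscale (nichols_algebra r q) M N}"
  have Gamma: "Gamma (nichols_algebra r q) n = mods // R"
    by (simp add: Gamma_def mods_def R_def)
  \<comment> \<open>By \<open>iso\<close> an isomorphism class is a fibre of \<open>pts\<close>, so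
    the description in \<open>point_sequence\<close> has one value, whichever module of the class is
    used.\<close>
  have cls: "R `` {M} = {N \<in> mods. pts N = pts M}" if "M \<in> mods" for M
    using that iso by (auto simp: R_def)
  have seq: "point_sequence (nichols_gen r q) n (R `` {M}) = pts M" if "M \<in> mods" for M
    unfolding point_sequence_def cls[OF that]
  proof (rule the_equality)
    show "\<exists>N\<in>{N \<in> mods. pts N = pts M}. has_points pscale (nichols_gen r q) n N (pts M)"
      using that pts by auto
  qed (use pts in auto)
  have "bij_betw (point_sequence (nichols_gen r q) n) (mods // R) (pts ` mods)"
    unfolding bij_betw_def
  proof
    show "inj_on (point_sequence (nichols_gen r q) n) (mods // R)"
    proof (rule inj_onI)
      fix C D assume CD: "C \<in> mods // R" "D \<in> mods // R"
        and eq: "point_sequence (nichols_gen r q) n C = point_sequence (nichols_gen r q) n D"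
      obtain M where M: "M \<in> mods" "C = R `` {M}"
        using CD(1) by (rule quotientE)
      obtain N where N: "N \<in> mods" "D = R `` {N}"
        using CD(2) by (rule quotientE)
      have "pts M = pts N"
        using eq seq[OF M(1)] seq[OF N(1)] M(2) N(2) by simp
      then show "C = D"
        unfolding M(2) N(2) cls[OF M(1)] cls[OF N(1)] by simp
    qed
    show "point_sequence (nichols_gen r q) n ` (mods // R) = pts ` mods"
    proof -
      have "mods // R = (\<lambda>M. R `` {M}) ` mods"
        by (auto simp: quotient_def)
      then show ?thesis
        by (simp add: image_image seq cong: image_cong_simp)
    qed
  qed
  moreover have "pts ` mods = {map (\<lambda>j. proj_point (lam j)) [0..<n] |lam. is_point_path r q n lam}"
  proof (intro equalityI subsetI)
    fix ps assume "ps \<in> pts ` mods"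
    then obtain M where M: "M \<in> mods" "ps = pts M" by blast
    obtain e lam where "point_frame (nichols_gen r q) n M e lam"
      using nichols_module.frame_exists[OF loc[OF M(1)]] by blast
    then show "ps \<in> {map (\<lambda>j. proj_point (lam j)) [0..<n] |lam. is_point_path r q n lam}"
      using M pts_frame nichols_module.frame_point_path[OF loc[OF M(1)]] by blast
  next
    fix ps assume "ps \<in> {map (\<lambda>j. proj_point (lam j)) [0..<n] |lam. is_point_path r q n lam}"
    then obtain lam where lam: "is_point_path r q n lam" "ps = map (\<lambda>j. proj_point (lam j)) [0..<n]"
      by blast
    have "point_module n lam \<in> mods"
      using truncated_point_module_point_module[OF assms lam(1)] by (simp add: mods_def)
    then show "ps \<in> pts ` mods"
      using pts_frame[OF _ point_frame_point_module[OF assms lam(1)]] lam(2) by (auto intro!: rev_image_eqI)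
  qed
  ultimately show ?thesis
    by (simp add: Gamma)
qed

section \<open>Functionals vanishing on the kernels\<close>

text \<open>The row space of the matrix of the symmetrizer, that is the image of its transpose.
  Functionals are compared on words of length \<open>n\<close>, the only ones occurring in tensors
  of degree \<open>n\<close>.\<close>

definition is_row :: "('x \<Rightarrow> 'x \<Rightarrow> 'x) \<Rightarrow> ('x \<Rightarrow> 'x \<Rightarrow> 'k::field) \<Rightarrow> nat \<Rightarrow> ('x list \<Rightarrow> 'k) \<Rightarrow> bool" where
  "is_row r q n F \<longleftrightarrow> (\<exists>G. \<forall>xs. length xs = n \<longrightarrow> F xs = qsym_dual r q n G xs)"

lemma is_row_cong:
  "is_row r q n F \<Longrightarrow> (\<And>xs. length xs = n \<Longrightarrow> F' xs = F xs) \<Longrightarrow> is_row r q n F'"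
  by (simp add: is_row_def)

lemma pairing_is_row:
  assumes "is_row r q n F" "f \<in> qsym_kernel r q n"
  shows "pairing F f = 0"
proof -
  obtain G where "\<And>xs. length xs = n \<Longrightarrow> F xs = qsym_dual r q n G xs"
    using assms(1) by (auto simp: is_row_def)
  then have "pairing F f = pairing (qsym_dual r q n G) f"
    using assms(2) by (intro word_sum_cong) (auto simp: qsym_kernel_def tensor_power_def)
  then show ?thesis
    using assms(2) by (simp add: qsym_kernel_def)
qed

lemma is_row_0: "is_row r q 0 F" and is_row_1: "is_row r q (Suc 0) F"
  by (auto simp: is_row_def)

text \<open>One step of the recursion for \<open>symmetrizer\<close>: a preimage \<open>G\<close>
  under the shuffle sum suffices if its restrictions to each first letter are rows of degree
  \<open>n\<close>. Certificates thus need to be found for one shuffle sum only.\<close>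

lemma is_row_SucI:
  assumes "\<And>x. is_row r q n (\<lambda>ys. G (x # ys))"
    and "\<And>xs. length xs = Suc n \<Longrightarrow> F xs = shuffle_sum (braid_dual r q) n 0 G xs"
  shows "is_row r q (Suc n) F"
proof -
  obtain H where H: "\<And>x ys. length ys = n \<Longrightarrow> G (x # ys) = qsym_dual r q n (H x) ys"
    using assms(1) unfolding is_row_def by metis
  define H' where "H' xs = (case xs of [] \<Rightarrow> 0 | x # ys \<Rightarrow> H x ys)" for xs
  have "F xs = qsym_dual r q (Suc n) H' xs" if "length xs = Suc n" for xs
  proof -
    have "G zs = symmetrizer (braid_dual r q) n (Suc 0) H' zs" if "length zs = Suc n" for zs
    proof (cases zs)
      case (Cons x ys)
      then have "symmetrizer (braid_dual r q) n (Suc 0) H' zs = qsym_dual r q n (\<lambda>ys. H' (x # ys)) ys"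
        using symmetrizer_dual_Cons[of r q n 0 H' x] by (simp add: fun_eq_iff)
      then show ?thesis
        using Cons that H by (simp add: H'_def)
    qed (use that in simp)
    then show ?thesis
      unfolding assms(2)[OF that] symmetrizer.simps using that by (intro shuffle_sum_dual_cong) simp
  qed
  then show ?thesis
    unfolding is_row_def by blast
qed

text \<open>Relabelling the letters by a map compatible with rack and cocycle commutes with the
  braiding, and so does multiplication by a weight that crossings do not change. Hence the twist
  commutes with the symmetrizer.\<close>

lemma is_row_twist:
  assumes g: "\<And>x y. g (r x y) = r (g x) (g y)" "\<And>x y. q (g x) (g y) = q x y"
    and w: "\<And>us x y vs. w (us @ r x y # x # vs) = w (us @ x # y # vs)"
    and row: "is_row r q n F"
  shows "is_row r q n (\<lambda>xs. w xs * F (map g xs))"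
proof -
  let ?t = "\<lambda>F xs. w xs * F (map g xs)"
  have braid: "braid_dual r q (Suc i) (?t F) = ?t (braid_dual r q (Suc i) F)" for F i
  proof
    fix xs
    show "braid_dual r q (Suc i) (?t F) xs = ?t (braid_dual r q (Suc i) F) xs"
    proof (cases "Suc i < length xs")
      case True
      obtain us x y vs where "xs = us @ x # y # vs" "length us = i"
        by (rule list_split_at[OF True])
      then show ?thesis
        using braid_dual_append[of r q us "?t F" x y vs]
          braid_dual_append[of r q "map g us" F "g x" "g y" "map g vs"]
        by (simp add: g w)
    qed (simp add: braid_dual_def)
  qed
  have shuffle: "shuffle_sum (braid_dual r q) m k (?t F) = ?t (shuffle_sum (braid_dual r q) m k F)" for m k F
  proof (induction m arbitrary: k F)
    case (Suc m)
    show ?case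
      unfolding shuffle_sum.simps braid Suc.IH by (simp add: fun_eq_iff distrib_left)
  qed simp
  have sym: "symmetrizer (braid_dual r q) m k (?t F) = ?t (symmetrizer (braid_dual r q) m k F)" for m k F
    by (induction m arbitrary: k) (simp_all only: symmetrizer.simps shuffle)
  obtain G where "\<And>xs. length xs = n \<Longrightarrow> F xs = qsym_dual r q n G xs"
    using row by (auto simp: is_row_def)
  then have "?t F xs = qsym_dual r q n (?t G) xs" if "length xs = n" for xs
    unfolding sym using that by simp
  then show ?thesis
    unfolding is_row_def by blast
qed

lemma is_row_scale: "is_row r q n F \<Longrightarrow> is_row r q n (\<lambda>xs. c * F xs)"
  using is_row_twist[of "\<lambda>x. x" r q "\<lambda>_. c" n F] by simp

lemma length_3_iff: "length xs = 3 \<longleftrightarrow> (\<exists>a b c. xs = [a, b, c])"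
  by (auto simp: numeral_3_eq_3 length_Suc_conv)

lemma length_4_iff: "length xs = 4 \<longleftrightarrow> (\<exists>a b c d. xs = [a, b, c, d])"
  by (auto simp: numeral_eq_Suc length_Suc_conv)

context
  fixes r :: "'x \<Rightarrow> 'x \<Rightarrow> 'x" and z :: "'k::field"
begin

abbreviation "const_dual \<equiv> braid_dual r (\<lambda>_ _. z)"

lemma const_dual_simps:
  "const_dual (Suc 0) F (a # b # ws) = z * F (r a b # a # ws)"
  "const_dual (Suc (Suc 0)) F (a # b # c # ws) = z * F (a # r b c # b # ws)"
  "const_dual (Suc (Suc (Suc 0))) F (a # b # c # d # ws) = z * F (a # b # r c d # c # ws)"
  by (simp_all add: braid_dual_def)

lemma shuffle_sum_2:
  "shuffle_sum const_dual (Suc 0) 0 F [a, b] = F [a, b] + z * F [r a b, a]"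
  by (simp add: const_dual_simps)

lemma shuffle_sum_3:
  "shuffle_sum const_dual (Suc (Suc 0)) 0 F [a, b, c] =
    F [a, b, c] + z * F [r a b, a, c] + z\<^sup>2 * F [r a (r b c), a, b]"
  by (simp add: const_dual_simps power2_eq_square)

lemma shuffle_sum_4:
  "shuffle_sum const_dual (Suc (Suc (Suc 0))) 0 F [a, b, c, d] =
    F [a, b, c, d] + z * F [r a b, a, c, d] + z\<^sup>2 * F [r a (r b c), a, b, d]
      + z ^ 3 * F [r a (r b (r c d)), a, b, c]"
  by (simp add: const_dual_simps power2_eq_square power3_eq_cube)

end

section \<open>The rack \<open>Aff(3,-1)\<close>\<close>

lemma three_cases: "x = 0 \<or> x = 1 \<or> x = 2" for x :: 3
proof (cases x)
  case (of_int k)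
  then have "k = 0 \<or> k = 1 \<or> k = 2" by auto
  then show ?thesis using of_int by auto
qed

lemma all_three: "(\<forall>x. P x) \<longleftrightarrow> P 0 \<and> P 1 \<and> P 2" for P :: "3 \<Rightarrow> bool"
  using three_cases by metis

lemma UNIV_three: "(UNIV :: 3 set) = {0, 1, 2}"
  using three_cases by blast

lemma sum_three: "(\<Sum>x\<in>UNIV. h x) = h 0 + h 1 + h 2" for h :: "3 \<Rightarrow> 'a::comm_monoid_add"
  unfolding UNIV_three by (simp add: add.assoc)

lemma three_arith: "- 1 = (2 :: 3)" "- 2 = (1 :: 3)" "3 = (0 :: 3)" "4 = (1 :: 3)"
  by simp_all

lemma aff3_simps:
  "aff3 x x = x"
  "aff3 0 1 = 2" "aff3 0 2 = 1" "aff3 1 0 = 2" "aff3 1 2 = 0" "aff3 2 0 = 1" "aff3 2 1 = 0"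
  by (simp_all add: aff3_def)

lemma aff3_inverse: "aff3 (aff3 a b) a = b"
  using three_cases[of a] three_cases[of b] by (auto simp: aff3_simps)

definition vec3 :: "'a \<Rightarrow> 'a \<Rightarrow> 'a \<Rightarrow> 3 \<Rightarrow> 'a" where
  "vec3 x y w i = (if i = 0 then x else if i = 1 then y else w)"

lemma vec3_simps [simp]: "vec3 x y w 0 = x" "vec3 x y w 1 = y" "vec3 x y w 2 = w"
  by (simp_all add: vec3_def)

locale zeta3 =
  fixes z :: "'k::field_char_0"
  assumes z_minimal: "z\<^sup>2 + z + 1 = 0"
begin

abbreviation "row \<equiv> is_row aff3 (\<lambda>_ _. z)"
abbreviation "ker \<equiv> qsym_kernel aff3 (\<lambda>_ _. z)"
abbreviation "dual \<equiv> braid_dual aff3 (\<lambda>_ _. z)"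

lemma z2: "z\<^sup>2 = - 1 - z"
  using z_minimal by (simp add: eq_neg_iff_add_eq_0 algebra_simps)

lemma zz: "z * z = - 1 - z"
  using z2 by (simp add: power2_eq_square)

lemma zzx: "z * (z * x) = - x - z * x"
  by (simp add: zz left_diff_distrib flip: mult.assoc)

lemma z3: "z ^ 3 = 1"
  by (simp add: power3_eq_cube zz left_diff_distrib)

lemma z_nonzero: "z \<noteq> 0"
  using z3 by auto

text \<open>Let \<open>c\<close> be the crossing on functionals of degree 2. Its cube is the
  identity, since the map \<open>(a, b) -> (aff3 a b, a)\<close> has this property and
  \<open>z ^ 3 = 1\<close>. So \<open>(1 + c) (1 - c + c^2) = 2\<close>, and the witness is
  \<open>1 - c + c^2\<close> applied to \<open>F\<close>, divided by 2.\<close>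

lemma row_2: "row (Suc (Suc 0)) F"
proof (rule is_row_SucI)
  let ?G = "\<lambda>xs. (F xs - z * F [aff3 (xs ! 0) (xs ! 1), xs ! 0] + z\<^sup>2 * F [xs ! 1, aff3 (xs ! 0) (xs ! 1)]) / 2"
  show "row (Suc 0) (\<lambda>ys. ?G (x # ys))" for x
    by (rule is_row_1)
  fix xs :: "3 list" assume "length xs = Suc (Suc 0)"
  then obtain a b where xs: "xs = [a, b]"
    by (auto simp: length_Suc_conv)
  show "F xs = shuffle_sum dual (Suc 0) 0 ?G xs"
    unfolding xs shuffle_sum_2 by (simp add: aff3_inverse field_simps z2 zz zzx)
qed

text \<open>Braiding preserves the alternating sum \<open>a - b + c\<close>. The words of length 3
  therefore split into blocks indexed by this sum \<open>s\<close>, with coordinates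
  \<open>i = a - s\<close> and \<open>j = b - s\<close> in each block.\<close>

lemma shift_words_3:
  "aff3 (s + i) (s + j) = s + (2 * i - j)" "aff3 (s + i) (aff3 (s + j) (s + j - i)) = s + (i - j)"
  for s i j :: 3
  by (simp_all add: aff3_def algebra_simps)

lemma row_3:
  assumes cube: "\<And>s. F [s, s, s] = 0"
    and conv: "\<And>s. (\<Sum>i\<in>UNIV. \<Sum>j\<in>UNIV. F [s + i, s + j, s + j - i]) = 0"
  shows "row (Suc (Suc (Suc 0))) F"
proof (rule is_row_SucI)
  \<comment> \<open>\<open>T P\<close> solves the nine linear equations of one block, with
    right-hand side twice \<open>P\<close>. Solutions are unique up to a two-dimensional kernel; the
    one taken has zero entries at \<open>(0, 0)\<close> and \<open>(0, 1)\<close>.\<close>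
  define H where "H P = (z - 1) * (P 0 1 + P 2 0 + P 2 2) + z * P 1 2 - P 2 1" for P :: "3 \<Rightarrow> 3 \<Rightarrow> 'k"
  define T where "T P = vec3 (vec3 0 0 (H P))
      (vec3 (H P - 2 * P 0 2) (- 2 * z * P 1 1) ((1 + z) * P 1 2 + z * P 2 1 - (P 0 1 + P 2 0 + P 2 2)))
      (vec3 (- 2 * P 0 1) (z * (P 0 1 + P 2 0 + P 2 2) + (1 + 2 * z) * P 1 2 + (1 + z) * P 2 1)
        (H P - 2 * z * P 2 2))" for P
  have T: "2 * P i j = T P i j + z * T P (2 * i - j) i + z\<^sup>2 * T P (i - j) i"
    if "P 0 0 = 0" "(\<Sum>i\<in>UNIV. \<Sum>j\<in>UNIV. P i j) = 0" for P i j
  proof -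
    have P10: "P 1 0 = - (P 0 1 + P 0 2 + P 1 1 + P 1 2 + P 2 0 + P 2 1 + P 2 2)"
      using that by (simp add: sum_three eq_neg_iff_add_eq_0 algebra_simps)
    show ?thesis
      using three_cases[of i] three_cases[of j] that(1)
      by (elim disjE) (simp_all add: T_def H_def three_arith P10 z2 zz zzx algebra_simps)
  qed
  let ?P = "\<lambda>s i j. F [s + i, s + j, s + j - i]"
  let ?G = "\<lambda>xs. let s = xs ! 0 - xs ! 1 + xs ! 2 in T (?P s) (xs ! 0 - s) (xs ! 1 - s) / 2"
  show "row (Suc (Suc 0)) (\<lambda>ys. ?G (x # ys))" for x
    by (rule row_2)
  fix xs :: "3 list" assume "length xs = Suc (Suc (Suc 0))"
  then obtain a b c where abc: "xs = [a, b, c]"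
    by (auto simp: length_Suc_conv)
  define s i j where "s = a - b + c" and "i = a - s" and "j = b - s"
  then have "a = s + i" "b = s + j" "c = s + j - i"
    by simp_all
  with abc have xs: "xs = [s + i, s + j, s + j - i]" by simp
  have s: "s + i - (s + j) + (s + j - i) = s" "s + (2 * i - j) - (s + i) + (s + j - i) = s"
      "s + (i - j) - (s + i) + (s + j) = s"
    by (simp_all add: algebra_simps)
  have "2 * ?P s i j = T (?P s) i j + z * T (?P s) (2 * i - j) i + z\<^sup>2 * T (?P s) (i - j) i"
    using cube[of s] conv[of s] by (intro T) simp_all
  then show "F xs = shuffle_sum dual (Suc (Suc 0)) 0 ?G xs"
    unfolding xs shuffle_sum_3 shift_words_3
    by (simp add: s Let_def field_simps)
qed

text \<open>All three shuffles fix a word of equal letters, so they contribute the factor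
  \<open>1 + z + z^2\<close>, which is 0.\<close>

lemma cube_in_ker: "basis [s, s, s] \<in> ker 3"
proof -
  have "pairing (qsym_dual aff3 (\<lambda>_ _. z) 3 F) (basis [s, s, s]) = 0" for F
    by (simp add: numeral_3_eq_3 symmetrizer.simps(2)[of _ "Suc (Suc 0)"] shuffle_sum_3 aff3_simps z2
        del: symmetrizer.simps shuffle_sum.simps)
      (simp add: algebra_simps)
  then show ?thesis by (simp add: qsym_kernel_def)
qed

text \<open>Each of the three shuffles permutes the words of a block, so the sum over a block again
  acquires the factor \<open>1 + z + z^2\<close>.\<close>

lemma conv_in_ker: "(\<Sum>i\<in>UNIV. \<Sum>j\<in>UNIV. basis [s + i, s + j, s + j - i]) \<in> ker 3"
proof -
  have "pairing (qsym_dual aff3 (\<lambda>_ _. z) 3 F) (\<Sum>i\<in>UNIV. \<Sum>j\<in>UNIV. basis [s + i, s + j, s + j - i]) = 0" for F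
  proof -
    let ?G = "symmetrizer dual (Suc (Suc 0)) (Suc 0) F"
    define P where "P i j = ?G [s + i, s + j, s + j - i]" for i j
    have P: "?G [s + (2 * i - j), s + i, s + j - i] = P (2 * i - j) i" "?G [s + (i - j), s + i, s + j] = P (i - j) i"
      for i j
      by (simp_all add: P_def algebra_simps)
    have "pairing (qsym_dual aff3 (\<lambda>_ _. z) 3 F) (\<Sum>i\<in>UNIV. \<Sum>j\<in>UNIV. basis [s + i, s + j, s + j - i]) =
        (\<Sum>i\<in>UNIV. \<Sum>j\<in>UNIV. P i j + z * P (2 * i - j) i + z\<^sup>2 * P (i - j) i)"
      unfolding pairing.word_sum_sum pairing.word_sum_basis numeral_3_eq_3
        symmetrizer.simps(2)[of _ "Suc (Suc 0)"] shuffle_sum_3 shift_words_3 P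
      by (simp only: P_def)
    also have "\<dots> = 0"
      by (simp add: sum_three three_arith z2 algebra_simps)
    finally show ?thesis .
  qed
  then show ?thesis by (simp add: qsym_kernel_def tensor_power_sum)
qed


section \<open>Functionals and relations in degree 4\<close>

lemma row_4I:
  assumes cube: "\<And>a s. G a s s s = 0"
    and conv: "\<And>a s. (\<Sum>i\<in>UNIV. \<Sum>j\<in>UNIV. G a (s + i) (s + j) (s + j - i)) = 0"
    and F: "\<And>a b c d. F [a, b, c, d] = G a b c d + z * G (aff3 a b) a c d
      + z\<^sup>2 * G (aff3 a (aff3 b c)) a b d + G (aff3 a (aff3 b (aff3 c d))) a b c"
  shows "row 4 F"
proof -
  let ?G = "\<lambda>xs. G (xs ! 0) (xs ! 1) (xs ! 2) (xs ! 3)"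
  have "row (Suc (Suc (Suc (Suc 0)))) F"
  proof (rule is_row_SucI)
    show "row (Suc (Suc (Suc 0))) (\<lambda>ys. ?G (x # ys))" for x
      by (rule row_3) (simp_all add: cube conv numeral_2_eq_2 numeral_3_eq_3)
    fix xs :: "3 list" assume "length xs = Suc (Suc (Suc (Suc 0)))"
    then obtain a b c d where xs: "xs = [a, b, c, d]"
      by (auto simp: length_Suc_conv)
    show "F xs = shuffle_sum dual (Suc (Suc (Suc 0))) 0 ?G xs"
      unfolding xs shuffle_sum_4 F z3 by (simp add: numeral_2_eq_2 numeral_3_eq_3)
  qed
  then show ?thesis by (simp add: numeral_eq_Suc)
qed

definition prod4 :: "(3 \<Rightarrow> 'k) \<Rightarrow> (3 \<Rightarrow> 'k) \<Rightarrow> (3 \<Rightarrow> 'k) \<Rightarrow> (3 \<Rightarrow> 'k) \<Rightarrow> 3 list \<Rightarrow> 'k" where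
  "prod4 u v w t xs = u (xs ! 0) * v (xs ! 1) * w (xs ! 2) * t (xs ! 3)"

lemma prod4_simps [simp]: "prod4 u v w t [a, b, c, d] = u a * v b * w c * t d"
  by (simp add: prod4_def numeral_2_eq_2 numeral_3_eq_3)

text \<open>The tables \<open>T\<close> below were found by linear algebra over \<open>\<rat>(\<zeta>\<^sub>3)\<close>.\<close>

lemma row_4_base_1: "row 4 (prod4 (vec3 0 1 (- 1)) (vec3 1 0 0) (vec3 1 1 1) (vec3 0 1 (- 1)))" (is "row 4 ?F")
proof -
  define T where "T = vec3
    (vec3 (vec3 (vec3 0 0 0) (vec3 (- 1 - 2 * z) (1 + 2 * z) (- 1 + z)) (vec3 (- 1 - 2 * z) (- 1 + z) 0))
      (vec3 (vec3 0 (4 + 5 * z) (- 1 - 2 * z)) (vec3 (- 1 - 2 * z) 0 0) (vec3 0 (1 + 2 * z) (- 2 - 4 * z)))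
      (vec3 (vec3 0 0 (4 + 5 * z)) (vec3 0 (- 2 - 4 * z) (- 1 + z)) (vec3 (1 - z) 0 0)))
    (vec3 (vec3 (vec3 0 (2 + z) (- 1 + z)) (vec3 0 (1 - z) (- 2 - z)) (vec3 (1 - z) (1 - z) (- 6)))
      (vec3 (vec3 (1 - z) 0 0) (vec3 0 0 0) (vec3 0 0 0))
      (vec3 (vec3 0 (5 + z) (- 4 + z)) (vec3 (1 - z) 0 0) (vec3 0 (1 + 2 * z) 0)))
    (vec3 (vec3 (vec3 0 (- 1 + z) 0) (vec3 0 (- 6) (1 - z)) (vec3 0 0 (1 - z)))
      (vec3 (vec3 0 (- 3) (5 + z)) (vec3 0 0 0) (vec3 (2 - 2 * z) 0 0))
      (vec3 (vec3 (2 + z) 0 0) (vec3 0 (- 1 + z) 0) (vec3 0 0 0)))"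
  \<comment> \<open>The factor 6 clears the denominators of the table.\<close>
  have "row 4 (\<lambda>xs. 6 * ?F xs)"
  proof (rule row_4I)
    have "\<forall>a s. T a s s s = 0"
      unfolding all_three T_def by simp
    then show "T a s s s = 0" for a s by blast
    have "\<forall>a s. (\<Sum>i\<in>UNIV. \<Sum>j\<in>UNIV. T a (s + i) (s + j) (s + j - i)) = 0"
      unfolding all_three sum_three T_def by (simp add: three_arith algebra_simps)
    then show "(\<Sum>i\<in>UNIV. \<Sum>j\<in>UNIV. T a (s + i) (s + j) (s + j - i)) = 0" for a s by blast
    have "\<forall>a b c d. 6 * ?F [a, b, c, d] = T a b c d + z * T (aff3 a b) a c d
      + z\<^sup>2 * T (aff3 a (aff3 b c)) a b d + T (aff3 a (aff3 b (aff3 c d))) a b c"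
      unfolding all_three T_def by (simp add: aff3_simps z2 zz zzx algebra_simps)
    then show "6 * ?F [a, b, c, d] = T a b c d + z * T (aff3 a b) a c d
      + z\<^sup>2 * T (aff3 a (aff3 b c)) a b d + T (aff3 a (aff3 b (aff3 c d))) a b c" for a b c d by blast
  qed
  from is_row_scale[OF this, of "1 / 6"] show ?thesis by simp
qed

lemma row_4_base_2: "row 4 (prod4 (vec3 0 1 (- 1)) (vec3 1 1 1) (vec3 1 0 0) (vec3 0 1 (- 1)))" (is "row 4 ?F")
proof -
  define T where "T = vec3
    (vec3 (vec3 (vec3 0 0 0) (vec3 0 0 0) (vec3 0 0 (2 + z)))
      (vec3 (vec3 (- 2 - z) 0 (1 + 2 * z)) (vec3 (1 - z) 0 0) (vec3 (2 + z) (- 2 - z) 0))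
      (vec3 (vec3 (- 2 - z) (- 1 + z) 0) (vec3 (2 + z) 0 (- 1 - 2 * z)) (vec3 0 0 0)))
    (vec3 (vec3 (vec3 0 0 0) (vec3 (1 + 2 * z) 0 3) (vec3 (2 + z) 0 0))
      (vec3 (vec3 (2 + z) (- 1 - 5 * z) 0) (vec3 (- 6) 0 0) (vec3 (2 + z) 0 0))
      (vec3 (vec3 (- 2 + 2 * z) (4 - z) (- 5 - z)) (vec3 0 0 0) (vec3 (2 + z) (- 2 - z) 0)))
    (vec3 (vec3 (vec3 0 0 (1 - z)) (vec3 (1 - z) 0 0) (vec3 (1 + 2 * z) (2 + z) 0))
      (vec3 (vec3 (- 1 + z) (- 4 + z) (4 - z)) (vec3 (2 + z) 0 0) (vec3 (1 + 2 * z) 0 0))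
      (vec3 (vec3 0 0 (- 1 - 5 * z)) (vec3 0 (- 1 - 2 * z) 0) (vec3 (- 6) (1 + 2 * z) 0)))"
  have "row 4 (\<lambda>xs. 6 * ?F xs)"
  proof (rule row_4I)
    have "\<forall>a s. T a s s s = 0"
      unfolding all_three T_def by simp
    then show "T a s s s = 0" for a s by blast
    have "\<forall>a s. (\<Sum>i\<in>UNIV. \<Sum>j\<in>UNIV. T a (s + i) (s + j) (s + j - i)) = 0"
      unfolding all_three sum_three T_def by (simp add: three_arith algebra_simps)
    then show "(\<Sum>i\<in>UNIV. \<Sum>j\<in>UNIV. T a (s + i) (s + j) (s + j - i)) = 0" for a s by blast
    have "\<forall>a b c d. 6 * ?F [a, b, c, d] = T a b c d + z * T (aff3 a b) a c d
      + z\<^sup>2 * T (aff3 a (aff3 b c)) a b d + T (aff3 a (aff3 b (aff3 c d))) a b c"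
      unfolding all_three T_def by (simp add: aff3_simps z2 zz zzx algebra_simps)
    then show "6 * ?F [a, b, c, d] = T a b c d + z * T (aff3 a b) a c d
      + z\<^sup>2 * T (aff3 a (aff3 b c)) a b d + T (aff3 a (aff3 b (aff3 c d))) a b c" for a b c d by blast
  qed
  from is_row_scale[OF this, of "1 / 6"] show ?thesis by simp
qed

text \<open>The second vector is killed by coordinate 1 and frequency 2, the third one by coordinate
  2 and frequency 2. With the sign change in the second place this is the mixed second pair of
  coordinate 1 and frequency 1.\<close>

lemma row_4_base_3: "row 4 (prod4 (vec3 0 1 (- 1)) (vec3 (- z) 0 1) (vec3 (1 + z) 1 0) (vec3 0 1 (- 1)))" (is "row 4 ?F")
proof -
  define T where "T = vec3
    (vec3 (vec3 (vec3 0 0 0) (vec3 0 0 0) (vec3 0 0 (1 + 5 * z)))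
      (vec3 (vec3 0 3 (4 + 2 * z)) (vec3 (1 - z) 0 (3 * z)) (vec3 0 (2 + 4 * z) 0))
      (vec3 (vec3 0 (- 2 - z) 0) (vec3 (- 1 - 2 * z) (- 3 - 3 * z) (- 2 - 4 * z)) (vec3 (- 4 - 5 * z) (1 + 2 * z) 0)))
    (vec3 (vec3 (vec3 0 0 0) (vec3 0 (- 3 * z) (2 + z)) (vec3 (- 3) (1 + 2 * z) 0))
      (vec3 (vec3 (2 + z) 0 (- 3 - 3 * z)) (vec3 (- 3 + 3 * z) 0 0) (vec3 0 (- 3 - 3 * z) (8 + 4 * z)))
      (vec3 (vec3 0 6 0) (vec3 (- 3 - 6 * z) (- 1 - 2 * z) (3 * z)) (vec3 (3 + 3 * z) (- 6) 0)))
    (vec3 (vec3 (vec3 0 0 (5 + 4 * z)) (vec3 (1 - z) (- 2 + 5 * z) 0) (vec3 0 (- 1 + 4 * z) 0))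
      (vec3 (vec3 0 (- 4 + z) 6) (vec3 0 0 (4 - 4 * z)) (vec3 0 (5 + 7 * z) (- 3 - 3 * z)))
      (vec3 (vec3 (1 - 4 * z) 0 3) (vec3 0 (- 6) (- 2 - 7 * z)) (vec3 (- 7 - 5 * z) (3 * z) 0)))"
  have "row 4 (\<lambda>xs. 6 * ?F xs)"
  proof (rule row_4I)
    have "\<forall>a s. T a s s s = 0"
      unfolding all_three T_def by simp
    then show "T a s s s = 0" for a s by blast
    have "\<forall>a s. (\<Sum>i\<in>UNIV. \<Sum>j\<in>UNIV. T a (s + i) (s + j) (s + j - i)) = 0"
      unfolding all_three sum_three T_def by (simp add: three_arith algebra_simps)
    then show "(\<Sum>i\<in>UNIV. \<Sum>j\<in>UNIV. T a (s + i) (s + j) (s + j - i)) = 0" for a s by blast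
    have "\<forall>a b c d. 6 * ?F [a, b, c, d] = T a b c d + z * T (aff3 a b) a c d
      + z\<^sup>2 * T (aff3 a (aff3 b c)) a b d + T (aff3 a (aff3 b (aff3 c d))) a b c"
      unfolding all_three T_def by (simp add: aff3_simps z2 zz zzx algebra_simps)
    then show "6 * ?F [a, b, c, d] = T a b c d + z * T (aff3 a b) a c d
      + z\<^sup>2 * T (aff3 a (aff3 b c)) a b d + T (aff3 a (aff3 b (aff3 c d))) a b c" for a b c d by blast
  qed
  from is_row_scale[OF this, of "1 / 6"] show ?thesis by simp
qed

text \<open>The reflection \<open>x -> - x\<close> is a rack automorphism that exchanges the two
  mixed cases. It changes the sign of \<open>vec3 0 1 (- 1)\<close>, which cancels because this
  vector occurs twice.\<close>

lemma row_4_base_4: "row 4 (prod4 (vec3 0 1 (- 1)) (vec3 (- z) 1 0) (vec3 (1 + z) 0 1) (vec3 0 1 (- 1)))"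
proof -
  have neg: "vec3 x y w (- a) = vec3 x w y a" for x y w :: 'k and a :: 3
    using three_cases[of a] by (auto simp: three_arith)
  have aff: "- aff3 x y = aff3 (- x) (- y)" for x y
    by (simp add: aff3_def)
  have "row 4 (\<lambda>xs. 1 * prod4 (vec3 0 1 (- 1)) (vec3 (- z) 0 1) (vec3 (1 + z) 1 0) (vec3 0 1 (- 1)) (map uminus xs))"
    by (rule is_row_twist[where g = uminus and r = aff3 and w = "\<lambda>_. 1", OF aff]) (simp_all add: row_4_base_3)
  then show ?thesis
  proof (rule is_row_cong)
    fix xs :: "3 list" assume "length xs = 4"
    then obtain a b c d where xs: "xs = [a, b, c, d]"
      by (auto simp: length_4_iff)
    have "vec3 0 (- 1) 1 x = - vec3 0 1 (- 1 :: 'k) x" for x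
      by (simp add: vec3_def)
    then show "prod4 (vec3 0 1 (- 1)) (vec3 (- z) 1 0) (vec3 (1 + z) 0 1) (vec3 0 1 (- 1)) xs =
        1 * prod4 (vec3 0 1 (- 1)) (vec3 (- z) 0 1) (vec3 (1 + z) 1 0) (vec3 0 1 (- 1)) (map uminus xs)"
      unfolding xs by (simp add: neg)
  qed
qed

text \<open>The kernel in degree 4 contains one more relation modulo the cubic ones. It involves the
  words \<open>abcd\<close> with \<open>a - b + c - d = 0\<close>, and its coefficients depend only on \<open>x = b - a\<close> and
  \<open>y = c - a\<close>.\<close>

definition quartic_coeff :: "3 \<Rightarrow> 3 \<Rightarrow> 'k" where
  "quartic_coeff = vec3 (vec3 0 (2 + 4 * z) (- 2 - 4 * z)) (vec3 (1 - z) 3 (2 + z)) (vec3 (z - 1) (- 2 - z) (- 3))"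

lemma sum_shift_three: "(\<Sum>a\<in>UNIV. h (a + c)) = (\<Sum>a\<in>UNIV. h a)" for h :: "3 \<Rightarrow> 'k"
  using three_cases[of c] by (auto simp: sum_three three_arith algebra_simps)

text \<open>The letters brought to the front by the shuffles of
  \<open>[a, a + x, a + y, a + y - x]\<close>, the general word of length 4 with alternating sum
  0.\<close>

lemma shift_words_4:
  "aff3 a (a + x) = a - x" "aff3 a (aff3 (a + x) (a + y)) = a + (x + y)"
  "aff3 a (aff3 (a + x) (aff3 (a + y) (a + y - x))) = a + (y - x)" for a x y :: 3
proof -
  have "2 * t = - t" for t :: 3
    using three_cases[of t] by (auto simp: three_arith)
  then show "aff3 a (a + x) = a - x" "aff3 a (aff3 (a + x) (a + y)) = a + (x + y)"
    "aff3 a (aff3 (a + x) (aff3 (a + y) (a + y - x))) = a + (y - x)"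
    by (simp_all add: aff3_def algebra_simps)
qed

lemma quartic_in_ker:
  "(\<Sum>a\<in>UNIV. \<Sum>x\<in>UNIV. \<Sum>y\<in>UNIV.
      pscale (quartic_coeff x y) (basis [a, a + x, a + y, a + y - x])) \<in> ker 4" (is "?Q \<in> _")
proof -
  have "pairing (qsym_dual aff3 (\<lambda>_ _. z) 4 F) ?Q = 0" for F
  proof -
    define G where "G = symmetrizer dual (Suc (Suc (Suc 0))) (Suc 0) F"
    define P where "P x y a = G [a, a + x, a + y, a + y - x]" for x y a
    have P: "G [a - x, a, a + y, a + y - x] = P x (x + y) (a + (- x))"
      "G [a + (x + y), a, a + x, a + y - x] = P (- x - y) (- y) (a + (x + y))"
      "G [a + (y - x), a, a + x, a + y] = P (x - y) (- x - y) (a + (y - x))" for x y a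
    proof -
      have x2: "2 * x = - x"
        using three_cases[of x] by (auto simp: three_arith)
      have e: "a + (x + y) + (- y) - (- x - y) = a + y + 2 * x" "a + (y - x) + (- x - y) = a - 2 * x"
        "a + (y - x) + (- x - y) - (x - y) = a + y - 2 * x - x"
        by (simp_all add: algebra_simps)
      show "G [a - x, a, a + y, a + y - x] = P x (x + y) (a + (- x))"
        "G [a + (x + y), a, a + x, a + y - x] = P (- x - y) (- y) (a + (x + y))"
        "G [a + (y - x), a, a + x, a + y] = P (x - y) (- x - y) (a + (y - x))"
        unfolding P_def e x2 by simp_all
    qed
    have four: "(4 :: nat) = Suc (Suc (Suc (Suc 0)))" by simp
    \<comment> \<open>The coefficients do not depend on \<open>a\<close>, and each shuffle
      translates \<open>a\<close>. Summing over \<open>a\<close> first leaves an identity in the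
      nine numbers \<open>R x y\<close>.\<close>
    define R where "R x y = (\<Sum>a\<in>UNIV. P x y a)" for x y
    have "pairing (qsym_dual aff3 (\<lambda>_ _. z) 4 F) ?Q = (\<Sum>a\<in>UNIV. \<Sum>x\<in>UNIV. \<Sum>y\<in>UNIV.
        quartic_coeff x y * (P x y a + z * P x (x + y) (a + (- x))
          + z\<^sup>2 * P (- x - y) (- y) (a + (x + y)) + P (x - y) (- x - y) (a + (y - x))))"
      unfolding pairing.word_sum_sum pairing.word_sum_pscale pairing.word_sum_basis four
        symmetrizer.simps(2)[of _ "Suc (Suc (Suc 0))"] G_def[symmetric] shuffle_sum_4 shift_words_4 P z3
      by (simp only: P_def mult_1_left)
    also have "\<dots> = (\<Sum>x\<in>UNIV. \<Sum>y\<in>UNIV. \<Sum>a\<in>UNIV.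
        quartic_coeff x y * (P x y a + z * P x (x + y) (a + (- x))
          + z\<^sup>2 * P (- x - y) (- y) (a + (x + y)) + P (x - y) (- x - y) (a + (y - x))))"
      by (subst sum.swap) (intro sum.cong refl sum.swap)
    also have "\<dots> = (\<Sum>x\<in>UNIV. \<Sum>y\<in>UNIV. quartic_coeff x y * (R x y + z * R x (x + y)
          + z\<^sup>2 * R (- x - y) (- y) + R (x - y) (- x - y)))"
      unfolding R_def by (simp only: sum_shift_three sum.distrib flip: sum_distrib_left)
    also have "\<dots> = 0"
      unfolding sum_three quartic_coeff_def by (simp add: three_arith z2 zz zzx algebra_simps)
    finally show ?thesis .
  qed
  then show ?thesis by (simp add: qsym_kernel_def tensor_power_sum tensor_power_pscale)
qed

end

section \<open>Coordinates and Fourier coefficients\<close>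

text \<open>\<open>Inl\<close> indexes coordinates and \<open>Inr\<close> frequencies. Because of
  the alternating sum, frequency \<open>k\<close> at one position goes with \<open>- k\<close> at
  the next; \<open>flip\<close> records this change.\<close>

fun flip :: "3 + 3 \<Rightarrow> 3 + 3" where
  "flip (Inl s) = Inl s"
| "flip (Inr k) = Inr (- k)"

lemma flip_flip [simp]: "flip (flip i) = i"
  by (cases i) simp_all

lemma bij_flip: "bij flip"
  by (rule o_bij[of flip]) (simp_all add: fun_eq_iff)

lemma flip_in_image_iff: "i \<in> flip ` A \<longleftrightarrow> flip i \<in> A"
  by (metis flip_flip image_iff)

lemma all_sum: "(\<forall>i. P i) \<longleftrightarrow> (\<forall>s. P (Inl s)) \<and> (\<forall>k. P (Inr k))"
  by (metis sum.exhaust)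

lemma card_sum_UNIV_three: "card (UNIV :: (3 + 3) set) = 6"
  by (simp add: card_UNIV_sum)

context zeta3
begin

definition chi :: "3 \<Rightarrow> 'k" where
  "chi = vec3 1 z (z\<^sup>2)"

lemma chi_simps [simp]: "chi 0 = 1" "chi 1 = z" "chi 2 = z\<^sup>2"
  by (simp_all add: chi_def)

lemma chi_add: "chi (a + b) = chi a * chi b"
  using three_cases[of a] three_cases[of b] by (auto simp: three_arith z2 zz zzx algebra_simps)

lemma chi_minus: "chi (- a) * chi a = 1"
  by (simp flip: chi_add)

lemma chi_nonzero: "chi a \<noteq> 0"
  using chi_minus[of a] by auto

lemma chi_sum: "m \<noteq> 0 \<Longrightarrow> (\<Sum>x\<in>UNIV. chi (m * x)) = 0"
  using three_cases[of m] by (auto simp: sum_three three_arith z2)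

lemma dft_inj:
  assumes "\<And>k. (\<Sum>s\<in>UNIV. chi (k * s) * h s) = 0"
  shows "h s = 0"
proof -
  have h: "h 0 + h 1 + h 2 = 0" "h 0 + z * h 1 + z\<^sup>2 * h 2 = 0" "h 0 + z\<^sup>2 * h 1 + z * h 2 = 0"
    using assms[of 0] assms[of 1] assms[of 2] by (simp_all add: sum_three three_arith)
  \<comment> \<open>The inverse transform up to the factor 3: frequency \<open>k\<close> is weighted
    with \<open>chi (- (k * s))\<close>.\<close>
  have "3 * h 0 = (h 0 + h 1 + h 2) + (h 0 + z * h 1 + z\<^sup>2 * h 2) + (h 0 + z\<^sup>2 * h 1 + z * h 2)"
    by (simp add: z2 algebra_simps)
  moreover have "3 * h 1 = (h 0 + h 1 + h 2) + z\<^sup>2 * (h 0 + z * h 1 + z\<^sup>2 * h 2) + z * (h 0 + z\<^sup>2 * h 1 + z * h 2)"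
    by (simp add: z2 zz zzx algebra_simps)
  moreover have "3 * h 2 = (h 0 + h 1 + h 2) + z * (h 0 + z * h 1 + z\<^sup>2 * h 2) + z\<^sup>2 * (h 0 + z\<^sup>2 * h 1 + z * h 2)"
    by (simp add: z2 zz zzx algebra_simps)
  ultimately show ?thesis
    using three_cases[of s] unfolding h by auto
qed

fun L :: "3 + 3 \<Rightarrow> (3 \<Rightarrow> 'k) \<Rightarrow> 'k" where
  "L (Inl s) u = u s"
| "L (Inr k) u = (\<Sum>s\<in>UNIV. chi (k * s) * u s)"

lemma L_Inr_simps:
  "L (Inr 0) u = u 0 + u 1 + u 2" "L (Inr 1) u = u 0 + z * u 1 + z\<^sup>2 * u 2"
  "L (Inr 2) u = u 0 + z\<^sup>2 * u 1 + z * u 2"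
  by (simp_all add: sum_three three_arith)

lemma L_linear: "L i (\<lambda>x. u x - c * v x) = L i u - c * L i v"
  by (cases i) (simp_all add: sum_subtractf sum_distrib_left algebra_simps)

lemma L_scale: "L i (\<lambda>x. c * u x) = c * L i u"
  by (cases i) (simp_all add: sum_distrib_left algebra_simps)

text \<open>Translations and multiplications with characters are symmetries of the relations, provided
  that the character is inverted at every other position of a product.\<close>

definition tw :: "3 \<Rightarrow> 3 \<Rightarrow> (3 \<Rightarrow> 'k) \<Rightarrow> 3 \<Rightarrow> 'k" where
  "tw s m u a = chi (m * a) * u (a + s)"

fun sh :: "3 \<Rightarrow> 3 \<Rightarrow> 3 + 3 \<Rightarrow> 3 + 3" where
  "sh s m (Inl i) = Inl (i + s)"
| "sh s m (Inr k) = Inr (k + m)"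

lemma sh_sh: "sh s m (sh s' m' i) = sh (s + s') (m + m') i"
  by (cases i) (simp_all add: algebra_simps)

lemma sh_0 [simp]: "sh 0 0 i = i"
  by (cases i) simp_all

lemma bij_sh: "bij (sh s m)"
  by (rule o_bij[of "sh (- s) (- m)"]) (simp_all add: fun_eq_iff sh_sh)

lemma flip_sh: "flip (sh s m i) = sh s (- m) (flip i)"
  by (cases i) simp_all

text \<open>Translation multiplies a Fourier coefficient by a root of unity, and a character shifts
  its frequency. Recording only the vanishing avoids carrying the roots of unity along.\<close>

lemma L_tw_eq_0_iff: "L i (tw s m u) = 0 \<longleftrightarrow> L (sh s m i) u = 0"
proof (cases i)
  case (Inr k)
  have "L i (tw s m u) = (\<Sum>a\<in>UNIV. chi (- ((k + m) * s)) * (chi ((k + m) * (a + s)) * u (a + s)))"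
  proof -
    have "chi (k * a) * chi (m * a) = chi (- ((k + m) * s)) * chi ((k + m) * (a + s))" for a
      by (simp add: algebra_simps flip: chi_add)
    then show ?thesis
      unfolding Inr by (simp add: tw_def flip: mult.assoc)
  qed
  also have "\<dots> = chi (- ((k + m) * s)) * L (Inr (k + m)) u"
    by (simp only: sum_shift_three[of "\<lambda>b. chi ((k + m) * b) * u b"] L.simps flip: sum_distrib_left)
  finally show ?thesis
    using Inr by (simp add: chi_nonzero del: L.simps)
qed (simp add: tw_def chi_nonzero)

lemma tw_eq_0_iff: "tw s m u = (\<lambda>_. 0) \<longleftrightarrow> u = (\<lambda>_. 0)"
proof -
  have "tw s m u (a - s) = chi (m * (a - s)) * u a" for a
    by (simp add: tw_def)
  then have "u a = 0" if "tw s m u = (\<lambda>_. 0)" for a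
    using that chi_nonzero by (metis mult_eq_0_iff)
  then show ?thesis
    by (auto simp: tw_def fun_eq_iff)
qed

text \<open>This is the non-vanishing of all minors of the Fourier matrix of order 3. If two
  coordinates vanish, a Fourier coefficient is a root of unity times the third. One coordinate and
  two frequencies are moved by \<open>tw\<close> to coordinate 0 and frequency 0; then the other
  coefficient is \<open>(1 + 2 * z) * u 2\<close> up to sign.\<close>

lemma L_indep:
  assumes "i \<noteq> j" "i \<noteq> k" "j \<noteq> k" "L i u = 0" "L j u = 0" "L k u = 0"
  shows "u = (\<lambda>_. 0)"
proof -
  have two: "u = (\<lambda>_. 0)" if "s \<noteq> s'" "L (Inl s) u = 0" "L (Inl s') u = 0" "L (Inr m) u = 0" for s s' m
    using that three_cases[of s] three_cases[of s'] three_cases[of m]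
    by (auto simp: fun_eq_iff all_three L_Inr_simps z_nonzero simp del: L.simps(2))
  have one: "u = (\<lambda>_. 0)" if mm: "m \<noteq> m'" and "L (Inl s) u = 0" "L (Inr m) u = 0" "L (Inr m') u = 0" for s m m'
  proof -
    let ?u = "tw s m u"
    have "L (Inl 0) ?u = 0" "L (Inr 0) ?u = 0" "L (Inr (m' - m)) ?u = 0"
      unfolding L_tw_eq_0_iff using that by simp_all
    then have u: "?u 0 = 0" "?u 1 = - ?u 2" "L (Inr (m' - m)) ?u = 0"
      by (simp_all add: L_Inr_simps eq_neg_iff_add_eq_0 del: L.simps(2))
    have "(1 + 2 * z) * (1 + 2 * z) = - 3"
      by (simp add: zz zzx algebra_simps)
    then have "1 + 2 * z \<noteq> 0" by auto
    moreover have e: "(1 + 2 * z) * ?u 2 = - (?u 0 + z * ?u 1 + z\<^sup>2 * ?u 2)"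
      "(1 + 2 * z) * ?u 2 = ?u 0 + z\<^sup>2 * ?u 1 + z * ?u 2"
      by (simp_all add: u(1,2) z2 algebra_simps)
    have "(1 + 2 * z) * ?u 2 = 0"
    proof -
      consider "m' - m = 1" | "m' - m = 2"
        using three_cases[of "m' - m"] mm by auto
      then show ?thesis
      proof cases
        case 1
        then show ?thesis unfolding e(1) using u(3) by (simp add: L_Inr_simps del: L.simps(2))
      next
        case 2
        then show ?thesis unfolding e(2) using u(3) by (simp add: L_Inr_simps del: L.simps(2))
      qed
    qed
    ultimately have "?u 2 = 0" by simp
    then have "?u = (\<lambda>_. 0)"
      using u by (simp add: fun_eq_iff all_three)
    then show ?thesis
      by (simp add: tw_eq_0_iff)
  qed
  have all: "\<forall>x. P x" if "a \<noteq> b" "a \<noteq> c" "b \<noteq> c" "P a" "P b" "P c" for a b c :: 3 and P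
    using that three_cases[of a] three_cases[of b] three_cases[of c] by (auto simp: all_three)
  have coords: "u = (\<lambda>_. 0)" if "\<forall>s. L (Inl s) u = 0"
    using that by auto
  have fourier: "u = (\<lambda>_. 0)" if "\<forall>k. L (Inr k) u = 0"
    using that dft_inj[of u] by auto
  show ?thesis
  proof (cases i; cases j; cases k)
    fix a b c assume "i = Inl a" "j = Inl b" "k = Inl c"
    then show ?thesis using assms all[of a b c "\<lambda>s. L (Inl s) u = 0"] coords by simp
  next
    fix a b c assume "i = Inr a" "j = Inr b" "k = Inr c"
    then show ?thesis using assms all[of a b c "\<lambda>s. L (Inr s) u = 0"] fourier by (simp del: L.simps)
  qed (use assms one two in \<open>auto simp del: L.simps\<close>)
qed

text \<open>The witness is a unit vector for two coordinates, a character belonging to the third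
  frequency for two frequencies, and a twist of \<open>vec3 0 1 (- 1)\<close> in the mixed
  case.\<close>

lemma L_exists:
  assumes "i \<noteq> j"
  shows "\<exists>u. u \<noteq> (\<lambda>_. 0) \<and> L i u = 0 \<and> L j u = 0"
proof -
  have mixed: "\<exists>u. u \<noteq> (\<lambda>_. 0) \<and> L (Inl s) u = 0 \<and> L (Inr k) u = 0" for s k
  proof -
    let ?u = "vec3 0 1 (- 1 :: 'k)"
    have "L (Inl 0) ?u = 0" "L (Inr 0) ?u = 0"
      by (simp_all add: L_Inr_simps del: L.simps(2))
    then have "L (Inl s) (tw (- s) (- k) ?u) = 0" "L (Inr k) (tw (- s) (- k) ?u) = 0"
      unfolding L_tw_eq_0_iff by simp_all
    moreover have "?u \<noteq> (\<lambda>_. 0)"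
      by (auto simp: fun_eq_iff all_three)
    ultimately show ?thesis
      by (metis tw_eq_0_iff)
  qed
  have third: "\<exists>c. c \<noteq> a \<and> c \<noteq> b" for a b :: 3
    using three_cases[of a] three_cases[of b] by (auto intro: exI[of _ 0] exI[of _ 1] exI[of _ 2])
  show ?thesis
  proof (cases i; cases j)
    fix a b assume ij: "i = Inl a" "j = Inl b"
    obtain c where "c \<noteq> a" "c \<noteq> b" using third by blast
    then show ?thesis
      using ij by (intro exI[of _ "\<lambda>x. if x = c then 1 else 0"]) (auto simp: fun_eq_iff)
  next
    fix a b assume ij: "i = Inr a" "j = Inr b"
    obtain c where c: "c \<noteq> a" "c \<noteq> b" using third by blast
    have "L (Inr k) (\<lambda>x. chi (- (c * x))) = 0" if "c \<noteq> k" for k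
    proof -
      have "k * x - c * x = (k - c) * x" for x by (simp add: algebra_simps)
      then show ?thesis
        using chi_sum[of "k - c"] that by (simp flip: chi_add)
    qed
    then show ?thesis
      using ij c chi_nonzero by (intro exI[of _ "\<lambda>x. chi (- (c * x))"]) (auto simp: fun_eq_iff simp del: L.simps)
  qed (use mixed in \<open>auto simp del: L.simps\<close>)
qed

definition zeros :: "(3 \<Rightarrow> 'k) \<Rightarrow> (3 + 3) set" where
  "zeros u = {i. L i u = 0}"

lemma card_zeros: "u \<noteq> (\<lambda>_. 0) \<Longrightarrow> card (zeros u) \<le> 2"
proof (rule ccontr)
  assume u: "u \<noteq> (\<lambda>_. 0)" and "\<not> card (zeros u) \<le> 2"
  then have "3 \<le> card (zeros u)" by simp
  then obtain T where "T \<subseteq> zeros u" "card T = 3"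
    using obtain_subset_with_card_n by metis
  then obtain i j k where "i \<noteq> j" "i \<noteq> k" "j \<noteq> k" "{i, j, k} \<subseteq> zeros u"
    by (auto simp: card_3_iff)
  then show False
    using L_indep[of i j k u] u by (simp add: zeros_def)
qed

text \<open>For a pair \<open>A\<close> the vector is unique up to a scalar by
  \<open>same_zeros\<close>, so the choice does not affect the projective point.\<close>

definition pt :: "(3 + 3) set \<Rightarrow> 3 \<Rightarrow> 'k" where
  "pt A = (SOME u. u \<noteq> (\<lambda>_. 0) \<and> A \<subseteq> zeros u)"

lemma pt:
  assumes "card A = 2"
  shows "pt A \<noteq> (\<lambda>_. 0)" "zeros (pt A) = A"
proof -
  obtain i j where "A = {i, j}" "i \<noteq> j"
    using assms by (auto simp: card_2_iff)
  then have "\<exists>u. u \<noteq> (\<lambda>_. 0) \<and> A \<subseteq> zeros u"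
    using L_exists[of i j] by (simp add: zeros_def)
  then have *: "pt A \<noteq> (\<lambda>_. 0) \<and> A \<subseteq> zeros (pt A)"
    unfolding pt_def by (rule someI_ex)
  then show "pt A \<noteq> (\<lambda>_. 0)" by blast
  show "zeros (pt A) = A"
    using * card_zeros[of "pt A"] assms card_mono[of "zeros (pt A)" A]
    by (intro card_subset_eq[symmetric]) auto
qed

text \<open>A functional that does not vanish on \<open>u\<close> fixes the scalar \<open>c\<close>;
  then \<open>v - c * u\<close> is killed by three functionals.\<close>

lemma same_zeros:
  assumes "card (zeros u) = 2" "u \<noteq> (\<lambda>_. 0)" "v \<noteq> (\<lambda>_. 0)" "zeros u \<subseteq> zeros v"
  obtains c where "c \<noteq> 0" "v = (\<lambda>x. c * u x)"
proof -
  obtain i j where ij: "zeros u = {i, j}" "i \<noteq> j"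
    using assms(1) by (auto simp: card_2_iff)
  have "zeros u \<noteq> UNIV"
    using assms(1) card_sum_UNIV_three by auto
  then obtain k where k: "k \<notin> zeros u" by blast
  define c where "c = L k v / L k u"
  have "L k u \<noteq> 0" using k by (simp add: zeros_def)
  then have "L k v = c * L k u" by (simp add: c_def)
  moreover have "L i u = 0" "L j u = 0" "L i v = 0" "L j v = 0"
    using ij assms(4) by (auto simp: zeros_def)
  ultimately have "(\<lambda>x. v x - c * u x) = (\<lambda>_. 0)"
    using ij k by (intro L_indep[of i j k]) (auto simp: L_linear)
  then have v: "v = (\<lambda>x. c * u x)"
    by (auto simp: fun_eq_iff)
  moreover have "c \<noteq> 0" using v assms(3) by auto
  ultimately show ?thesis using that by blast
qed

lemma zeros_scale: "c \<noteq> 0 \<Longrightarrow> zeros (\<lambda>x. c * u x) = zeros u"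
  by (simp add: zeros_def L_scale)

lemma zeros_eq_of_proj_point_eq:
  assumes "proj_point u = proj_point v" "u \<noteq> (\<lambda>_. 0)"
  shows "zeros u = zeros v"
  using proj_point_eqD[OF assms] zeros_scale by metis

lemma proj_point_pt:
  assumes "u \<noteq> (\<lambda>_. 0)" "card (zeros u) = 2"
  shows "proj_point u = proj_point (pt (zeros u))"
proof -
  obtain c where "c \<noteq> 0" "u = (\<lambda>x. c * pt (zeros u) x)"
    using same_zeros[of "pt (zeros u)" u] pt[OF assms(2)] assms by auto
  then show ?thesis
    using proj_point_scale by metis
qed

section \<open>The cubic relations as a covering condition\<close>

definition cubic :: "(3 \<Rightarrow> 'k) \<Rightarrow> (3 \<Rightarrow> 'k) \<Rightarrow> (3 \<Rightarrow> 'k) \<Rightarrow> bool" where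
  "cubic u v w \<longleftrightarrow> zeros u \<union> flip ` zeros v \<union> zeros w = UNIV"

definition conv :: "(3 \<Rightarrow> 'k) \<Rightarrow> (3 \<Rightarrow> 'k) \<Rightarrow> (3 \<Rightarrow> 'k) \<Rightarrow> 3 \<Rightarrow> 'k" where
  "conv u v w s = (\<Sum>i\<in>UNIV. \<Sum>j\<in>UNIV. u (s + i) * v (s + j) * w (s + j - i))"

text \<open>The convolution theorem: \<open>conv\<close> sums over the words with
  \<open>a - b + c = s\<close>, and \<open>chi (k * s)\<close> factors accordingly, the middle
  letter receiving the frequency \<open>- k\<close>.\<close>

lemma L_conv:
  "L (Inr k) u * L (Inr (- k)) v * L (Inr k) w = (\<Sum>s\<in>UNIV. chi (k * s) * conv u v w s)"
proof -
  have "(\<Sum>s\<in>UNIV. chi (k * s) * conv u v w s) =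
      (\<Sum>s\<in>UNIV. \<Sum>i\<in>UNIV. \<Sum>j\<in>UNIV. chi (k * s) * (u (s + i) * v (s + j) * w (s + j - i)))"
    by (simp only: conv_def sum_distrib_left)
  also have "\<dots> = L (Inr k) u * L (Inr (- k)) v * L (Inr k) w"
    using three_cases[of k]
    by (elim disjE) (simp_all add: sum_three three_arith z2 zz zzx algebra_simps)
  finally show ?thesis by simp
qed

lemma conv_eq_0_iff:
  "(\<forall>s. conv u v w s = 0) \<longleftrightarrow> (\<forall>k. L (Inr k) u = 0 \<or> L (Inr (- k)) v = 0 \<or> L (Inr k) w = 0)"
proof -
  have "(\<forall>s. conv u v w s = 0) \<longleftrightarrow> (\<forall>k. (\<Sum>s\<in>UNIV. chi (k * s) * conv u v w s) = 0)"
    using dft_inj[of "conv u v w"] by auto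
  then show ?thesis
    by (simp add: L_conv[symmetric] del: L.simps)
qed

lemma cubic_iff:
  "cubic u v w \<longleftrightarrow> (\<forall>s. u s * v s * w s = 0) \<and> (\<forall>s. conv u v w s = 0)"
proof -
  have "cubic u v w \<longleftrightarrow> (\<forall>i. L i u = 0 \<or> L (flip i) v = 0 \<or> L i w = 0)"
    by (auto simp: cubic_def zeros_def set_eq_iff flip_in_image_iff simp del: L.simps)
  also have "\<dots> \<longleftrightarrow> (\<forall>s. u s * v s * w s = 0) \<and> (\<forall>s. conv u v w s = 0)"
    unfolding all_sum conv_eq_0_iff by (simp del: L.simps(2))
  finally show ?thesis .
qed

definition prod3 :: "(3 \<Rightarrow> 'k) \<Rightarrow> (3 \<Rightarrow> 'k) \<Rightarrow> (3 \<Rightarrow> 'k) \<Rightarrow> 3 list \<Rightarrow> 'k" where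
  "prod3 u v w xs = u (xs ! 0) * v (xs ! 1) * w (xs ! 2)"

lemma prod3_simps [simp]: "prod3 u v w [a, b, c] = u a * v b * w c"
  by (simp add: prod3_def numeral_2_eq_2)

text \<open>The explicit elements \<open>cube_in_ker\<close> and \<open>conv_in_ker\<close> give the
  necessary conditions, and \<open>row_3\<close> shows that there are no others.\<close>

lemma prod3_annihilates_iff: "(\<forall>f\<in>ker 3. pairing (prod3 u v w) f = 0) \<longleftrightarrow> cubic u v w"
proof
  assume *: "\<forall>f\<in>ker 3. pairing (prod3 u v w) f = 0"
  have "u s * v s * w s = 0" for s
    using *[rule_format, OF cube_in_ker[of s]] by simp
  moreover have "conv u v w s = 0" for s
    using *[rule_format, OF conv_in_ker[of s]] by (simp add: pairing.word_sum_sum conv_def)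
  ultimately show "cubic u v w" by (simp add: cubic_iff)
next
  assume "cubic u v w"
  then have "row (Suc (Suc (Suc 0))) (prod3 u v w)"
    by (intro row_3) (auto simp: cubic_iff conv_def)
  then have "row 3 (prod3 u v w)" by (simp add: numeral_3_eq_3)
  then show "\<forall>f\<in>ker 3. pairing (prod3 u v w) f = 0"
    using pairing_is_row by blast
qed

text \<open>Three sets of at most two elements can cover six elements only as a partition into
  pairs.\<close>

lemma cubic_partition:
  assumes "cubic u v w" "u \<noteq> (\<lambda>_. 0)" "v \<noteq> (\<lambda>_. 0)" "w \<noteq> (\<lambda>_. 0)"
  shows "card (zeros u) = 2" "card (zeros v) = 2" "card (zeros w) = 2"
    and "flip ` zeros v \<inter> zeros u = {}" "zeros w = - (zeros u \<union> flip ` zeros v)"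
proof -
  let ?A = "zeros u" and ?B = "flip ` zeros v" and ?C = "zeros w"
  have le: "card ?A \<le> 2" "card ?B \<le> 2" "card ?C \<le> 2"
    using card_zeros assms(2-4) card_image_le[of "zeros v" flip] by (auto intro: order_trans)
  have "6 = card (?A \<union> ?B \<union> ?C)"
    using assms(1) card_sum_UNIV_three by (simp add: cubic_def)
  moreover have "card (?A \<union> ?B \<union> ?C) + card ((?A \<union> ?B) \<inter> ?C) = card (?A \<union> ?B) + card ?C"
    using card_Un_Int[of "?A \<union> ?B" ?C] by simp
  moreover have "card (?A \<union> ?B) + card (?A \<inter> ?B) = card ?A + card ?B"
    using card_Un_Int[of ?A ?B] by simp
  ultimately have *: "card ?A = 2" "card ?B = 2" "card ?C = 2" "card (?A \<inter> ?B) = 0" "card ((?A \<union> ?B) \<inter> ?C) = 0"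
    using le by linarith+
  then show "card ?A = 2" "card ?C = 2" by auto
  have "inj_on flip (zeros v)"
    using bij_flip by (auto simp: bij_def inj_on_def)
  then show "card (zeros v) = 2"
    using * by (simp add: card_image)
  show "?B \<inter> ?A = {}"
    using * by auto
  show "?C = - (?A \<union> ?B)"
    using * assms(1) by (auto simp: cubic_def)
qed

section \<open>Point paths of length at most four in terms of the relations\<close>

abbreviation "path \<equiv> is_point_path aff3 (\<lambda>_ _. z)"

lemma pairing_ker_small: "k \<le> 2 \<Longrightarrow> f \<in> ker k \<Longrightarrow> pairing F f = 0"
proof -
  assume "k \<le> 2" "f \<in> ker k"
  then consider "k = 0" | "k = Suc 0" | "k = Suc (Suc 0)" by linarith
  then have "row k F"
    by cases (simp_all only: is_row_0 is_row_1 row_2)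
  then show ?thesis
    using \<open>f \<in> ker k\<close> by (rule pairing_is_row)
qed

text \<open>The first letter of a word acts last, hence the reversed order of the points.\<close>

lemma word_weight_3_annihilates_iff:
  "(\<forall>f\<in>ker 3. pairing (word_weight lam j) f = 0) \<longleftrightarrow> cubic (lam (Suc (Suc j))) (lam (Suc j)) (lam j)"
proof -
  have "pairing (word_weight lam j) f = pairing (prod3 (lam (Suc (Suc j))) (lam (Suc j)) (lam j)) f"
    if "f \<in> ker 3" for f
    using that by (intro word_sum_cong) (auto simp: qsym_kernel_def tensor_power_def length_3_iff)
  then show ?thesis
    by (simp add: prod3_annihilates_iff[symmetric])
qed

lemma path_2_iff: "path 2 lam \<longleftrightarrow> (\<forall>j<2. lam j \<noteq> (\<lambda>_. 0))"
  unfolding is_point_path_def by (auto intro: pairing_ker_small[OF add_leD2])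

lemma path_3_iff: "path 3 lam \<longleftrightarrow> (\<forall>j<3. lam j \<noteq> (\<lambda>_. 0)) \<and> cubic (lam 2) (lam 1) (lam 0)"
proof -
  have "(\<forall>j k. j + k \<le> 3 \<longrightarrow> (\<forall>f\<in>ker k. pairing (word_weight lam j) f = 0)) \<longleftrightarrow>
      (\<forall>f\<in>ker 3. pairing (word_weight lam 0) f = 0)"
  proof (intro iffI allI impI ballI)
    fix j k f assume 3: "\<forall>f\<in>ker 3. pairing (word_weight lam 0) f = 0" and jk: "j + k \<le> 3" and f: "f \<in> ker k"
    show "pairing (word_weight lam j) f = 0"
    proof (cases "k \<le> 2")
      case False
      then have "k = 3" "j = 0" using jk by auto
      then show ?thesis using 3 f by simp
    qed (use f pairing_ker_small in blast)
  qed (metis add_0 order_refl)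
  then show ?thesis
    unfolding is_point_path_def word_weight_3_annihilates_iff by (simp add: numeral_2_eq_2)
qed

lemma path_4_iff:
  "path 4 lam \<longleftrightarrow> (\<forall>j<4. lam j \<noteq> (\<lambda>_. 0)) \<and> cubic (lam 2) (lam 1) (lam 0) \<and> cubic (lam 3) (lam 2) (lam 1) \<and>
    (\<forall>f\<in>ker 4. pairing (prod4 (lam 3) (lam 2) (lam 1) (lam 0)) f = 0)"
proof -
  have "pairing (word_weight lam 0) f = pairing (prod4 (lam 3) (lam 2) (lam 1) (lam 0)) f"
    if "f \<in> ker 4" for f
    using that by (intro word_sum_cong)
      (auto simp: qsym_kernel_def tensor_power_def length_4_iff numeral_2_eq_2 numeral_3_eq_3)
  then have 4: "(\<forall>f\<in>ker 4. pairing (word_weight lam 0) f = 0) \<longleftrightarrow>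
      (\<forall>f\<in>ker 4. pairing (prod4 (lam 3) (lam 2) (lam 1) (lam 0)) f = 0)"
    by simp
  have 3: "(\<forall>f\<in>ker 3. pairing (word_weight lam 0) f = 0) \<longleftrightarrow> cubic (lam 2) (lam 1) (lam 0)"
    "(\<forall>f\<in>ker 3. pairing (word_weight lam 1) f = 0) \<longleftrightarrow> cubic (lam 3) (lam 2) (lam 1)"
    using word_weight_3_annihilates_iff[of lam 0] word_weight_3_annihilates_iff[of lam 1]
    by (simp_all add: numeral_2_eq_2 numeral_3_eq_3)
  \<comment> \<open>Windows of at most two points impose no condition on pairings; the longer
    windows within four points are the three listed.\<close>
  have "(\<forall>j k. j + k \<le> 4 \<longrightarrow> P j k) \<longleftrightarrow> P 0 3 \<and> P 1 3 \<and> P 0 4"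
    if small: "\<And>j k. k \<le> 2 \<Longrightarrow> P j k" for P :: "nat \<Rightarrow> nat \<Rightarrow> bool"
  proof
    assume "\<forall>j k. j + k \<le> 4 \<longrightarrow> P j k"
    from this[rule_format, of 0 3] this[rule_format, of 1 3] this[rule_format, of 0 4]
    show "P 0 3 \<and> P 1 3 \<and> P 0 4" by simp
  next
    assume *: "P 0 3 \<and> P 1 3 \<and> P 0 4"
    show "\<forall>j k. j + k \<le> 4 \<longrightarrow> P j k"
    proof (intro allI impI)
      fix j k :: nat assume "j + k \<le> 4"
      then consider "k \<le> 2" | "k = 3" "j = 0" | "k = 3" "j = 1" | "k = 4" "j = 0" by linarith
      then show "P j k" by cases (use * small in auto)
    qed
  qed
  from this[of "\<lambda>j k. \<forall>f\<in>ker k. pairing (word_weight lam j) f = 0"]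
  have "(\<forall>j k. j + k \<le> 4 \<longrightarrow> (\<forall>f\<in>ker k. pairing (word_weight lam j) f = 0)) \<longleftrightarrow>
      (\<forall>f\<in>ker 3. pairing (word_weight lam 0) f = 0) \<and> (\<forall>f\<in>ker 3. pairing (word_weight lam 1) f = 0) \<and>
      (\<forall>f\<in>ker 4. pairing (word_weight lam 0) f = 0)"
    using pairing_ker_small by blast
  then show ?thesis
    unfolding is_point_path_def 3 4 by simp
qed

text \<open>Ordered partitions of the six functionals into three pairs, of which the first two
  are recorded.\<close>

definition pairs :: "((3 + 3) set \<times> (3 + 3) set) set" where
  "pairs = (SIGMA A:{A. card A = 2}. {B. B \<subseteq> - A \<and> card B = 2})"

lemma card_pairs: "card pairs = 90"
proof -
  have "card {A :: (3 + 3) set. card A = 2} = 15"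
    using n_subsets[of "UNIV :: (3 + 3) set" 2] by (simp add: card_sum_UNIV_three choose_two)
  moreover have "card {B. B \<subseteq> - A \<and> card B = 2} = 6" if "card A = 2" for A :: "(3 + 3) set"
    using n_subsets[of "- A" 2] that by (simp add: Compl_eq_Diff_UNIV card_Diff_subset card_sum_UNIV_three choose_two)
  ultimately show ?thesis
    unfolding pairs_def by (subst card_SigmaI) simp_all
qed

text \<open>Points are listed by degree, whereas \<open>A\<close> belongs to the first tensor factor
  and hence to the last point. \<open>B\<close> is the flipped zero set of the middle point, so that
  \<open>A\<close>, \<open>B\<close> and the complement of their union form the partition.\<close>

fun triple :: "(3 + 3) set \<times> (3 + 3) set \<Rightarrow> (3 \<Rightarrow> 'k) set list" where
  "triple (A, B) = map proj_point [pt (- (A \<union> B)), pt (flip ` B), pt A]"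

lemma card_flip_image: "card (flip ` B) = card B"
  by (rule card_image) (use bij_flip in \<open>auto simp: bij_def inj_on_def\<close>)

lemma card_compl_pairs: "(A, B) \<in> pairs \<Longrightarrow> card (- (A \<union> B)) = 2"
proof -
  assume *: "(A, B) \<in> pairs"
  then have "A \<inter> B = {}" by (auto simp: pairs_def)
  then have "card (A \<union> B) = 4"
    using * card_Un_disjoint[of A B] by (simp add: pairs_def)
  then show ?thesis
    by (simp add: Compl_eq_Diff_UNIV card_Diff_subset card_sum_UNIV_three)
qed

lemma flip_image_flip_image [simp]: "flip ` flip ` A = A"
  by (auto simp: image_image)

lemma cubic_pt: "(A, B) \<in> pairs \<Longrightarrow> cubic (pt A) (pt (flip ` B)) (pt (- (A \<union> B)))"
  using card_compl_pairs[of A B] by (auto simp: cubic_def pairs_def pt card_flip_image)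

lemma triple_of_cubic:
  assumes "cubic u v w" "u \<noteq> (\<lambda>_. 0)" "v \<noteq> (\<lambda>_. 0)" "w \<noteq> (\<lambda>_. 0)"
  shows "(zeros u, flip ` zeros v) \<in> pairs"
    and "triple (zeros u, flip ` zeros v) = map proj_point [w, v, u]"
  using cubic_partition[OF assms] assms proj_point_pt[of u] proj_point_pt[of v] proj_point_pt[of w]
  by (auto simp: pairs_def card_flip_image)

lemma inj_on_triple: "inj_on triple pairs"
proof (rule inj_onI)
  fix P P' assume *: "P \<in> pairs" "P' \<in> pairs" "triple P = triple P'"
  obtain A B A' B' where P: "P = (A, B)" "P' = (A', B')" by (meson surj_pair)
  have "card A = 2" "card A' = 2" "card (flip ` B) = 2" "card (flip ` B') = 2"
    using *(1,2) P by (auto simp: pairs_def card_flip_image)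
  then have "A = A'" "flip ` B = flip ` B'"
    using *(3) zeros_eq_of_proj_point_eq[of "pt A" "pt A'"]
      zeros_eq_of_proj_point_eq[of "pt (flip ` B)" "pt (flip ` B')"]
    by (auto simp: P pt)
  then show "P = P'"
    using P by (metis flip_image_flip_image)
qed

lemma paths_3: "{map (\<lambda>j. proj_point (lam j)) [0..<3] |lam. path 3 lam} = triple ` pairs"
proof (intro equalityI subsetI)
  fix ps assume "ps \<in> {map (\<lambda>j. proj_point (lam j)) [0..<3] |lam. path 3 lam}"
  then obtain lam where lam: "path 3 lam" "ps = map (\<lambda>j. proj_point (lam j)) [0..<3]" by blast
  then have "ps = triple (zeros (lam 2), flip ` zeros (lam 1))"
    "(zeros (lam 2), flip ` zeros (lam 1)) \<in> pairs"
    using triple_of_cubic[of "lam 2" "lam 1" "lam 0"]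
    by (auto simp: path_3_iff upt_rec numeral_2_eq_2)
  then show "ps \<in> triple ` pairs" by blast
next
  fix ps assume "ps \<in> triple ` pairs"
  then obtain A B where AB: "(A, B) \<in> pairs" "ps = triple (A, B)" by auto
  define lam where "lam j = [pt (- (A \<union> B)), pt (flip ` B), pt A] ! j" for j
  have "path 3 lam"
    unfolding path_3_iff using cubic_pt[OF AB(1)] AB(1) card_compl_pairs[OF AB(1)]
    by (auto simp: lam_def numeral_2_eq_2 numeral_3_eq_3 less_Suc_eq pairs_def pt card_flip_image)
  moreover have "ps = map (\<lambda>j. proj_point (lam j)) [0..<3]"
    by (simp add: AB lam_def upt_rec numeral_2_eq_2)
  ultimately show "ps \<in> {map (\<lambda>j. proj_point (lam j)) [0..<3] |lam. path 3 lam}" by blast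
qed

end

section \<open>Four and more points\<close>

context zeta3
begin

definition quartic :: "(3 \<Rightarrow> 'k) \<Rightarrow> (3 \<Rightarrow> 'k) \<Rightarrow> (3 \<Rightarrow> 'k) \<Rightarrow> (3 \<Rightarrow> 'k) \<Rightarrow> 'k" where
  "quartic u v w t = (\<Sum>a\<in>UNIV. \<Sum>x\<in>UNIV. \<Sum>y\<in>UNIV.
     quartic_coeff x y * (u a * v (a + x) * w (a + y) * t (a + y - x)))"

lemma quartic_eq_0:
  assumes "\<forall>f\<in>ker 4. pairing (prod4 u v w t) f = 0"
  shows "quartic u v w t = 0"
  using assms[rule_format, OF quartic_in_ker]
  by (simp add: quartic_def pairing.word_sum_sum pairing.word_sum_pscale)

text \<open>The characters cancel because the alternating sum of the letters is 0, and the
  translation is absorbed by the sum over \<open>a\<close>.\<close>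

lemma quartic_tw: "quartic (tw s m u) (tw s (- m) v) (tw s m w) (tw s (- m) t) = quartic u v w t"
proof -
  let ?h = "\<lambda>a. \<Sum>x\<in>UNIV. \<Sum>y\<in>UNIV. quartic_coeff x y * (u a * v (a + x) * w (a + y) * t (a + y - x))"
  have "tw s m u a * tw s (- m) v (a + x) * tw s m w (a + y) * tw s (- m) t (a + y - x) =
      u (a + s) * v (a + s + x) * w (a + s + y) * t (a + s + y - x)" for a x y
  proof -
    have "chi (m * a) * chi (- m * (a + x)) * chi (m * (a + y)) * chi (- m * (a + y - x)) = 1"
      by (simp add: algebra_simps flip: chi_add)
    then have "chi (m * a) * chi (- m * (a + x)) * chi (m * (a + y)) * chi (- m * (a + y - x)) *
        (u (a + s) * v (a + s + x) * w (a + s + y) * t (a + s + y - x)) =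
        u (a + s) * v (a + s + x) * w (a + s + y) * t (a + s + y - x)" by simp
    moreover have "a + x + s = a + s + x" "a + y + s = a + s + y" "a + y - x + s = a + s + y - x"
      by simp_all
    ultimately show ?thesis
      unfolding tw_def by (simp only: mult.assoc mult.left_commute)
  qed
  then have "quartic (tw s m u) (tw s (- m) v) (tw s m w) (tw s (- m) t) = (\<Sum>a\<in>UNIV. ?h (a + s))"
    by (simp only: quartic_def)
  also have "\<dots> = quartic u v w t"
    unfolding quartic_def by (rule sum_shift_three)
  finally show ?thesis .
qed

lemma zeros_tw: "zeros (tw s m u) = sh s m -` zeros u"
  by (auto simp: zeros_def L_tw_eq_0_iff)

lemma flip_zeros_tw: "flip ` zeros (tw s (- m) v) = sh s m -` (flip ` zeros v)"
  by (auto simp: zeros_tw flip_in_image_iff flip_sh set_eq_iff)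

lemma vimage_sh_eq_UNIV_iff: "sh s m -` S = UNIV \<longleftrightarrow> S = UNIV"
  using bij_sh[of s m] by (metis bij_def surj_image_vimage_eq vimage_UNIV)

lemma cubic_tw: "cubic (tw s m u) (tw s (- m) v) (tw s m w) \<longleftrightarrow> cubic u v w"
  unfolding cubic_def flip_zeros_tw unfolding zeros_tw vimage_Un[symmetric] by (rule vimage_sh_eq_UNIV_iff)

text \<open>Only one quartic element of the kernel is tested here. That this is enough emerges when
  every surviving candidate turns out to be a row.\<close>

definition good4 :: "(3 \<Rightarrow> 'k) \<Rightarrow> (3 \<Rightarrow> 'k) \<Rightarrow> (3 \<Rightarrow> 'k) \<Rightarrow> (3 \<Rightarrow> 'k) \<Rightarrow> bool" where
  "good4 u v w t \<longleftrightarrow> u \<noteq> (\<lambda>_. 0) \<and> v \<noteq> (\<lambda>_. 0) \<and> w \<noteq> (\<lambda>_. 0) \<and> t \<noteq> (\<lambda>_. 0) \<and>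
    cubic u v w \<and> cubic v w t \<and> quartic u v w t = 0"

lemma good4_tw: "good4 (tw s m u) (tw s (- m) v) (tw s m w) (tw s (- m) t) \<longleftrightarrow> good4 u v w t"
  using cubic_tw[of s "- m" v w t] by (simp add: good4_def tw_eq_0_iff cubic_tw quartic_tw)

text \<open>The partition from \<open>u\<close>, \<open>v\<close>, \<open>w\<close> and the flipped
  partition from \<open>v\<close>, \<open>w\<close>, \<open>t\<close> have the sets of
  \<open>v\<close> and \<open>w\<close> in common, so the remaining sets agree.\<close>

lemma zeros_fourth:
  assumes "cubic u v w" "cubic v w t" "u \<noteq> (\<lambda>_. 0)" "v \<noteq> (\<lambda>_. 0)" "w \<noteq> (\<lambda>_. 0)" "t \<noteq> (\<lambda>_. 0)"
  shows "zeros t = flip ` zeros u"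
proof -
  have 1: "i \<in> zeros w \<longleftrightarrow> i \<notin> zeros u \<and> flip i \<notin> zeros v" "\<not> (i \<in> zeros u \<and> flip i \<in> zeros v)"
    and 2: "i \<in> zeros t \<longleftrightarrow> i \<notin> zeros v \<and> flip i \<notin> zeros w" for i
    using cubic_partition(4,5)[OF assms(1,3,4,5)] cubic_partition(5)[OF assms(2,4,5,6)]
    by (auto simp: flip_in_image_iff set_eq_iff)
  show ?thesis
    using 1(2)[of "flip _"] by (auto simp: set_eq_iff flip_in_image_iff 1(1) 2)
qed

section \<open>Representatives of the points and the configurations excluded by the quartic
  relation\<close>

lemma multiple_of_base:
  assumes "zeros u = A" "card A = 2" "u \<noteq> (\<lambda>_. 0)" "b \<noteq> (\<lambda>_. 0)" "A \<subseteq> zeros b"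
  obtains c where "c \<noteq> 0" "u = (\<lambda>x. c * b x)"
proof -
  obtain c where "c \<noteq> 0" "b = (\<lambda>x. c * u x)"
    using same_zeros[of u b] assms by auto
  then show ?thesis
    by (intro that[of "1 / c"]) auto
qed

lemma base_nonzero:
  "vec3 0 1 (- 1) \<noteq> (\<lambda>_. 0 :: 'k)" "vec3 1 0 0 \<noteq> (\<lambda>_. 0 :: 'k)" "vec3 1 1 1 \<noteq> (\<lambda>_. 0 :: 'k)"
  "vec3 (- z) 0 1 \<noteq> (\<lambda>_. 0)" "vec3 (1 + z) 0 1 \<noteq> (\<lambda>_. 0)"
  "vec3 (- z) 1 0 \<noteq> (\<lambda>_. 0)" "vec3 (1 + z) 1 0 \<noteq> (\<lambda>_. 0)"
  by (simp_all add: fun_eq_iff all_three)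

lemma zeros_base:
  "{Inl 0, Inr 0} \<subseteq> zeros (vec3 0 1 (- 1))" "{Inl 1, Inl 2} \<subseteq> zeros (vec3 1 0 0)"
  "{Inr 1, Inr 2} \<subseteq> zeros (vec3 1 1 1)"
  "{Inl 1, Inr 2} \<subseteq> zeros (vec3 (- z) 0 1)" "{Inl 1, Inr 1} \<subseteq> zeros (vec3 (1 + z) 0 1)"
  "{Inl 2, Inr 1} \<subseteq> zeros (vec3 (- z) 1 0)" "{Inl 2, Inr 2} \<subseteq> zeros (vec3 (1 + z) 1 0)"
  by (simp_all add: zeros_def L_Inr_simps z2 algebra_simps del: L.simps(2))

lemma one_plus_2z_nonzero: "1 + 2 * z \<noteq> 0"
proof
  assume "1 + 2 * z = 0"
  moreover have "(1 + 2 * z) * (1 + 2 * z) = - 3"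
    by (simp add: zz zzx algebra_simps)
  ultimately show False by simp
qed

text \<open>Here \<open>u\<close> and \<open>t\<close> are multiples of \<open>vec3 1 0 0\<close>.
  The cubic relations give \<open>v 1 * w 1 = - (v 2 * w 2)\<close> and the quartic one
  \<open>v 1 * w 1 = v 2 * w 2\<close>, while the partition forbids \<open>v\<close> and
  \<open>w\<close> to vanish at 1.\<close>

lemma not_good4_coordinates:
  assumes "good4 u v w t" "zeros u = {Inl 1, Inl 2}"
  shows False
proof -
  have nz: "u \<noteq> (\<lambda>_. 0)" "v \<noteq> (\<lambda>_. 0)" "w \<noteq> (\<lambda>_. 0)" "t \<noteq> (\<lambda>_. 0)"
    and cub: "cubic u v w" "cubic v w t" and Q: "quartic u v w t = 0"
    using assms(1) by (auto simp: good4_def)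
  obtain c where c: "c \<noteq> 0" "u = (\<lambda>x. c * vec3 1 0 0 x)"
    using multiple_of_base[OF assms(2) _ nz(1) base_nonzero(2) zeros_base(2)] by auto
  have "zeros t = {Inl 1, Inl 2}"
    using zeros_fourth[OF cub nz] assms(2) by simp
  then obtain d where d: "d \<noteq> 0" "t = (\<lambda>x. d * vec3 1 0 0 x)"
    using multiple_of_base[OF _ _ nz(4) base_nonzero(2) zeros_base(2)] by auto
  have "Inl 1 \<notin> zeros v" "Inl 1 \<notin> zeros w"
    using cubic_partition(4,5)[OF cub(1) nz(1-3)] assms(2) by (auto simp: flip_in_image_iff)
  then have "v 1 * w 1 \<noteq> 0"
    by (simp add: zeros_def)
  have "conv u v w 0 = 0" "u 0 * v 0 * w 0 = 0"
    using cub(1) by (auto simp: cubic_iff)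
  moreover have "conv u v w 0 = c * (v 0 * w 0 + v 1 * w 1 + v 2 * w 2)" "u 0 * v 0 * w 0 = c * (v 0 * w 0)"
    unfolding conv_def c by (simp_all add: sum_three three_arith algebra_simps)
  ultimately have "v 0 * w 0 + v 1 * w 1 + v 2 * w 2 = 0" "v 0 * w 0 = 0"
    using c(1) by (metis mult_eq_0_iff)+
  then have "v 1 * w 1 + v 2 * w 2 = 0"
    by (metis add_0)
  moreover have "quartic u v w t = c * d * 3 * (v 1 * w 1 - v 2 * w 2)"
    unfolding quartic_def c d by (simp add: sum_three three_arith quartic_coeff_def algebra_simps)
  ultimately have "2 * (v 1 * w 1) = 0"
    using Q c d by (simp add: eq_neg_iff_add_eq_0)
  then show False using \<open>v 1 * w 1 \<noteq> 0\<close> by simp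
qed

text \<open>Now \<open>u\<close> and \<open>t\<close> are constant, and the cyclic correlations
  \<open>C0\<close>, \<open>C1\<close>, \<open>C2\<close> of \<open>v\<close> and \<open>w\<close>
  replace the pointwise products. The relations make all three vanish, and with them the product of
  Fourier coefficients in \<open>ne\<close>, which the partition keeps non-zero.\<close>

lemma not_good4_fourier:
  assumes "good4 u v w t" "zeros u = {Inr 1, Inr 2}"
  shows False
proof -
  have nz: "u \<noteq> (\<lambda>_. 0)" "v \<noteq> (\<lambda>_. 0)" "w \<noteq> (\<lambda>_. 0)" "t \<noteq> (\<lambda>_. 0)"
    and cub: "cubic u v w" "cubic v w t" and Q: "quartic u v w t = 0"
    using assms(1) by (auto simp: good4_def)
  obtain c where c: "c \<noteq> 0" "u = (\<lambda>x. c * vec3 1 1 1 x)"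
    using multiple_of_base[OF assms(2) _ nz(1) base_nonzero(3) zeros_base(3)] by auto
  have "zeros t = {Inr 1, Inr 2}"
    using zeros_fourth[OF cub nz] assms(2) by (auto simp: three_arith)
  then obtain d where d: "d \<noteq> 0" "t = (\<lambda>x. d * vec3 1 1 1 x)"
    using multiple_of_base[OF _ _ nz(4) base_nonzero(3) zeros_base(3)] by auto
  have "flip (Inr 1) \<notin> zeros v" "Inr 1 \<notin> zeros w"
    using cubic_partition(4,5)[OF cub(1) nz(1-3)] assms(2) by (auto simp: flip_in_image_iff)
  then have ne: "L (Inr 2) v * L (Inr 1) w \<noteq> 0"
    by (simp add: zeros_def three_arith del: L.simps)
  define C0 C1 C2 where "C0 = v 0 * w 0 + v 1 * w 1 + v 2 * w 2"
    and "C1 = v 0 * w 1 + v 1 * w 2 + v 2 * w 0" and "C2 = v 0 * w 2 + v 1 * w 0 + v 2 * w 1"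
  have "u s * v s * w s = 0" for s
    using cub(1) by (auto simp: cubic_iff)
  moreover have "u s = c" for s
    using c three_cases[of s] by auto
  ultimately have vw: "v s * w s = 0" for s
    using c(1) by simp
  have C0: "C0 = 0"
    by (simp only: C0_def vw add_0_right)
  have "conv u v w 0 = 0"
    using cub(1) by (auto simp: cubic_iff)
  moreover have "conv u v w 0 = c * (C0 + C1 + C2)"
    unfolding conv_def c C0_def C1_def C2_def by (simp add: sum_three three_arith algebra_simps)
  ultimately have "C1 = - C2"
    using c C0 by (simp add: eq_neg_iff_add_eq_0)
  moreover have "quartic u v w t = c * d * 3 * (1 + 2 * z) * (C1 - C2)"
    unfolding quartic_def c d C1_def C2_def by (simp add: sum_three three_arith quartic_coeff_def algebra_simps)
  then have "C1 = C2"
    using Q c d one_plus_2z_nonzero by simp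
  ultimately have "C1 = 0" "C2 = 0"
    by (simp_all add: eq_neg_iff_add_eq_0 flip: mult_2)
  moreover have "L (Inr 2) v * L (Inr 1) w = C0 + z * C1 + z\<^sup>2 * C2"
    unfolding L_Inr_simps C0_def C1_def C2_def by (simp add: z2 zz zzx algebra_simps)
  ultimately show False
    using ne C0 by simp
qed

text \<open>All four vectors are known up to scalars, so the quartic relation becomes a single
  number, a non-zero multiple of \<open>1 + 2 * z\<close>. After the flip the excluded second pairs
  are \<open>{Inl 1, Inr 2}\<close> and \<open>{Inl 2, Inr 1}\<close>.\<close>

lemma not_good4_mixed:
  assumes "good4 u v w t" "zeros u = {Inl 0, Inr 0}"
  shows "zeros v \<noteq> {Inl 1, Inr 1}" "zeros v \<noteq> {Inl 2, Inr 2}"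
proof -
  have nz: "u \<noteq> (\<lambda>_. 0)" "v \<noteq> (\<lambda>_. 0)" "w \<noteq> (\<lambda>_. 0)" "t \<noteq> (\<lambda>_. 0)"
    and cub: "cubic u v w" "cubic v w t" and Q: "quartic u v w t = 0"
    using assms(1) by (auto simp: good4_def)
  obtain c where c: "c \<noteq> 0" "u = (\<lambda>x. c * vec3 0 1 (- 1) x)"
    using multiple_of_base[OF assms(2) _ nz(1) base_nonzero(1) zeros_base(1)] by auto
  have "zeros t = {Inl 0, Inr 0}"
    using zeros_fourth[OF cub nz] assms(2) by auto
  then obtain d where d: "d \<noteq> 0" "t = (\<lambda>x. d * vec3 0 1 (- 1) x)"
    using multiple_of_base[OF _ _ nz(4) base_nonzero(1) zeros_base(1)] by auto
  have zw: "zeros w = - ({Inl 0, Inr 0} \<union> flip ` zeros v)"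
    using cubic_partition(5)[OF cub(1) nz(1-3)] assms(2) by simp
  show "zeros v \<noteq> {Inl 1, Inr 1}"
  proof
    assume v: "zeros v = {Inl 1, Inr 1}"
    have "zeros w = {Inl 2, Inr 1}"
      unfolding zw v by (auto simp: set_eq_iff all_sum all_three three_arith)
    then obtain b where b: "b \<noteq> 0" "w = (\<lambda>x. b * vec3 (- z) 1 0 x)"
      using multiple_of_base[OF _ _ nz(3) base_nonzero(6) zeros_base(6)] by auto
    obtain a where a: "a \<noteq> 0" "v = (\<lambda>x. a * vec3 (1 + z) 0 1 x)"
      using multiple_of_base[OF v _ nz(2) base_nonzero(5) zeros_base(5)] by auto
    have "quartic u v w t = c * d * a * b * 3 * (1 + 2 * z)"
      unfolding quartic_def a b c d by (simp add: sum_three three_arith quartic_coeff_def z2 zz zzx algebra_simps)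
    then show False
      using Q a b c d one_plus_2z_nonzero by simp
  qed
  show "zeros v \<noteq> {Inl 2, Inr 2}"
  proof
    assume v: "zeros v = {Inl 2, Inr 2}"
    have "zeros w = {Inl 1, Inr 2}"
      unfolding zw v by (auto simp: set_eq_iff all_sum all_three three_arith)
    then obtain b where b: "b \<noteq> 0" "w = (\<lambda>x. b * vec3 (- z) 0 1 x)"
      using multiple_of_base[OF _ _ nz(3) base_nonzero(4) zeros_base(4)] by auto
    obtain a where a: "a \<noteq> 0" "v = (\<lambda>x. a * vec3 (1 + z) 1 0 x)"
      using multiple_of_base[OF v _ nz(2) base_nonzero(7) zeros_base(7)] by auto
    have "quartic u v w t = c * d * a * b * (- 3) * (1 + 2 * z)"
      unfolding quartic_def a b c d by (simp add: sum_three three_arith quartic_coeff_def z2 zz zzx algebra_simps)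
    then show False
      using Q a b c d one_plus_2z_nonzero by simp
  qed
qed

text \<open>The admissible second pairs for the first pair \<open>{Inl 0, Inr 0}\<close>.\<close>

definition base_pairs :: "(3 + 3) set set" where
  "base_pairs = {{Inl 1, Inl 2}, {Inr 1, Inr 2}, {Inl 1, Inr 1}, {Inl 2, Inr 2}}"

text \<open>Each of the 9 mixed first pairs is the image of \<open>{Inl 0, Inr 0}\<close> under
  exactly one shift; the admissible second pairs are shifted along.\<close>

fun quad_pair :: "3 \<times> 3 \<times> (3 + 3) set \<Rightarrow> (3 + 3) set \<times> (3 + 3) set" where
  "quad_pair (i, k, B) = ({Inl i, Inr k}, sh i k ` B)"

definition quad_pairs :: "((3 + 3) set \<times> (3 + 3) set) set" where
  "quad_pairs = quad_pair ` (UNIV \<times> UNIV \<times> base_pairs)"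

lemma card_quad_pairs: "card quad_pairs = 36"
proof -
  have "inj_on quad_pair (UNIV \<times> UNIV \<times> base_pairs)"
  proof (rule inj_onI)
    fix P P' assume eq: "quad_pair P = quad_pair P'"
    obtain i k B i' k' B' where P: "P = (i, k, B)" "P' = (i', k', B')"
      by (metis prod_cases3)
    then have "i = i'" "k = k'"
      using eq by auto
    moreover from this have "B = B'"
      using eq P bij_sh[of i k] by (simp add: inj_image_eq_iff bij_is_inj)
    ultimately show "P = P'" using P by simp
  qed
  moreover have "card base_pairs = 4"
    by (simp add: base_pairs_def doubleton_eq_iff)
  ultimately show ?thesis
    by (simp add: quad_pairs_def card_image card_cartesian_product)
qed

lemma quad_pairs_subset_pairs: "quad_pairs \<subseteq> pairs"
proof -
  have "quad_pair (i, k, B) \<in> pairs" if "B \<in> base_pairs" for i k B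
  proof -
    have "B \<subseteq> - {Inl 0, Inr 0}" "card B = 2"
      using that by (auto simp: base_pairs_def)
    moreover have "Inl i = sh i k (Inl 0)" "Inr k = sh i k (Inr 0)"
      by simp_all
    ultimately have "sh i k ` B \<subseteq> - {Inl i, Inr k}"
      using bij_is_inj[OF bij_sh[of i k]] by (auto simp: inj_def simp del: sh.simps)
    moreover have "card (sh i k ` B) = 2"
      using bij_is_inj[OF bij_sh[of i k]] \<open>card B = 2\<close> by (simp add: card_image inj_on_subset)
    ultimately show ?thesis by (simp add: pairs_def)
  qed
  then show ?thesis
    unfolding quad_pairs_def by auto
qed

text \<open>A twist moves the first pair to a standard position, where the exclusions apply: the
  elements 1 and 2 of one side if it is not mixed, the two zeros otherwise.\<close>

lemma quad_pairs_of_good4: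
  assumes "good4 u v w t"
  shows "(zeros u, flip ` zeros v) \<in> quad_pairs"
proof -
  have nz: "u \<noteq> (\<lambda>_. 0)" "v \<noteq> (\<lambda>_. 0)" "w \<noteq> (\<lambda>_. 0)" and cub: "cubic u v w"
    using assms by (auto simp: good4_def)
  have tw: "good4 (tw s m u) (tw s (- m) v) (tw s m w) (tw s (- m) t)" for s m
    using assms by (simp add: good4_tw)
  obtain i j where ij: "zeros u = {i, j}" "i \<noteq> j"
    using cubic_partition(1)[OF cub nz] by (auto simp: card_2_iff)
  \<comment> \<open>The shift \<open>c\<close> is the residue missing from the pair.\<close>
  have third: "\<exists>c. {a, b} = {1 + c, 2 + c}" if "a \<noteq> b" for a b :: 3
    using that three_cases[of a] three_cases[of b]
    by (auto intro: exI[of _ 0] exI[of _ 1] exI[of _ 2] simp: doubleton_eq_iff three_arith)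
  have False if i: "i = Inl a" and j: "j = Inl b" for a b
  proof -
    obtain c where "{a, b} = {1 + c, 2 + c}" using third[of a b] ij i j by auto
    then have "zeros u = sh c 0 ` {Inl 1, Inl 2}"
      using ij i j by auto
    then have "zeros (tw c 0 u) = {Inl 1, Inl 2}"
      unfolding zeros_tw using bij_sh[of c 0] by (simp only: inj_vimage_image_eq bij_is_inj)
    then show False using not_good4_coordinates[OF tw[of c 0]] by blast
  qed
  moreover have False if i: "i = Inr a" and j: "j = Inr b" for a b
  proof -
    obtain c where "{a, b} = {1 + c, 2 + c}" using third[of a b] ij i j by auto
    then have "zeros u = sh 0 c ` {Inr 1, Inr 2}"
      using ij i j by auto
    then have "zeros (tw 0 c u) = {Inr 1, Inr 2}"
      unfolding zeros_tw using bij_sh[of 0 c] by (simp only: inj_vimage_image_eq bij_is_inj)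
    then show False using not_good4_fourier[OF tw[of 0 c]] by blast
  qed
  ultimately obtain a b where ab: "zeros u = {Inl a, Inr b}"
    using ij by (cases i; cases j) (auto simp: insert_commute)
  let ?u = "tw a b u" and ?v = "tw a (- b) v" and ?w = "tw a b w"
  have "zeros u = sh a b ` {Inl 0, Inr 0}"
    using ab by simp
  then have u: "zeros ?u = {Inl 0, Inr 0}"
    unfolding zeros_tw using bij_sh[of a b] by (simp only: inj_vimage_image_eq bij_is_inj)
  have v: "flip ` zeros ?v \<subseteq> {Inl 1, Inl 2, Inr 1, Inr 2}" "card (flip ` zeros ?v) = 2"
  proof -
    have "cubic ?u ?v ?w" "?u \<noteq> (\<lambda>_. 0)" "?v \<noteq> (\<lambda>_. 0)" "?w \<noteq> (\<lambda>_. 0)"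
      using tw[of a b] by (auto simp: good4_def)
    note part = cubic_partition[OF this]
    show "card (flip ` zeros ?v) = 2"
      using part(2) by (simp add: card_flip_image)
    have "x \<in> {Inl 0, Inr 0, Inl 1, Inl 2, Inr 1, Inr 2}" for x :: "3 + 3"
      using three_cases by (cases x) auto
    moreover have "x \<notin> {Inl 0, Inr 0}" if "x \<in> flip ` zeros ?v" for x
      using part(4) that unfolding u by blast
    ultimately show "flip ` zeros ?v \<subseteq> {Inl 1, Inl 2, Inr 1, Inr 2}"
      by blast
  qed
  have "flip ` zeros ?v \<noteq> {Inl 1, Inr 2}" "flip ` zeros ?v \<noteq> {Inl 2, Inr 1}"
  proof -
    have "zeros ?v = flip ` flip ` zeros ?v" by (simp only: flip_image_flip_image)
    moreover have "flip ` {Inl 1, Inr 2} = {Inl 1, Inr 1}" "flip ` {Inl 2, Inr 1} = {Inl 2, Inr 2}"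
      by (simp_all add: three_arith)
    ultimately show "flip ` zeros ?v \<noteq> {Inl 1, Inr 2}" "flip ` zeros ?v \<noteq> {Inl 2, Inr 1}"
      using not_good4_mixed[OF tw[of a b] u] by metis+
  qed
  moreover obtain x y where "flip ` zeros ?v = {x, y}" "x \<noteq> y"
    using v(2) by (auto simp: card_2_iff)
  ultimately have "flip ` zeros ?v \<in> base_pairs"
    using v(1) by (auto simp: base_pairs_def doubleton_eq_iff)
  moreover have "flip ` zeros v = sh a b ` (flip ` zeros ?v)"
    unfolding flip_zeros_tw using bij_sh[of a b] by (simp only: surj_image_vimage_eq bij_is_surj)
  ultimately show ?thesis
    unfolding ab quad_pairs_def by (intro image_eqI[of _ _ "(a, b, flip ` zeros ?v)"]) auto
qed

text \<open>The alternating sum of the letters, an invariant of the braiding and so a source of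
  admissible weights in \<open>is_row_twist\<close>.\<close>

primrec alt :: "3 list \<Rightarrow> 3" where
  "alt [] = 0"
| "alt (x # xs) = x - alt xs"

lemma alt_braid: "alt (us @ aff3 x y # x # vs) = alt (us @ x # y # vs)"
  by (induction us) (simp_all add: aff3_def)

text \<open>Translating the letters back and multiplying by \<open>chi (- m * alt xs)\<close> undoes
  the twist: as the characters alternate in sign along the product, their combined value depends on
  the word only through \<open>alt\<close>.\<close>

lemma row_4_tw:
  assumes "row 4 (prod4 (tw s m u) (tw s (- m) v) (tw s m w) (tw s (- m) t))"
  shows "row 4 (prod4 u v w t)"
proof -
  let ?F = "prod4 (tw s m u) (tw s (- m) v) (tw s m w) (tw s (- m) t)"
  have "row 4 (\<lambda>xs. chi (- m * alt xs) * ?F (map (\<lambda>a. a - s) xs))"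
  proof (rule is_row_twist[OF _ _ _ assms])
    show "aff3 x y - s = aff3 (x - s) (y - s)" for x y
      by (simp add: aff3_def algebra_simps)
  qed (simp_all only: alt_braid)
  then show ?thesis
  proof (rule is_row_cong)
    fix xs :: "3 list" assume "length xs = 4"
    then obtain a b c d where xs: "xs = [a, b, c, d]"
      by (auto simp: length_4_iff)
    have "chi (- m * (a - (b - (c - d)))) * (chi (m * (a - s)) * chi (- m * (b - s)) * chi (m * (c - s)) * chi (- m * (d - s))) = 1"
      by (simp add: algebra_simps flip: chi_add)
    then have "chi (- m * (a - (b - (c - d)))) * (chi (m * (a - s)) * chi (- m * (b - s)) * chi (m * (c - s)) * chi (- m * (d - s)))
        * (u a * v b * w c * t d) = u a * v b * w c * t d" by simp
    then show "prod4 u v w t xs = chi (- m * alt xs) * ?F (map (\<lambda>a. a - s) xs)"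
      unfolding xs by (simp add: tw_def mult.assoc mult.left_commute)
  qed
qed

lemma row_4_multiple:
  assumes "row 4 (prod4 u v w t)"
  shows "row 4 (prod4 (\<lambda>x. a * u x) (\<lambda>x. b * v x) (\<lambda>x. c * w x) (\<lambda>x. d * t x))"
  by (rule is_row_cong[OF is_row_scale[OF assms, of "a * b * c * d"]]) (simp add: prod4_def)

lemma three_ne: "(1 :: 3) \<noteq> 2"
  by simp

lemma row_4_base:
  assumes nz: "u \<noteq> (\<lambda>_. 0)" "v \<noteq> (\<lambda>_. 0)" "w \<noteq> (\<lambda>_. 0)" "t \<noteq> (\<lambda>_. 0)"
    and u: "zeros u = {Inl 0, Inr 0}" and t: "zeros t = {Inl 0, Inr 0}"
    and v: "flip ` zeros v \<in> base_pairs" and w: "zeros w = - (zeros u \<union> flip ` zeros v)"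
  shows "row 4 (prod4 u v w t)"
proof -
  obtain a where a: "u = (\<lambda>x. a * vec3 0 1 (- 1) x)"
    using multiple_of_base[OF u _ nz(1) base_nonzero(1) zeros_base(1)] by auto
  obtain d where d: "t = (\<lambda>x. d * vec3 0 1 (- 1) x)"
    using multiple_of_base[OF t _ nz(4) base_nonzero(1) zeros_base(1)] by auto
  have zv: "zeros v = flip ` B" if "flip ` zeros v = B" for B
    using that by (metis flip_image_flip_image)
  consider "flip ` zeros v = {Inl 1, Inl 2}" | "flip ` zeros v = {Inr 1, Inr 2}"
    | "flip ` zeros v = {Inl 1, Inr 1}" | "flip ` zeros v = {Inl 2, Inr 2}"
    using v by (auto simp: base_pairs_def)
  then show ?thesis
  proof cases
    case 1
    have "zeros v = {Inl 1, Inl 2}" "zeros w = {Inr 1, Inr 2}"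
      unfolding zv[OF 1] w u 1 by (auto simp: set_eq_iff all_sum all_three three_arith)
    then obtain b c where "v = (\<lambda>x. b * vec3 1 0 0 x)" "w = (\<lambda>x. c * vec3 1 1 1 x)"
      using multiple_of_base[OF _ _ nz(2) base_nonzero(2) zeros_base(2)]
        multiple_of_base[OF _ _ nz(3) base_nonzero(3) zeros_base(3)] by (metis card_2_iff sum.inject three_ne)
    then show ?thesis
      unfolding a d using row_4_multiple[OF row_4_base_1] by simp
  next
    case 2
    have "zeros v = {Inr 1, Inr 2}" "zeros w = {Inl 1, Inl 2}"
      unfolding zv[OF 2] w u 2 by (auto simp: set_eq_iff all_sum all_three three_arith)
    then obtain b c where "v = (\<lambda>x. b * vec3 1 1 1 x)" "w = (\<lambda>x. c * vec3 1 0 0 x)"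
      using multiple_of_base[OF _ _ nz(2) base_nonzero(3) zeros_base(3)]
        multiple_of_base[OF _ _ nz(3) base_nonzero(2) zeros_base(2)] by (metis card_2_iff sum.inject three_ne)
    then show ?thesis
      unfolding a d using row_4_multiple[OF row_4_base_2] by simp
  next
    case 3
    have "zeros v = {Inl 1, Inr 2}" "zeros w = {Inl 2, Inr 2}"
      unfolding zv[OF 3] w u 3 by (auto simp: set_eq_iff all_sum all_three three_arith)
    then obtain b c where "v = (\<lambda>x. b * vec3 (- z) 0 1 x)" "w = (\<lambda>x. c * vec3 (1 + z) 1 0 x)"
      using multiple_of_base[OF _ _ nz(2) base_nonzero(4) zeros_base(4)]
        multiple_of_base[OF _ _ nz(3) base_nonzero(7) zeros_base(7)] by (metis card_2_iff sum.distinct(1))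
    then show ?thesis
      unfolding a d using row_4_multiple[OF row_4_base_3] by simp
  next
    case 4
    have "zeros v = {Inl 2, Inr 1}" "zeros w = {Inl 1, Inr 1}"
      unfolding zv[OF 4] w u 4 by (auto simp: set_eq_iff all_sum all_three three_arith)
    then obtain b c where "v = (\<lambda>x. b * vec3 (- z) 1 0 x)" "w = (\<lambda>x. c * vec3 (1 + z) 0 1 x)"
      using multiple_of_base[OF _ _ nz(2) base_nonzero(6) zeros_base(6)]
        multiple_of_base[OF _ _ nz(3) base_nonzero(5) zeros_base(5)] by (metis card_2_iff sum.distinct(1))
    then show ?thesis
      unfolding a d using row_4_multiple[OF row_4_base_4] by simp
  qed
qed

lemma row_4_of_quad_pair:
  assumes nz: "u \<noteq> (\<lambda>_. 0)" "v \<noteq> (\<lambda>_. 0)" "w \<noteq> (\<lambda>_. 0)" "t \<noteq> (\<lambda>_. 0)"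
    and pair: "(zeros u, flip ` zeros v) \<in> quad_pairs"
    and w: "zeros w = - (zeros u \<union> flip ` zeros v)" and t: "zeros t = flip ` zeros u"
  shows "row 4 (prod4 u v w t)"
proof -
  obtain i k B where B: "B \<in> base_pairs" "zeros u = {Inl i, Inr k}" "flip ` zeros v = sh i k ` B"
    using pair by (auto simp: quad_pairs_def)
  have "zeros u = sh i k ` {Inl 0, Inr 0}" "flip ` zeros t = sh i k ` {Inl 0, Inr 0}"
    using B(2) t by simp_all
  then have zu: "zeros (tw i k u) = {Inl 0, Inr 0}" and "flip ` zeros (tw i (- k) t) = {Inl 0, Inr 0}"
    and zv: "flip ` zeros (tw i (- k) v) = B"
    unfolding flip_zeros_tw B(3) unfolding zeros_tw using bij_sh[of i k] by (simp_all only: inj_vimage_image_eq bij_is_inj)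
  then have "zeros (tw i (- k) t) = flip ` {Inl 0, Inr 0}"
    by (metis flip_image_flip_image)
  then have zt: "zeros (tw i (- k) t) = {Inl 0, Inr 0}"
    by simp
  have zw: "zeros (tw i k w) = - (zeros (tw i k u) \<union> flip ` zeros (tw i (- k) v))"
    unfolding flip_zeros_tw unfolding zeros_tw w by auto
  have "row 4 (prod4 (tw i k u) (tw i (- k) v) (tw i k w) (tw i (- k) t))"
    using nz B(1) by (intro row_4_base zu zt zw) (simp_all add: tw_eq_0_iff zv)
  then show ?thesis
    by (rule row_4_tw)
qed

end

section \<open>Point paths of length four and the absence of longer ones\<close>

lemma is_point_path_mono: "m \<le> n \<Longrightarrow> is_point_path r q n lam \<Longrightarrow> is_point_path r q m lam"
  unfolding is_point_path_def by (meson le_trans less_le_trans)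

lemma is_point_path_shift:
  assumes "is_point_path r q (Suc n) lam"
  shows "is_point_path r q n (\<lambda>j. lam (Suc j))"
proof -
  have weight: "word_weight (\<lambda>j. lam (Suc j)) j xs = word_weight lam (Suc j) xs" for j xs
    by (induction xs) simp_all
  have "pairing (word_weight lam (Suc j)) f = 0" if "j + k \<le> n" "f \<in> qsym_kernel r q k" for j k f
    using assms that unfolding is_point_path_def by (metis Suc_le_mono add_Suc)
  then show ?thesis
    using assms by (simp add: is_point_path_def weight[abs_def])
qed

context zeta3
begin

lemma good4_of_path: "path 4 lam \<Longrightarrow> good4 (lam 3) (lam 2) (lam 1) (lam 0)"
  unfolding path_4_iff good4_def using quartic_eq_0 by simp

text \<open>Extends \<open>triple\<close> by the point of degree 0, the last tensor factor, whose
  zeros are prescribed by \<open>zeros_fourth\<close>.\<close>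

fun quadruple :: "(3 + 3) set \<times> (3 + 3) set \<Rightarrow> (3 \<Rightarrow> 'k) set list" where
  "quadruple (A, B) = map proj_point [pt (flip ` A), pt (- (A \<union> B)), pt (flip ` B), pt A]"

lemma inj_on_quadruple: "inj_on quadruple quad_pairs"
proof (rule inj_on_subset[OF _ quad_pairs_subset_pairs], rule inj_onI)
  fix P P' assume *: "P \<in> pairs" "P' \<in> pairs" "quadruple P = quadruple P'"
  have "triple P = tl (quadruple P)" for P
    by (cases P) simp
  then show "P = P'"
    using * inj_on_triple by (metis inj_onD)
qed

lemma paths_4: "{map (\<lambda>j. proj_point (lam j)) [0..<4] |lam. path 4 lam} = quadruple ` quad_pairs"
proof (intro equalityI subsetI)
  fix ps assume "ps \<in> {map (\<lambda>j. proj_point (lam j)) [0..<4] |lam. path 4 lam}"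
  then obtain lam where lam: "path 4 lam" "ps = map (\<lambda>j. proj_point (lam j)) [0..<4]" by blast
  have good: "good4 (lam 3) (lam 2) (lam 1) (lam 0)"
    by (rule good4_of_path[OF lam(1)])
  then have nz: "lam 3 \<noteq> (\<lambda>_. 0)" "lam 2 \<noteq> (\<lambda>_. 0)" "lam 1 \<noteq> (\<lambda>_. 0)" "lam 0 \<noteq> (\<lambda>_. 0)"
    and cub: "cubic (lam 3) (lam 2) (lam 1)" "cubic (lam 2) (lam 1) (lam 0)"
    by (auto simp: good4_def)
  have "ps = quadruple (zeros (lam 3), flip ` zeros (lam 2))"
    using triple_of_cubic(2)[OF cub(1) nz(1-3)] zeros_fourth[OF cub nz] proj_point_pt[OF nz(4)]
      cubic_partition(3)[OF cub(2) nz(2-4)]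
    by (simp add: lam(2) upt_rec numeral_2_eq_2 numeral_3_eq_3)
  then show "ps \<in> quadruple ` quad_pairs"
    using quad_pairs_of_good4[OF good] by blast
next
  fix ps assume "ps \<in> quadruple ` quad_pairs"
  then obtain A B where AB: "(A, B) \<in> quad_pairs" "ps = quadruple (A, B)" by auto
  let ?u = "pt A" and ?v = "pt (flip ` B)" and ?w = "pt (- (A \<union> B))" and ?t = "pt (flip ` A)"
  define lam where "lam j = [?t, ?w, ?v, ?u] ! j" for j
  have lam: "lam 0 = ?t" "lam 1 = ?w" "lam 2 = ?v" "lam 3 = ?u"
    by (simp_all add: lam_def numeral_2_eq_2 numeral_3_eq_3)
  have pair: "(A, B) \<in> pairs"
    using AB quad_pairs_subset_pairs by blast
  have card: "card A = 2" "card (flip ` B) = 2" "card (- (A \<union> B)) = 2" "card (flip ` A) = 2"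
    using pair card_compl_pairs[OF pair] by (auto simp: pairs_def card_flip_image)
  \<comment> \<open>The flip of the partition given by \<open>A\<close> and \<open>B\<close>, which
    is the second cubic condition.\<close>
  have "flip ` B \<union> flip ` (- (A \<union> B)) \<union> flip ` A = UNIV"
    by (auto simp: set_eq_iff flip_in_image_iff)
  then have "cubic ?v ?w ?t"
    by (simp only: cubic_def pt(2)[OF card(2)] pt(2)[OF card(3)] pt(2)[OF card(4)])
  moreover have "row 4 (prod4 ?u ?v ?w ?t)"
    using AB(1) by (intro row_4_of_quad_pair pt(1))
      (simp_all only: pt(2)[OF card(1)] pt(2)[OF card(2)] pt(2)[OF card(3)] pt(2)[OF card(4)] card
        flip_image_flip_image)
  moreover have "\<forall>j<4. lam j \<noteq> (\<lambda>_. 0)"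
  proof (intro allI impI)
    fix j :: nat assume "j < 4"
    then have "j = 0 \<or> j = 1 \<or> j = 2 \<or> j = 3" by linarith
    then show "lam j \<noteq> (\<lambda>_. 0)"
      by (elim disjE) (simp_all only: lam pt(1)[OF card(1)] pt(1)[OF card(2)] pt(1)[OF card(3)]
        pt(1)[OF card(4)] not_False_eq_True)
  qed
  ultimately have "path 4 lam"
    unfolding path_4_iff lam using cubic_pt[OF pair] pairing_is_row by blast
  moreover have "ps = map (\<lambda>j. proj_point (lam j)) [0..<4]"
    by (simp add: AB lam_def upt_rec numeral_2_eq_2 numeral_3_eq_3)
  ultimately show "ps \<in> {map (\<lambda>j. proj_point (lam j)) [0..<4] |lam. path 4 lam}" by blast
qed

text \<open>In the mixed base pairs \<open>{Inl 1, Inr 1}\<close> and \<open>{Inl 2, Inr 2}\<close>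
  coordinate and frequency differ from 0 by the same amount \<open>e\<close>, and shifting both
  pairs preserves these differences.\<close>

lemma quad_pairs_mixed:
  assumes "(A, {Inl i, Inr k}) \<in> quad_pairs"
  obtains e where "e \<noteq> 0" "A = {Inl (i - e), Inr (k - e)}"
proof -
  obtain i' k' B where B: "B \<in> base_pairs" "A = {Inl i', Inr k'}" "{Inl i, Inr k} = sh i' k' ` B"
    using assms by (auto simp: quad_pairs_def)
  then have "(i = i' + 1 \<and> k = k' + 1) \<or> (i = i' + 2 \<and> k = k' + 2)"
    by (auto simp: base_pairs_def doubleton_eq_iff)
  then show ?thesis
    using that[of 1] that[of 2] B(2) by auto
qed

lemma no_path_5: "\<not> path 5 lam"
proof
  assume "path 5 lam"
  then have path: "path (Suc 4) lam" by simp
  have "path 4 lam" "path 4 (\<lambda>j. lam (Suc j))"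
    using is_point_path_mono[OF _ path] is_point_path_shift[OF path] by auto
  then have good: "good4 (lam 3) (lam 2) (lam 1) (lam 0)" "good4 (lam 4) (lam 3) (lam 2) (lam 1)"
    using good4_of_path[of lam] good4_of_path[of "\<lambda>j. lam (Suc j)"] by (simp_all add: numeral_eq_Suc)
  let ?u = "lam 4" and ?v = "lam 3" and ?w = "lam 2"
  have part: "zeros ?w = - (zeros ?u \<union> flip ` zeros ?v)"
    using good(2) cubic_partition(5)[of ?u ?v ?w] by (simp add: good4_def)
  obtain i k where v: "zeros ?v = {Inl i, Inr k}"
    using quad_pairs_of_good4[OF good(1)] by (auto simp: quad_pairs_def)
  then have "(zeros ?u, {Inl i, Inr (- k)}) \<in> quad_pairs"
    using quad_pairs_of_good4[OF good(2)] by simp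
  then obtain e where e: "e \<noteq> 0" "zeros ?u = {Inl (i - e), Inr (- k - e)}"
    by (rule quad_pairs_mixed)
  \<comment> \<open>On either side the third pair consists of the residue left over by the first
    two: \<open>i\<close> and \<open>i - e\<close> leave \<open>i + e\<close>, and likewise for the
    frequencies. The flip then turns the equal shifts into the opposite shifts \<open>e\<close> and
    \<open>- e\<close>.\<close>
  have "flip ` zeros ?w = {Inl (i + e), Inr (k - e)}"
  proof -
    have "s \<noteq> a \<and> s \<noteq> a - e \<longleftrightarrow> s = a + e" for s a
    proof -
      have "s - a \<noteq> 0 \<and> s - a \<noteq> - e \<longleftrightarrow> s - a = e"
        using e(1) three_cases[of "s - a"] three_cases[of e] by (auto simp: three_arith)
      then show ?thesis by (auto simp: algebra_simps)
    qed
    then have "zeros ?w = {Inl (i + e), Inr (- k + e)}"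
      unfolding part e v by (auto simp: set_eq_iff all_sum)
    then show ?thesis by simp
  qed
  then have "(zeros ?v, {Inl (i + e), Inr (k - e)}) \<in> quad_pairs"
    using quad_pairs_of_good4[OF good(1)] by simp
  then obtain e' where "e' \<noteq> 0" "zeros ?v = {Inl (i + e - e'), Inr (k - e - e')}"
    by (rule quad_pairs_mixed)
  \<comment> \<open>Coordinates give \<open>e = e'\<close> and frequencies
    \<open>e + e' = 0\<close>, so that \<open>2 * e = 0\<close> and thus \<open>e = 0\<close> modulo
    3.\<close>
  then have "e + e' = 0" "e = e'" "e' \<noteq> 0"
    using v by (auto simp: doubleton_eq_iff algebra_simps)
  then show False
    using three_cases[of e] by (auto simp: three_arith)
qed

lemma no_path: "5 \<le> n \<Longrightarrow> \<not> path n lam"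
  using no_path_5[of lam] is_point_path_mono[of 5 n] by blast

lemma paths_2:
  "{map (\<lambda>j. proj_point (lam j)) [0..<2] |lam. path 2 lam} = {ps. length ps = 2 \<and> set ps \<subseteq> projective_space}"
proof (intro equalityI subsetI)
  fix ps :: "(3 \<Rightarrow> 'k) set list"
  assume "ps \<in> {map (\<lambda>j. proj_point (lam j)) [0..<2] |lam. path 2 lam}"
  then show "ps \<in> {ps. length ps = 2 \<and> set ps \<subseteq> projective_space}"
    by (auto simp: path_2_iff projective_space_def proj_point_def intro!: quotientI)
next
  fix ps :: "(3 \<Rightarrow> 'k) set list"
  assume ps: "ps \<in> {ps. length ps = 2 \<and> set ps \<subseteq> projective_space}"
  then have "\<exists>u. u \<noteq> (\<lambda>_. 0) \<and> ps ! j = proj_point u" if "j < 2" for j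
  proof -
    have "ps ! j \<in> {u. u \<noteq> (\<lambda>_. 0)} // proj_rel"
      using that ps nth_mem[of j ps] by (auto simp: projective_space_def)
    then show ?thesis
      by (rule quotientE) (auto simp: proj_point_def)
  qed
  then obtain lam where "\<And>j. j < 2 \<Longrightarrow> lam j \<noteq> (\<lambda>_. 0) \<and> ps ! j = proj_point (lam j)"
    by metis
  moreover from this have "ps = map (\<lambda>j. proj_point (lam j)) [0..<2]"
    using ps by (intro nth_equalityI) auto
  ultimately show "ps \<in> {map (\<lambda>j. proj_point (lam j)) [0..<2] |lam. path 2 lam}"
    unfolding path_2_iff by blast
qed

end

lemma point_paths_subset:
  "{map (\<lambda>j. proj_point (lam j)) [0..<n] |lam. is_point_path r q n lam} \<subseteq>
    {ps. length ps = n \<and> set ps \<subseteq> projective_space}"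
  by (auto simp: is_point_path_def projective_space_def proj_point_def intro!: quotientI)

theorem theorem1p5:
  fixes \<zeta> :: "'k::field_char_0"
    and q :: "3 \<Rightarrow> 3 \<Rightarrow> 'k"
  assumes "\<zeta> ^ 3 = 1" and "\<forall>k. 0 < k \<and> k < 3 \<longrightarrow> \<zeta> ^ k \<noteq> 1"
    and "q = (\<lambda>_ _. \<zeta>)"
  shows "bij_betw (point_sequence (nichols_gen aff3 q) 2) (Gamma (nichols_algebra aff3 q) 2)
           {ps. length ps = 2 \<and> set ps \<subseteq> projective_space}
       \<and> (\<exists>S \<subseteq> {ps. length ps = 3 \<and> set ps \<subseteq> projective_space}. card S = 90 \<and>
            bij_betw (point_sequence (nichols_gen aff3 q) 3) (Gamma (nichols_algebra aff3 q) 3) S)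
       \<and> (\<exists>S \<subseteq> {ps. length ps = 4 \<and> set ps \<subseteq> projective_space}. card S = 36 \<and>
            bij_betw (point_sequence (nichols_gen aff3 q) 4) (Gamma (nichols_algebra aff3 q) 4) S)
       \<and> (\<forall>n\<ge>5. Gamma (nichols_algebra aff3 q) n = {})"
proof -
  have "\<zeta> \<noteq> 1"
    using assms(2)[rule_format, of 1] by simp
  moreover have "(\<zeta> - 1) * (\<zeta>\<^sup>2 + \<zeta> + 1) = 0"
    using assms(1) by (simp add: algebra_simps power2_eq_square power3_eq_cube)
  ultimately interpret zeta3 \<zeta>
    by unfold_locales simp
  have bij: "bij_betw (point_sequence (nichols_gen aff3 q) n) (Gamma (nichols_algebra aff3 q) n)
      {map (\<lambda>j. proj_point (lam j)) [0..<n] |lam. path n lam}" for n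
    unfolding assms(3)
    by (rule bij_betw_point_sequence[OF is_rack_aff3 is_2cocycle_const[OF z_nonzero]])
  have "Gamma (nichols_algebra aff3 q) n = {}" if "5 \<le> n" for n
    using bij[of n] no_path[OF that] by (auto simp: bij_betw_def)
  moreover have "card (triple ` pairs) = 90" "card (quadruple ` quad_pairs) = 36"
    using card_image[OF inj_on_triple] card_image[OF inj_on_quadruple] card_pairs card_quad_pairs by simp_all
  moreover have "triple ` pairs \<subseteq> {ps. length ps = 3 \<and> set ps \<subseteq> projective_space}"
    "quadruple ` quad_pairs \<subseteq> {ps. length ps = 4 \<and> set ps \<subseteq> projective_space}"
    unfolding paths_3[symmetric] paths_4[symmetric] by (rule point_paths_subset)+
  ultimately show ?thesis
    using bij[of 2, unfolded paths_2] bij[of 3, unfolded paths_3] bij[of 4, unfolded paths_4] by blast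
qed

end
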